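(* Let $\mu:(\mathcal{M},\mathcal{F})\rightarrow(\mathcal{M}',\mathcal{F}')$ be a morphism of complex foliations, let $f'$ be a smooth function on $\mathcal{M}'$, and put $\mu^*f'=f'\circ\mu$. Then, for every $p$, there is a long exact sequence $$\cdots\longrightarrow H^{p,q-1}_{\mu^*f'}(\mathcal{F})\stackrel{\alpha^*}{\longrightarrow}H^{p,q}_{f'}(\mu)\stackrel{\beta^*}{\longrightarrow}H^{p,q}_{f'}(\mathcal{F}')\stackrel{\mu^*}{\longrightarrow}H^{p,q}_{\mu^*f'}(\mathcal{F})\stackrel{\alpha^*}{\longrightarrow}\cdots,$$ where $\alpha^*$ is induced by $\psi\mapsto(0,\psi)$, $\beta^*$ is induced by $(\varphi,\psi)\mapsto\varphi$, and $\mu^*$ is induced by the pullback of foliated forms.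
   Context: Complex foliation: $\mathcal{M}$ is a smooth manifold of dimension $2m+n$ with a foliation $\mathcal{F}$ of codimension $n$, defined by an open cover $\{U_i\}_{i\in I}$ of $\mathcal{M}$ and diffeomorphisms $\phi_i:\Omega_i\times\mathcal{O}_i\to U_i$ ($\Omega_i$ an open polydisc in $\mathbb{C}^m$, $\mathcal{O}_i$ an open ball in $\mathbb{R}^n$) such that, whenever $U_i\cap U_j\neq\emptyset$, the coordinate change $\phi_j^{-1}\circ\phi_i$ has the form $(z',x')=(\phi_{ij}^1(z,x),\phi_{ij}^2(x))$ with $\phi_{ij}^1(z,x)$ holomorphic in $z$ for fixed $x$. The leaves, locally given by $x=$ const, are complex manifolds of dimension $m$. The coordinates $(z,x)=(z^1,\ldots,z^m,x^1,\ldots,x^n)$ on $U_i$ given by $\phi_i^{-1}:U_i\to\Omega_i\times\mathcal{O}_i$ are called adapted. Likewise $\mathcal{M}'$ has dimension $2m'+n'$ and $\mathcal{F}'$ has leaves of complex dimension $m'$. A morphism $\mu:(\mathcal{M},\mathcal{F})\to(\mathcal{M}',\mathcal{F}')$ is a smooth map $\mathcal{M}\to\mathcal{M}'$ sending every leaf $F$ of $\mathcal{F}$ into a leaf $F'$ of $\mathcal{F}'$ such that the restriction $F\to F'$ is holomorphic. Foliated forms: $\Omega^{p,q}(\mathcal{F})$ is the space of foliated (leafwise) differential forms of type $(p,q)$, written in adapted coordinates as $\varphi=\sum\varphi_{A_p\overline{B}_q}(z,x)\,dz^{A_p}\wedge d\overline{z}^{B_q}$ with smooth complex-valued coefficients,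 where $dz^a,d\overline{z}^a$ are regarded as forms along the leaves (sections of the exterior algebra of the dual of $T\mathcal{F}\otimes\mathbb{C}$). It is $0$ unless $0\le p,q\le m$. A morphism $\mu$ induces a pullback $\mu^*:\Omega^{p,q}(\mathcal{F}')\to\Omega^{p,q}(\mathcal{F})$. The operator $\overline{\partial}_{\mathcal{F}}:\Omega^{p,q}(\mathcal{F})\to\Omega^{p,q+1}(\mathcal{F})$ is $\overline{\partial}_{\mathcal{F}}\varphi=\sum_{a=1}^m\sum\frac{\partial\varphi_{A_p\overline{B}_q}}{\partial\overline{z}^a}\,d\overline{z}^a\wedge dz^{A_p}\wedge d\overline{z}^{B_q}$. Smooth functions may be taken complex-valued. For a smooth function $f$ on $\mathcal{M}$, define $\overline{\partial}_{\mathcal{F},f}:\Omega^{p,q}(\mathcal{F})\to\Omega^{p,q+1}(\mathcal{F})$ by $\overline{\partial}_{\mathcal{F},f}\varphi=f\,\overline{\partial}_{\mathcal{F}}\varphi-(p+q)\,\overline{\partial}_{\mathcal{F}}f\wedge\varphi$. It satisfies $\overline{\partial}_{\mathcal{F},f}^2=0$. For fixed $p$, $H^{p,q}_f(\mathcal{F})$ denotes the degree-$q$ cohomology of the complex $(\Omega^{p,\bullet}(\mathcal{F}),\overline{\partial}_{\mathcal{F},f})$. The same definitions on $(\mathcal{M}',\mathcal{F}')$ give $\overline{\partial}'_{\mathcal{F}',f'}$ and $H^{p,q}_{f'}(\mathcal{F}')$. One has $\overline{\partial}_{\mathcal{F},\mu^*f'}\mu^*=\mu^*\overline{\partial}'_{\mathcal{F}',f'}$.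 Relative cohomology: put $\Omega^{p,q}_{\mathcal{F}}(\mu)=\Omega^{p,q}(\mathcal{F}')\oplus\Omega^{p,q-1}(\mathcal{F})$ and $\widetilde{\overline{\partial}}_{\mathcal{F}}(\varphi,\psi)=(\overline{\partial}'_{\mathcal{F}',f'}\varphi,\ \mu^*\varphi-\overline{\partial}_{\mathcal{F},\mu^*f'}\psi)$, so that $\widetilde{\overline{\partial}}_{\mathcal{F}}:\Omega^{p,q}_{\mathcal{F}}(\mu)\to\Omega^{p,q+1}_{\mathcal{F}}(\mu)$ and $\widetilde{\overline{\partial}}_{\mathcal{F}}^2=0$. For fixed $p$, $H^{p,q}_{f'}(\mu)$ denotes the degree-$q$ cohomology of this complex. *)

theory Defs
  imports "HOL-Analysis.Analysis" "HOL-Algebra.Coset" "HOL-Library.Function_Algebras"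
begin

section \<open>Coordinate spaces and smooth functions\<close>

text \<open>
  Dimensions are natural numbers that may be 0, so \<open>\<complex>\<^sup>m\<close> and \<open>\<real>\<^sup>n\<close> are rendered as sets of
  sequences vanishing from index \<open>m\<close> (resp. \<open>n\<close>) on.  The product topology on sequences induces
  the Euclidean topology on them.
\<close>

type_synonym pt = "(nat \<Rightarrow> complex) \<times> (nat \<Rightarrow> real)"

definition Cspace :: "nat \<Rightarrow> (nat \<Rightarrow> complex) set" where
  "Cspace m = {z. \<forall>a\<ge>m. z a = 0}"

definition Rspace :: "nat \<Rightarrow> (nat \<Rightarrow> real) set" where
  "Rspace n = {x. \<forall>k\<ge>n. x k = 0}"

definition open_polydisc :: "nat \<Rightarrow> (nat \<Rightarrow> complex) set \<Rightarrow> bool" where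
  "open_polydisc m D \<longleftrightarrow>
    (\<exists>c r. (\<forall>a<m. r a > (0::real)) \<and> D = {z \<in> Cspace m. \<forall>a<m. cmod (z a - c a) < r a})"

definition open_ball :: "nat \<Rightarrow> (nat \<Rightarrow> real) set \<Rightarrow> bool" where
  "open_ball n D \<longleftrightarrow>
    (\<exists>c r. r > 0 \<and> D = {x \<in> Rspace n. L2_set (\<lambda>k. x k - c k) {..<n} < r})"

datatype dir = DRe nat | DIm nat | DTr nat

definition dirs :: "nat \<Rightarrow> nat \<Rightarrow> dir set" where
  "dirs m n = DRe ` {..<m} \<union> DIm ` {..<m} \<union> DTr ` {..<n}"

fun move :: "dir \<Rightarrow> real \<Rightarrow> pt \<Rightarrow> pt" where
  "move (DRe a) t (z, x) = (z(a := z a + of_real t), x)"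
| "move (DIm a) t (z, x) = (z(a := z a + \<i> * of_real t), x)"
| "move (DTr k) t (z, x) = (z, x(k := x k + t))"

definition pd :: "dir \<Rightarrow> (pt \<Rightarrow> 'b::real_normed_vector) \<Rightarrow> pt \<Rightarrow> 'b" where
  "pd e F y = vector_derivative (\<lambda>t. F (move e t y)) (at 0)"

primrec ck_on :: "nat \<Rightarrow> nat \<Rightarrow> nat \<Rightarrow> pt set \<Rightarrow> (pt \<Rightarrow> 'b::real_normed_vector) \<Rightarrow> bool" where
  "ck_on 0 m n U F \<longleftrightarrow> continuous_on U F"
| "ck_on (Suc k) m n U F \<longleftrightarrow> continuous_on U F \<and>
     (\<forall>e\<in>dirs m n. (\<forall>y\<in>U. (\<lambda>t. F (move e t y)) differentiable (at 0)) \<and> ck_on k m n U (pd e F))"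

text \<open>Only used for sets \<open>U\<close> that are open in \<open>\<complex>\<^sup>m \<times> \<real>\<^sup>n\<close>.\<close>

definition smooth_on :: "nat \<Rightarrow> nat \<Rightarrow> pt set \<Rightarrow> (pt \<Rightarrow> 'b::real_normed_vector) \<Rightarrow> bool" where
  "smooth_on m n U F \<longleftrightarrow> (\<forall>k. ck_on k m n U F)"

text \<open>The operators \<open>\<partial>/\<partial>z\<^sup>a\<close> and \<open>\<partial>/\<partial>z\<bar>\<^sup>a\<close>.\<close>

definition wirt :: "nat \<Rightarrow> (pt \<Rightarrow> complex) \<Rightarrow> pt \<Rightarrow> complex" where
  "wirt a F y = (pd (DRe a) F y - \<i> * pd (DIm a) F y) / 2"

definition wirt_bar :: "nat \<Rightarrow> (pt \<Rightarrow> complex) \<Rightarrow> pt \<Rightarrow> complex" where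
  "wirt_bar a F y = (pd (DRe a) F y + \<i> * pd (DIm a) F y) / 2"

text \<open>Holomorphic functions of \<open>m\<close> variables, for \<open>W\<close> open in \<open>\<complex>\<^sup>m\<close>.\<close>

definition holomorphic_several ::
  "nat \<Rightarrow> (nat \<Rightarrow> complex) set \<Rightarrow> ((nat \<Rightarrow> complex) \<Rightarrow> complex) \<Rightarrow> bool" where
  "holomorphic_several m W h \<longleftrightarrow> continuous_on W h \<and>
     (\<forall>z\<in>W. \<forall>a<m. (\<lambda>t. h (z(a := t))) field_differentiable (at (z a)))"


section \<open>Complex foliations\<close>

record ('a, 'i) foliation =
  man :: "'a topology"
  idx :: "'i set"
  ldim :: nat                               \<comment> \<open>complex dimension of the leaves\<close>
  cdim :: nat                               \<comment> \<open>real codimension\<close>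
  ldom :: "'i \<Rightarrow> (nat \<Rightarrow> complex) set"
  tdom :: "'i \<Rightarrow> (nat \<Rightarrow> real) set"
  chart :: "'i \<Rightarrow> pt \<Rightarrow> 'a"

definition dom_ch :: "('a, 'i) foliation \<Rightarrow> 'i \<Rightarrow> pt set" where
  "dom_ch F i = ldom F i \<times> tdom F i"

definition img_ch :: "('a, 'i) foliation \<Rightarrow> 'i \<Rightarrow> 'a set" where
  "img_ch F i = chart F i ` dom_ch F i"

text \<open>The local expression \<open>\<phi>'\<^sub>j\<inverse> \<circ> h \<circ> \<phi>\<^sub>i\<close> of a map \<open>h\<close>, and where it is defined.\<close>

definition loc_dom ::
  "('a, 'i) foliation \<Rightarrow> ('b, 'j) foliation \<Rightarrow> ('a \<Rightarrow> 'b) \<Rightarrow> 'i \<Rightarrow> 'j \<Rightarrow> pt set" where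
  "loc_dom F F' h i j = {y \<in> dom_ch F i. h (chart F i y) \<in> img_ch F' j}"

definition loc ::
  "('a, 'i) foliation \<Rightarrow> ('b, 'j) foliation \<Rightarrow> ('a \<Rightarrow> 'b) \<Rightarrow> 'i \<Rightarrow> 'j \<Rightarrow> pt \<Rightarrow> pt" where
  "loc F F' h i j y = inv_into (dom_ch F' j) (chart F' j) (h (chart F i y))"

definition smooth_loc ::
  "('a, 'i) foliation \<Rightarrow> ('b, 'j) foliation \<Rightarrow> ('a \<Rightarrow> 'b) \<Rightarrow> 'i \<Rightarrow> 'j \<Rightarrow> bool" where
  "smooth_loc F F' h i j \<longleftrightarrow>
     (\<forall>b<ldim F'. smooth_on (ldim F) (cdim F) (loc_dom F F' h i j) (\<lambda>y. fst (loc F F' h i j y) b)) \<and>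
     (\<forall>k<cdim F'. smooth_on (ldim F) (cdim F) (loc_dom F F' h i j) (\<lambda>y. snd (loc F F' h i j y) k))"

text \<open>
  The smooth structure of the manifold is the one for which the \<open>\<phi>\<^sub>i\<close> are diffeomorphisms.  They
  cover the manifold, so it is determined by them, and it exists exactly when their coordinate
  changes are smooth.
\<close>

definition complex_foliation :: "('a, 'i) foliation \<Rightarrow> bool" where
  "complex_foliation F \<longleftrightarrow>
     Hausdorff_space (man F) \<and> second_countable (man F) \<and>
     (\<Union>i\<in>idx F. img_ch F i) = topspace (man F) \<and>
     (\<forall>i\<in>idx F. open_polydisc (ldim F) (ldom F i) \<and> open_ball (cdim F) (tdom F i) \<and>
        openin (man F) (img_ch F i) \<and>
        homeomorphic_map (top_of_set (dom_ch F i)) (subtopology (man F) (img_ch F i)) (chart F i)) \<and>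
     (\<forall>i\<in>idx F. \<forall>j\<in>idx F.
        smooth_loc F F id i j \<and>
        (\<exists>g. \<forall>(z, x)\<in>loc_dom F F id i j. snd (loc F F id i j (z, x)) = g x) \<and>
        (\<forall>x. \<forall>b<ldim F. holomorphic_several (ldim F) {z. (z, x) \<in> loc_dom F F id i j}
                (\<lambda>z. fst (loc F F id i j (z, x)) b)))"

definition plaque :: "('a, 'i) foliation \<Rightarrow> 'i \<Rightarrow> (nat \<Rightarrow> real) \<Rightarrow> 'a set" where
  "plaque F i x = chart F i ` (ldom F i \<times> {x})"

definition same_plaque :: "('a, 'i) foliation \<Rightarrow> ('a \<times> 'a) set" where
  "same_plaque F = {(p, q). \<exists>i\<in>idx F. \<exists>x\<in>tdom F i. p \<in> plaque F i x \<and> q \<in> plaque F i x}"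

definition leaves :: "('a, 'i) foliation \<Rightarrow> 'a set set" where
  "leaves F = {(same_plaque F)\<^sup>* `` {p} | p. p \<in> topspace (man F)}"

text \<open>
  The plaques contained in a leaf are the coordinate patches of its complex manifold structure
  (in particular they are open for the leaf topology, which may be finer than the topology induced
  by the ambient manifold); a map between leaves is holomorphic if it is so in these patches.
\<close>

definition leaf_holomorphic ::
  "('a, 'i) foliation \<Rightarrow> ('b, 'j) foliation \<Rightarrow> 'a set \<Rightarrow> 'b set \<Rightarrow> ('a \<Rightarrow> 'b) \<Rightarrow> bool" where
  "leaf_holomorphic F F' L L' h \<longleftrightarrow> h ` L \<subseteq> L' \<and>
     (\<forall>i\<in>idx F. \<forall>(z, x)\<in>dom_ch F i. chart F i (z, x) \<in> L \<longrightarrow>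
        (\<forall>j\<in>idx F'. \<forall>x'\<in>tdom F' j. h (chart F i (z, x)) \<in> plaque F' j x' \<longrightarrow>
          (\<exists>W. openin (top_of_set (Cspace (ldim F))) W \<and> z \<in> W \<and> W \<subseteq> ldom F i \<and>
             h ` chart F i ` (W \<times> {x}) \<subseteq> plaque F' j x' \<and>
             (\<forall>b<ldim F'. holomorphic_several (ldim F) W (\<lambda>w. fst (loc F F' h i j (w, x)) b)))))"

definition smooth_map ::
  "('a, 'i) foliation \<Rightarrow> ('b, 'j) foliation \<Rightarrow> ('a \<Rightarrow> 'b) \<Rightarrow> bool" where
  "smooth_map F F' h \<longleftrightarrow> continuous_map (man F) (man F') h \<and>
     (\<forall>i\<in>idx F. \<forall>j\<in>idx F'. smooth_loc F F' h i j)"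

definition foliation_morphism ::
  "('a, 'i) foliation \<Rightarrow> ('b, 'j) foliation \<Rightarrow> ('a \<Rightarrow> 'b) \<Rightarrow> bool" where
  "foliation_morphism F F' h \<longleftrightarrow> smooth_map F F' h \<and>
     (\<forall>L\<in>leaves F. \<exists>L'\<in>leaves F'. leaf_holomorphic F F' L L' h)"

definition smooth_function :: "('a, 'i) foliation \<Rightarrow> ('a \<Rightarrow> complex) \<Rightarrow> bool" where
  "smooth_function F f \<longleftrightarrow>
     (\<forall>i\<in>idx F. smooth_on (ldim F) (cdim F) (dom_ch F i) (\<lambda>y. f (chart F i y)))"


section \<open>Foliated forms\<close>

text \<open>
  \<open>(u, v)\<close> stands for the complexified leafwise tangent vector
  \<open>\<Sum>a<m. u a \<partial>/\<partial>z\<^sup>a + v a \<partial>/\<partial>z\<bar>\<^sup>a\<close>.  A form is a function of the list of its arguments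
  (a form of degree \<open>k\<close> being 0 on lists of other lengths), with the convention that the wedge
  product of covectors evaluates to a determinant.
\<close>

type_synonym cvec = "(nat \<Rightarrow> complex) \<times> (nat \<Rightarrow> complex)"
type_synonym altform = "cvec list \<Rightarrow> complex"
type_synonym 'i form = "'i \<Rightarrow> pt \<Rightarrow> altform"   \<comment> \<open>local expressions in all adapted charts\<close>

definition dz :: "nat \<Rightarrow> cvec \<Rightarrow> complex" where
  "dz a w = fst w a"

definition dz_bar :: "nat \<Rightarrow> cvec \<Rightarrow> complex" where
  "dz_bar a w = snd w a"

definition vz :: "nat \<Rightarrow> cvec" where
  "vz a = ((\<lambda>b. if b = a then 1 else 0), \<lambda>b. 0)"

definition vz_bar :: "nat \<Rightarrow> cvec" where
  "vz_bar a = ((\<lambda>b. 0), \<lambda>b. if b = a then 1 else 0)"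

definition wedge1 :: "(cvec \<Rightarrow> complex) \<Rightarrow> altform \<Rightarrow> altform" where
  "wedge1 \<theta> \<phi> ws = (\<Sum>r<length ws. (-1) ^ r * \<theta> (ws ! r) * \<phi> (take r ws @ drop (Suc r) ws))"

primrec wedge_list :: "(cvec \<Rightarrow> complex) list \<Rightarrow> altform" where
  "wedge_list [] = (\<lambda>ws. if ws = [] then 1 else 0)"
| "wedge_list (\<theta> # \<theta>s) = wedge1 \<theta> (wedge_list \<theta>s)"

text \<open>Increasing multi-indices of length \<open>p\<close>, as sets; there are none unless \<open>0 \<le> p \<le> m\<close>.\<close>

definition multi_index :: "nat \<Rightarrow> int \<Rightarrow> nat set set" where
  "multi_index m p = {A. A \<subseteq> {..<m} \<and> int (card A) = p}"

definition dzs :: "nat set \<Rightarrow> nat set \<Rightarrow> (cvec \<Rightarrow> complex) list" where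
  "dzs A B = map dz (sorted_list_of_set A) @ map dz_bar (sorted_list_of_set B)"

text \<open>The coefficient of \<open>dz\<^sup>A \<and> dz\<bar>\<^sup>B\<close> in an alternating form.\<close>

definition coeff_form :: "nat set \<Rightarrow> nat set \<Rightarrow> altform \<Rightarrow> complex" where
  "coeff_form A B \<phi> = \<phi> (map vz (sorted_list_of_set A) @ map vz_bar (sorted_list_of_set B))"

text \<open>
  The complexified leafwise differential at \<open>y\<close> of a map \<open>G\<close> between coordinate domains, \<open>m\<close> being
  the number of complex coordinates of the source; \<open>G\<close> is to map leaves into leaves.
\<close>

definition leaf_diff :: "nat \<Rightarrow> (pt \<Rightarrow> pt) \<Rightarrow> pt \<Rightarrow> cvec \<Rightarrow> cvec" where
  "leaf_diff m G y w =
    ((\<lambda>b. \<Sum>a<m. wirt a (\<lambda>y. fst (G y) b) y * fst w a + wirt_bar a (\<lambda>y. fst (G y) b) y * snd w a),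
     (\<lambda>b. \<Sum>a<m. wirt a (\<lambda>y. cnj (fst (G y) b)) y * fst w a
                 + wirt_bar a (\<lambda>y. cnj (fst (G y) b)) y * snd w a))"

text \<open>\<open>\<Omega>\<^sup>p\<^sup>,\<^sup>q(\<F>)\<close>.  Off the chart domains the values are irrelevant and normalised to 0.\<close>

definition foliated_forms :: "('a, 'i) foliation \<Rightarrow> int \<Rightarrow> int \<Rightarrow> 'i form set" where
  "foliated_forms F p q = {\<phi>.
     (\<forall>i\<in>idx F. \<exists>c.
        (\<forall>A\<in>multi_index (ldim F) p. \<forall>B\<in>multi_index (ldim F) q.
           smooth_on (ldim F) (cdim F) (dom_ch F i) (c A B)) \<and>
        (\<forall>y\<in>dom_ch F i. \<forall>ws. \<phi> i y ws =
           (\<Sum>A\<in>multi_index (ldim F) p. \<Sum>B\<in>multi_index (ldim F) q.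
              c A B y * wedge_list (dzs A B) ws))) \<and>
     (\<forall>i\<in>idx F. \<forall>j\<in>idx F. \<forall>y\<in>loc_dom F F id i j. \<forall>ws.
        \<phi> i y ws = \<phi> j (loc F F id i j y) (map (leaf_diff (ldim F) (loc F F id i j) y) ws)) \<and>
     (\<forall>i y. i \<notin> idx F \<or> y \<notin> dom_ch F i \<longrightarrow> \<phi> i y = (\<lambda>ws. 0))}"

definition dbar :: "('a, 'i) foliation \<Rightarrow> int \<Rightarrow> int \<Rightarrow> 'i form \<Rightarrow> 'i form" where
  "dbar F p q \<phi> i y ws =
     (if i \<in> idx F \<and> y \<in> dom_ch F i
      then \<Sum>a<ldim F. \<Sum>A\<in>multi_index (ldim F) p. \<Sum>B\<in>multi_index (ldim F) q.
             wirt_bar a (\<lambda>y. coeff_form A B (\<phi> i y)) y * wedge_list (dz_bar a # dzs A B) ws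
      else 0)"

definition dbar_fun ::
  "('a, 'i) foliation \<Rightarrow> ('a \<Rightarrow> complex) \<Rightarrow> 'i \<Rightarrow> pt \<Rightarrow> cvec \<Rightarrow> complex" where
  "dbar_fun F f i y w = (\<Sum>a<ldim F. wirt_bar a (\<lambda>y. f (chart F i y)) y * dz_bar a w)"

definition dbar_tw ::
  "('a, 'i) foliation \<Rightarrow> ('a \<Rightarrow> complex) \<Rightarrow> int \<Rightarrow> int \<Rightarrow> 'i form \<Rightarrow> 'i form" where
  "dbar_tw F f p q \<phi> i y ws =
     f (chart F i y) * dbar F p q \<phi> i y ws - of_int (p + q) * wedge1 (dbar_fun F f i y) (\<phi> i y) ws"

text \<open>For forms on the target the choice of the adapted chart \<open>j\<close> around \<open>h (\<phi>\<^sub>i y)\<close> is irrelevant.\<close>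

definition pullback ::
  "('a, 'i) foliation \<Rightarrow> ('b, 'j) foliation \<Rightarrow> ('a \<Rightarrow> 'b) \<Rightarrow> 'j form \<Rightarrow> 'i form" where
  "pullback F F' h \<phi> i y ws =
     (if i \<in> idx F \<and> y \<in> dom_ch F i
      then let j = (SOME j. j \<in> idx F' \<and> h (chart F i y) \<in> img_ch F' j)
           in \<phi> j (loc F F' h i j y) (map (leaf_diff (ldim F) (loc F F' h i j) y) ws)
      else 0)"


section \<open>Cohomology\<close>

record 'v cochain =
  cdeg :: "int \<Rightarrow> 'v set"
  cdiff :: "int \<Rightarrow> 'v \<Rightarrow> 'v"
  cscale :: "complex \<Rightarrow> 'v \<Rightarrow> 'v"

definition cocycles :: "'v::ab_group_add cochain \<Rightarrow> int \<Rightarrow> 'v set" where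
  "cocycles K q = {x \<in> cdeg K q. cdiff K q x = 0}"

definition coboundaries :: "'v::ab_group_add cochain \<Rightarrow> int \<Rightarrow> 'v set" where
  "coboundaries K q = cdiff K (q - 1) ` cdeg K (q - 1)"

definition cocycle_group :: "'v::ab_group_add cochain \<Rightarrow> int \<Rightarrow> 'v monoid" where
  "cocycle_group K q = \<lparr>carrier = cocycles K q, mult = (+), one = 0\<rparr>"

definition cohomology :: "'v::ab_group_add cochain \<Rightarrow> int \<Rightarrow> 'v set monoid" where
  "cohomology K q = cocycle_group K q Mod coboundaries K q"

definition coh_class :: "'v::ab_group_add cochain \<Rightarrow> int \<Rightarrow> 'v \<Rightarrow> 'v set" where
  "coh_class K q x = coboundaries K q #>\<^bsub>cocycle_group K q\<^esub> x"

text \<open>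
  The map into the degree \<open>q\<close> cohomology of \<open>K\<close> induced by a map \<open>h\<close> on representatives; the union
  is over equal sets when \<open>h\<close> respects cohomology classes.
\<close>

definition induced ::
  "'w::ab_group_add cochain \<Rightarrow> int \<Rightarrow> ('v \<Rightarrow> 'w) \<Rightarrow> 'v set \<Rightarrow> 'w set" where
  "induced K q h X = (\<Union>x\<in>X. coh_class K q (h x))"

definition coh_scale :: "'v::ab_group_add cochain \<Rightarrow> int \<Rightarrow> complex \<Rightarrow> 'v set \<Rightarrow> 'v set" where
  "coh_scale K q c = induced K q (cscale K c)"

text \<open>\<open>h\<close> induces a well-defined complex-linear map from \<open>H\<^sup>q(K)\<close> to \<open>H\<^sup>r(K')\<close>.\<close>

definition induces_linear ::
  "'v::ab_group_add cochain \<Rightarrow> int \<Rightarrow> 'w::ab_group_add cochain \<Rightarrow> int \<Rightarrow> ('v \<Rightarrow> 'w) \<Rightarrow> bool" where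
  "induces_linear K q K' r h \<longleftrightarrow>
     h ` cocycles K q \<subseteq> cocycles K' r \<and>
     (\<forall>x\<in>cocycles K q. induced K' r h (coh_class K q x) = coh_class K' r (h x)) \<and>
     group_hom (cohomology K q) (cohomology K' r) (induced K' r h) \<and>
     (\<forall>c. \<forall>X\<in>carrier (cohomology K q).
        induced K' r h (coh_scale K q c X) = coh_scale K' r c (induced K' r h X))"

definition form_scale :: "complex \<Rightarrow> 'i form \<Rightarrow> 'i form" where
  "form_scale c \<phi> = (\<lambda>i y ws. c * \<phi> i y ws)"

definition dolbeault_tw ::
  "('a, 'i) foliation \<Rightarrow> ('a \<Rightarrow> complex) \<Rightarrow> int \<Rightarrow> 'i form cochain" where
  "dolbeault_tw F f p =
     \<lparr>cdeg = foliated_forms F p, cdiff = dbar_tw F f p, cscale = form_scale\<rparr>"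

definition relative_tw ::
  "('a, 'i) foliation \<Rightarrow> ('b, 'j) foliation \<Rightarrow> ('a \<Rightarrow> 'b) \<Rightarrow> ('b \<Rightarrow> complex) \<Rightarrow> int \<Rightarrow>
   ('j form \<times> 'i form) cochain" where
  "relative_tw F F' h f' p =
     \<lparr>cdeg = (\<lambda>q. foliated_forms F' p q \<times> foliated_forms F p (q - 1)),
      cdiff = (\<lambda>q (\<phi>, \<psi>). (dbar_tw F' f' p q \<phi>,
                            pullback F F' h \<phi> - dbar_tw F (f' \<circ> h) p (q - 1) \<psi>)),
      cscale = (\<lambda>c (\<phi>, \<psi>). (form_scale c \<phi>, form_scale c \<psi>))\<rparr>"

end

theory Submission
  imports Defs
begin

text \<open>
  The relative complex is the mapping cone of the pullback \<open>\<mu>\<^sup>*\<close> between the two twisted Dolbeault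
  complexes, and the sequence is the long exact sequence of this cone.  For the cone of any cochain
  map exactness is elementary: \<open>(\<phi>, \<psi>)\<close> is a cocycle precisely when \<open>\<phi>\<close> is a cocycle and \<open>\<psi>\<close>
  exhibits \<open>\<mu>\<^sup>* \<phi>\<close> as a coboundary (\<open>exact_at_cone\<close>, \<open>exact_at_target\<close>, \<open>exact_at_source\<close>).  What
  has to be shown is that the pullback is a cochain map between cochain complexes
  (\<open>cochain_map_pullback\<close>).

  For this, forms are treated without coefficients.  A form of type \<open>(p, q)\<close> at a point is an
  alternating functional, linear in each slot, that has weight \<open>p\<close> under scaling of the holomorphic
  components of its arguments (\<open>pq_form\<close>); the expansion in products \<open>dz\<^sup>A \<and> dz\<bar>\<^sup>B\<close> is a theorem
  about such functionals (\<open>pq_form_expand\<close>).  In these terms the twisted operator sends \<open>\<phi>\<close> to the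
  alternating sum, over the choices of one argument \<open>u\<close>, of \<open>T\<^sub>k(u) g = f \<partial>\<bar>\<^sub>u g - k (\<partial>\<bar>\<^sub>u f) g\<close> applied to
  the value \<open>g\<close> of \<open>\<phi>\<close> at the remaining arguments, where \<open>k = p + q\<close>.  The composite
  \<open>T\<^sub>k\<^sub>+\<^sub>1(u) T\<^sub>k(v)\<close> is symmetric in \<open>u\<close> and \<open>v\<close> (\<open>tw_deriv_commute\<close>), and a double alternating sum
  of a symmetric expression vanishes (\<open>alt_sum_alt_sum_symmetric\<close>).  Hence the square of the twisted
  operator is 0.

  The same cancellation gives naturality (\<open>tw_dbar_pull\<close>).  By the chain rule, the derivative of a
  pulled back form is the pulled back derivative plus terms in which one argument is replaced by a
  second derivative of the map.  The map being holomorphic along the leaves, these second derivatives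
  are symmetric, and their alternating sum is 0.  Applied to the coordinate changes of a foliation,
  naturality says that the twisted operator maps foliated forms to foliated forms; applied to the
  local expressions of a morphism, it says that pullback commutes with the twisted operators.

  The analysis behind this, the chain rule and the symmetry of second derivatives, is developed for
  functions on \<open>\<complex>\<^sup>m \<times> \<real>\<^sup>n\<close> with continuous partial derivatives.
\<close>

text \<open>
  Quantifiers over points of \<open>\<complex>\<^sup>m \<times> \<real>\<^sup>n\<close> are kept whole and not split into quantifiers over the two
  components.
\<close>

declare split_paired_All [simp del] split_paired_Ex [simp del]


section \<open>Partial derivatives and functions of class C^k\<close>

text \<open>
  The coordinate space \<open>\<complex>\<^sup>m \<times> \<real>\<^sup>n\<close> is a proper subset of the type of points, so openness is relative
  to it.
\<close>

abbreviation coord_open :: "nat \<Rightarrow> nat \<Rightarrow> pt set \<Rightarrow> bool" where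
  "coord_open m n \<equiv> openin (top_of_set (Cspace m \<times> Rspace n))"

lemma move_zero [simp]: "move e 0 y = y"
  by (cases e; cases y) auto

lemma move_move: "move e s (move e t y) = move e (s + t) y"
  by (cases e; cases y) (auto simp: algebra_simps)

lemma move_commute: "move e s (move e' t y) = move e' t (move e s y)"
  by (cases e; cases e'; cases y) (auto simp: fun_eq_iff)

lemma move_in_space:
  "e \<in> dirs m n \<Longrightarrow> y \<in> Cspace m \<times> Rspace n \<Longrightarrow> move e t y \<in> Cspace m \<times> Rspace n"
  by (cases e; cases y) (auto simp: dirs_def Cspace_def Rspace_def)

lemma continuous_on_move: "continuous_on UNIV (\<lambda>(t, y). move e t y)"
proof -
  have c: "continuous_on UNIV (\<lambda>y::real \<times> pt. fst (snd y) b)" for b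
    by (rule continuous_on_product_then_coordinatewise) (intro continuous_intros)
  have r: "continuous_on UNIV (\<lambda>y::real \<times> pt. snd (snd y) b)" for b
    by (rule continuous_on_product_then_coordinatewise) (intro continuous_intros)
  show ?thesis
  proof (cases e)
    case (DRe a)
    have "(\<lambda>(t, y). move e t y) =
      (\<lambda>p. ((\<lambda>b. if b = a then fst (snd p) a + of_real (fst p) else fst (snd p) b), snd (snd p)))"
      using DRe by (auto simp: fun_eq_iff)
    moreover have "continuous_on UNIV (\<lambda>p::real \<times> pt.
        if b = a then fst (snd p) a + of_real (fst p) else fst (snd p) b)" for b
      by (cases "b = a") (auto intro!: continuous_on_add c continuous_intros)
    ultimately show ?thesis
      by (auto intro!: continuous_on_Pair continuous_on_coordinatewise_then_product r)
  next
    case (DIm a)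
    have "(\<lambda>(t, y). move e t y) =
      (\<lambda>p. ((\<lambda>b. if b = a then fst (snd p) a + \<i> * of_real (fst p) else fst (snd p) b), snd (snd p)))"
      using DIm by (auto simp: fun_eq_iff)
    moreover have "continuous_on UNIV (\<lambda>p::real \<times> pt.
        if b = a then fst (snd p) a + \<i> * of_real (fst p) else fst (snd p) b)" for b
      by (cases "b = a") (auto intro!: continuous_on_add c continuous_intros)
    ultimately show ?thesis
      by (auto intro!: continuous_on_Pair continuous_on_coordinatewise_then_product r)
  next
    case (DTr k)
    have "(\<lambda>(t, y). move e t y) =
      (\<lambda>p. (fst (snd p), (\<lambda>b. if b = k then snd (snd p) k + fst p else snd (snd p) b)))"
      using DTr by (auto simp: fun_eq_iff)
    moreover have "continuous_on UNIV (\<lambda>p::real \<times> pt.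
        if b = k then snd (snd p) k + fst p else snd (snd p) b)" for b
      by (cases "b = k") (auto intro!: continuous_on_add r continuous_intros)
    ultimately show ?thesis
      by (auto intro!: continuous_on_Pair continuous_on_coordinatewise_then_product c)
  qed
qed

lemma tendsto_move:
  assumes "(d \<longlongrightarrow> t) G" "(X \<longlongrightarrow> x) G"
  shows "((\<lambda>s. move e (d s) (X s)) \<longlongrightarrow> move e t x) G"
proof -
  have "isCont (\<lambda>(t, y). move e t y) (t, x)"
    using continuous_on_move[of e] by (simp add: continuous_on_eq_continuous_at del: split_paired_All)
  from isCont_tendsto_compose[OF this tendsto_Pair[OF assms]] show ?thesis by simp
qed

lemma coord_open_subset: "coord_open m n U \<Longrightarrow> U \<subseteq> Cspace m \<times> Rspace n"
  by (rule openin_subset[where U = "top_of_set _", simplified])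

lemma eventually_coord_open:
  assumes "coord_open m n U" "x \<in> U" "(X \<longlongrightarrow> x) G" "\<forall>\<^sub>F s in G. X s \<in> Cspace m \<times> Rspace n"
  shows "\<forall>\<^sub>F s in G. X s \<in> U"
proof -
  obtain T where T: "open T" "U = (Cspace m \<times> Rspace n) \<inter> T"
    using assms(1) by (auto simp: openin_open)
  have "\<forall>\<^sub>F s in G. X s \<in> T"
    using topological_tendstoD[OF assms(3) T(1)] assms(2) T by auto
  with assms(4) show ?thesis by eventually_elim (auto simp: T)
qed

lemma eventually_move_in:
  assumes U: "coord_open m n U" "y \<in> U" "e \<in> dirs m n"
  shows "\<forall>\<^sub>F t in nhds 0. move e t y \<in> U"
proof (rule eventually_coord_open[OF U(1,2)])
  show "((\<lambda>t. move e t y) \<longlongrightarrow> y) (nhds 0)"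
    using tendsto_move[OF filterlim_ident[of "nhds 0"] tendsto_const[of y], of e] by simp
  show "\<forall>\<^sub>F s in nhds 0. move e s y \<in> Cspace m \<times> Rspace n"
    using move_in_space[OF U(3)] U(2) coord_open_subset[OF U(1)] by (intro always_eventually) blast
qed

lemma pd_works:
  "(\<lambda>t. F (move e t y)) differentiable (at 0) \<longleftrightarrow>
     ((\<lambda>t. F (move e t y)) has_vector_derivative pd e F y) (at 0)"
  by (simp add: vector_derivative_works pd_def)

lemma pd_eqI: "((\<lambda>t. F (move e t y)) has_vector_derivative D) (at 0) \<Longrightarrow> pd e F y = D"
  by (simp add: vector_derivative_at pd_def)

lemma has_pd_cong:
  assumes U: "coord_open m n U" "y \<in> U" "e \<in> dirs m n" and eq: "\<And>y. y \<in> U \<Longrightarrow> F y = G y"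
  shows "((\<lambda>t. F (move e t y)) has_vector_derivative D) (at 0) \<longleftrightarrow>
    ((\<lambda>t. G (move e t y)) has_vector_derivative D) (at 0)"
proof (rule has_vector_derivative_cong_ev)
  show "\<forall>\<^sub>F t in nhds 0. t \<in> UNIV \<longrightarrow> F (move e t y) = G (move e t y)"
    using eventually_move_in[OF U] by eventually_elim (simp add: eq)
  show "F (move e 0 y) = G (move e 0 y)" using eq U by simp
qed

lemma pd_cong:
  assumes U: "coord_open m n U" "y \<in> U" "e \<in> dirs m n" and eq: "\<And>y. y \<in> U \<Longrightarrow> F y = G y"
  shows "pd e F y = pd e G y"
  unfolding pd_def vector_derivative_def using has_pd_cong[OF U, of F G] eq by simp

lemma differentiable_pd_cong:
  assumes U: "coord_open m n U" "y \<in> U" "e \<in> dirs m n" and eq: "\<And>y. y \<in> U \<Longrightarrow> F y = G y"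
  shows "(\<lambda>t. F (move e t y)) differentiable (at 0) \<longleftrightarrow> (\<lambda>t. G (move e t y)) differentiable (at 0)"
  using has_pd_cong[OF U, of F G] eq pd_cong[OF U, of F G] by (simp add: pd_works)

lemma ck_on_cong:
  assumes "coord_open m n U" "\<And>y. y \<in> U \<Longrightarrow> F y = G y"
  shows "ck_on k m n U F \<longleftrightarrow> ck_on k m n U G"
  using assms(2)
proof (induction k arbitrary: F G)
  case 0
  then show ?case by (simp cong: continuous_on_cong)
next
  case (Suc k)
  have "ck_on k m n U (pd e F) \<longleftrightarrow> ck_on k m n U (pd e G)" if "e \<in> dirs m n" for e
    using pd_cong[OF assms(1) _ that, of _ F G] Suc.prems by (intro Suc.IH) auto
  moreover have "(\<lambda>t. F (move e t y)) differentiable (at 0) \<longleftrightarrow>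
      (\<lambda>t. G (move e t y)) differentiable (at 0)" if "e \<in> dirs m n" "y \<in> U" for e y
    using differentiable_pd_cong[OF assms(1) that(2,1), of F G] Suc.prems by blast
  moreover have "continuous_on U F \<longleftrightarrow> continuous_on U G"
    using Suc.prems by (simp cong: continuous_on_cong)
  ultimately show ?case by simp
qed

lemma ck_on_continuous: "ck_on k m n U F \<Longrightarrow> continuous_on U F"
  by (cases k) auto

lemma ck_on_Suc_imp: "ck_on (Suc k) m n U F \<Longrightarrow> ck_on k m n U F"
  by (induction k arbitrary: F) auto

lemma ck_on_mono: "ck_on k m n U F \<Longrightarrow> V \<subseteq> U \<Longrightarrow> ck_on k m n V F"
  by (induction k arbitrary: F) (auto intro: continuous_on_subset)

text \<open>
  Pullbacks are given by different formulas near different points, depending on the chart around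
  the image point; their smoothness is checked on one neighbourhood at a time.
\<close>

lemma ck_on_local:
  fixes F :: "pt \<Rightarrow> 'b::real_normed_vector"
  assumes U: "U \<subseteq> Cspace m \<times> Rspace n"
    and "\<And>y. y \<in> U \<Longrightarrow> \<exists>V. coord_open m n V \<and> y \<in> V \<and> ck_on k m n V F"
  shows "ck_on k m n U F"
proof -
  have cont: "continuous_on U F"
    if *: "\<And>y. y \<in> U \<Longrightarrow> \<exists>V. coord_open m n V \<and> y \<in> V \<and> continuous_on V F" for F :: "pt \<Rightarrow> 'b"
  proof (unfold continuous_on_def, intro ballI)
    fix y assume "y \<in> U"
    with * obtain V where V: "coord_open m n V" "y \<in> V" "continuous_on V F" by blast
    obtain T where T: "open T" "V = (Cspace m \<times> Rspace n) \<inter> T"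
      using V(1) by (auto simp: openin_open)
    have "at y within V = at y within Cspace m \<times> Rspace n"
      using T V(2) by (intro at_within_nhd[of _ T]) auto
    then have "(F \<longlongrightarrow> F y) (at y within Cspace m \<times> Rspace n)"
      using V by (auto simp: continuous_on_def)
    then show "(F \<longlongrightarrow> F y) (at y within U)"
      using U tendsto_within_subset by blast
  qed
  show ?thesis
    using assms(2)
  proof (induction k arbitrary: F)
    case 0
    then show ?case using cont by simp
  next
    case (Suc k)
    have "continuous_on U F"
    proof (rule cont)
      fix y assume "y \<in> U"
      from Suc.prems[OF this] show "\<exists>V. coord_open m n V \<and> y \<in> V \<and> continuous_on V F"
        by auto
    qed
    moreover have "(\<lambda>t. F (move e t y)) differentiable (at 0)" if "e \<in> dirs m n" "y \<in> U" for e y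
      using Suc.prems[OF that(2)] that by auto
    moreover have "ck_on k m n U (pd e F)" if e: "e \<in> dirs m n" for e
    proof (rule Suc.IH)
      fix y assume "y \<in> U"
      from Suc.prems[OF this] e show "\<exists>V. coord_open m n V \<and> y \<in> V \<and> ck_on k m n V (pd e F)"
        by auto
    qed
    ultimately show ?case by simp
  qed
qed

lemma ck_on_add:
  assumes U: "coord_open m n U" and "ck_on k m n U F" "ck_on k m n U G"
  shows "ck_on k m n U (\<lambda>y. F y + G y)"
  using assms(2,3)
proof (induction k arbitrary: F G)
  case 0 then show ?case by (auto intro: continuous_intros)
next
  case (Suc k)
  have d: "((\<lambda>t. F (move e t y) + G (move e t y)) has_vector_derivative pd e F y + pd e G y) (at 0)"
    if "e \<in> dirs m n" "y \<in> U" for e y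
    using Suc.prems that by (intro has_vector_derivative_add) (auto simp: pd_works)
  have "ck_on k m n U (pd e (\<lambda>y. F y + G y))" if "e \<in> dirs m n" for e
    using ck_on_cong[OF U, of "pd e (\<lambda>y. F y + G y)" "\<lambda>y. pd e F y + pd e G y" k]
      pd_eqI[OF d[OF that]] Suc that by simp
  then show ?case
    using Suc.prems d by (auto intro: continuous_intros simp: differentiableI_vector)
qed

lemma ck_on_bilinear:
  assumes "bounded_bilinear pr" and U: "coord_open m n U"
    and "ck_on k m n U F" "ck_on k m n U G"
  shows "ck_on k m n U (\<lambda>y. pr (F y) (G y))"
  using assms(3,4)
proof (induction k arbitrary: F G)
  interpret bounded_bilinear pr by fact
  case 0
  then show ?case by (simp add: continuous_on)
next
  interpret bounded_bilinear pr by fact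
  case (Suc k)
  have d: "((\<lambda>t. pr (F (move e t y)) (G (move e t y))) has_vector_derivative
      pr (F y) (pd e G y) + pr (pd e F y) (G y)) (at 0)"
    if "e \<in> dirs m n" "y \<in> U" for e y
  proof -
    have "((\<lambda>t. pr (F (move e t y)) (G (move e t y))) has_vector_derivative
      pr (F (move e 0 y)) (pd e G y) + pr (pd e F y) (G (move e 0 y))) (at 0)"
      using Suc.prems that by (intro has_vector_derivative) (auto simp: pd_works)
    then show ?thesis by simp
  qed
  have "ck_on k m n U (pd e (\<lambda>y. pr (F y) (G y)))" if e: "e \<in> dirs m n" for e
  proof -
    have "ck_on k m n U (\<lambda>y. pr (F y) (pd e G y) + pr (pd e F y) (G y))"
      using Suc.prems e by (intro ck_on_add[OF U] Suc.IH) (auto intro: ck_on_Suc_imp simp del: ck_on.simps(2) dest: ck_on.simps(2)[THEN iffD1])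
    then show ?thesis
      by (rule ck_on_cong[OF U, THEN iffD2, rotated]) (rule pd_eqI[OF d[OF e]])
  qed
  then show ?case
    using Suc.prems differentiableI_vector[OF d] by (auto intro: continuous_on)
qed

lemma ck_on_const: "ck_on k m n U (\<lambda>y. c)"
proof (induction k arbitrary: c)
  case (Suc k)
  have "pd e (\<lambda>y. c) = (\<lambda>y. 0)" for e by (auto simp: fun_eq_iff intro!: pd_eqI derivative_eq_intros)
  then show ?case using Suc by (auto intro: continuous_intros)
qed (auto intro: continuous_intros)


lemma ck_on_sum:
  assumes U: "coord_open m n U" and "\<And>i. i \<in> I \<Longrightarrow> ck_on k m n U (F i)"
  shows "ck_on k m n U (\<lambda>y. \<Sum>i\<in>I. F i y)"
  using assms(2)
  by (induction I rule: infinite_finite_induct) (auto intro: ck_on_add[OF U] ck_on_const)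

lemma ck_on_bounded_linear:
  assumes "bounded_linear T" and U: "coord_open m n U" and "ck_on k m n U F"
  shows "ck_on k m n U (\<lambda>y. T (F y))"
proof -
  have "bounded_bilinear (\<lambda>a b. a *\<^sub>R T b)"
    by (rule bounded_bilinear.comp[OF bounded_bilinear_scaleR bounded_linear_ident assms(1)])
  from ck_on_bilinear[OF this U ck_on_const[of _ _ _ _ 1] assms(3)] show ?thesis by simp
qed

section \<open>The chain rule\<close>

primrec real_coord :: "dir \<Rightarrow> pt \<Rightarrow> real" where
  "real_coord (DRe a) y = Re (fst y a)"
| "real_coord (DIm a) y = Im (fst y a)"
| "real_coord (DTr k) y = snd y k"

lemma real_coord_move: "real_coord e (move e' t y) = real_coord e y + (if e = e' then t else 0)"
  by (cases e; cases e'; cases y) auto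

lemma pt_eqI:
  assumes "x \<in> Cspace m \<times> Rspace n" "y \<in> Cspace m \<times> Rspace n"
    and "\<And>e. e \<in> dirs m n \<Longrightarrow> real_coord e x = real_coord e y"
  shows "x = y"
proof -
  have "fst x a = fst y a" for a
  proof (cases "a < m")
    case True
    then show ?thesis
      using assms(3)[of "DRe a"] assms(3)[of "DIm a"] by (auto simp: dirs_def complex_eq_iff)
  qed (use assms in \<open>auto simp: Cspace_def\<close>)
  moreover have "snd x k = snd y k" for k
  proof (cases "k < n")
    case True
    then show ?thesis using assms(3)[of "DTr k"] by (auto simp: dirs_def)
  qed (use assms in \<open>auto simp: Rspace_def\<close>)
  ultimately show ?thesis by (auto simp: prod_eq_iff)
qed

lemma finite_dirs: "finite (dirs m n)"
  by (simp add: dirs_def)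

lemma has_vector_derivative_move:
  assumes "(\<lambda>s. F (move e s (move e t y))) differentiable (at 0)"
  shows "((\<lambda>s. F (move e s y)) has_vector_derivative pd e F (move e t y)) (at t)"
proof -
  have "((\<lambda>s. F (move e s (move e t y))) has_vector_derivative pd e F (move e t y)) (at (t - t))"
    using assms by (simp add: pd_works)
  moreover have "((\<lambda>s. s - t) has_vector_derivative 1) (at t)"
    by (auto intro!: derivative_eq_intros)
  ultimately have "((\<lambda>s. F (move e s (move e t y))) \<circ> (\<lambda>s. s - t) has_vector_derivative
      1 *\<^sub>R pd e F (move e t y)) (at t)"
    by (intro vector_diff_chain_at)
  then show ?thesis by (simp add: o_def move_move)
qed

lemma move_increment_bound:
  fixes g :: "pt \<Rightarrow> 'b::real_normed_vector"
  assumes "\<And>s. \<bar>s\<bar> \<le> \<bar>t\<bar> \<Longrightarrow> (\<lambda>r. g (move e r (move e s x))) differentiable (at 0) \<and>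
      norm (pd e g (move e s x) - c) \<le> B"
  shows "norm (g (move e t x) - g x - t *\<^sub>R c) \<le> B * \<bar>t\<bar>"
proof -
  let ?h = "\<lambda>s. g (move e s x) - s *\<^sub>R c"
  have "norm (?h t - ?h 0) \<le> B * norm (t - 0)"
  proof (rule differentiable_bound[of "closed_segment 0 t" ?h "\<lambda>s r. r *\<^sub>R (pd e g (move e s x) - c)"])
    fix s assume "s \<in> closed_segment 0 t"
    then have s: "\<bar>s\<bar> \<le> \<bar>t\<bar>" by (auto simp: closed_segment_eq_real_ivl split: if_splits)
    have "(?h has_vector_derivative pd e g (move e s x) - c) (at s)"
      using assms[OF s]
      by (auto intro!: derivative_eq_intros has_vector_derivative_move has_vector_derivative_diff)
    then show "(?h has_derivative (\<lambda>r. r *\<^sub>R (pd e g (move e s x) - c))) (at s within closed_segment 0 t)"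
      unfolding has_vector_derivative_def using has_derivative_at_withinI by blast
    show "onorm (\<lambda>r. r *\<^sub>R (pd e g (move e s x) - c)) \<le> B"
      using assms[OF s] onorm_scaleR_left[OF bounded_linear_ident, of "pd e g (move e s x) - c"]
      by (simp add: onorm_id)
  qed auto
  then show ?thesis by (simp add: algebra_simps)
qed

text \<open>
  The increment of \<open>g\<close> splits into the one along \<open>X\<close> and the one along a coordinate line issuing from
  \<open>X s\<close>.  By the mean value inequality the latter differs from \<open>d s *\<^sub>R pd e g (X 0)\<close> by \<open>o(s)\<close>, because
  \<open>pd e g\<close> is continuous and the coordinate segment shrinks to \<open>X 0\<close>.
\<close>

lemma chain_step:
  fixes g :: "pt \<Rightarrow> 'b::real_normed_vector"
  assumes V: "coord_open m n V" and g: "ck_on 1 m n V g" and e: "e \<in> dirs m n"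
    and X: "isCont X 0" "\<And>s. X s \<in> Cspace m \<times> Rspace n" "X 0 \<in> V"
    and gX: "((\<lambda>s. g (X s)) has_vector_derivative D) (at 0)"
    and del: "(d has_real_derivative d') (at 0)" "d 0 = 0"
  shows "((\<lambda>s. g (move e (d s) (X s))) has_vector_derivative D + d' *\<^sub>R pd e g (X 0)) (at 0)"
proof -
  define c where "c = pd e g (X 0)"
  define R where "R s = g (move e (d s) (X s)) - g (X s) - d s *\<^sub>R c" for s
  have diff: "\<And>y. y \<in> V \<Longrightarrow> (\<lambda>t. g (move e t y)) differentiable (at 0)"
    and cont: "continuous_on V (pd e g)"
    using g e by auto
  have bound: "\<forall>\<^sub>F s in nhds 0. norm (R s) \<le> \<eta> * \<bar>d s\<bar>" if "\<eta> > 0" for \<eta>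
  proof -
    \<comment> \<open>near 0 the whole coordinate segment from \<open>X s\<close> stays in \<open>N\<close>, uniformly in its length\<close>
    define N where "N = {x \<in> V. norm (pd e g x - c) < \<eta>}"
    have "N = V \<inter> pd e g -` ball c \<eta>"
      by (auto simp: N_def dist_norm norm_minus_commute)
    then have "openin (top_of_set V) N"
      using cont by (simp add: continuous_openin_preimage_gen)
    then have N: "coord_open m n N" using V openin_trans by blast
    have "(X \<longlongrightarrow> X 0) (nhds 0)"
      using X(1) by (simp add: isCont_def tendsto_at_iff_tendsto_nhds)
    then have lim: "((\<lambda>(t, s). move e t (X s)) \<longlongrightarrow> move e 0 (X 0)) (nhds 0 \<times>\<^sub>F nhds 0)"
      unfolding case_prod_unfold
      by (intro tendsto_move filterlim_fst filterlim_compose[OF _ filterlim_snd])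
    have "\<forall>\<^sub>F (t, s) in nhds 0 \<times>\<^sub>F nhds 0. move e t (X s) \<in> N"
      using eventually_coord_open[OF N _ lim] X(2,3) that move_in_space[OF e]
      by (auto simp: N_def c_def case_prod_unfold)
    then obtain P Q where PQ: "eventually P (nhds 0)" "eventually Q (nhds 0)"
        "\<And>t s. P t \<Longrightarrow> Q s \<Longrightarrow> move e t (X s) \<in> N"
      by (auto simp: eventually_prod_filter)
    then obtain \<rho> where \<rho>: "\<rho> > 0" "\<And>t. \<bar>t\<bar> < \<rho> \<Longrightarrow> P t"
      by (auto simp: eventually_nhds_metric dist_real_def)
    have "isCont d 0" using del(1) DERIV_isCont by blast
    then have "(d \<longlongrightarrow> 0) (nhds 0)"
      using del(2) tendsto_at_iff_tendsto_nhds[of d 0] by (simp add: isCont_def)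
    from order_tendstoD[OF tendsto_rabs[OF this], of \<rho>] \<rho>(1)
    have "\<forall>\<^sub>F s in nhds 0. \<bar>d s\<bar> < \<rho>" by simp
    with PQ(2) show ?thesis
    proof eventually_elim
      case (elim s)
      show ?case unfolding R_def
      proof (rule move_increment_bound)
        fix t assume "\<bar>t\<bar> \<le> \<bar>d s\<bar>"
        then have "move e t (X s) \<in> N" using elim \<rho>(2) PQ(3) by auto
        then show "(\<lambda>r. g (move e r (move e t (X s)))) differentiable (at 0) \<and>
            norm (pd e g (move e t (X s)) - c) \<le> \<eta>"
          using diff by (auto simp: N_def)
      qed
    qed
  qed
  have "(R has_vector_derivative 0) (at 0)"
  proof -
    have "((\<lambda>s. norm (R s) / \<bar>s\<bar>) \<longlongrightarrow> 0) (at 0)"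
    proof (rule tendstoI)
      fix \<epsilon> :: real assume "\<epsilon> > 0"
      have "((\<lambda>s. d s / s) \<longlongrightarrow> d') (at 0)"
        using del by (simp add: has_field_derivative_iff)
      from order_tendstoD(2)[OF tendsto_rabs[OF this], of "\<bar>d'\<bar> + 1"]
      have "\<forall>\<^sub>F s in at 0. \<bar>d s / s\<bar> < \<bar>d'\<bar> + 1" by simp
      moreover have "\<forall>\<^sub>F s in at 0. norm (R s) \<le> (\<epsilon> / (\<bar>d'\<bar> + 1)) * \<bar>d s\<bar>"
        using bound[of "\<epsilon> / (\<bar>d'\<bar> + 1)"] \<open>\<epsilon> > 0\<close> by (simp add: eventually_nhds_conv_at add_nonneg_pos)
      moreover have "\<forall>\<^sub>F s::real in at 0. s \<noteq> 0"
        by (simp add: eventually_at_filter)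
      ultimately show "\<forall>\<^sub>F s in at 0. dist (norm (R s) / \<bar>s\<bar>) 0 < \<epsilon>"
      proof eventually_elim
        case (elim s)
        have "norm (R s) / \<bar>s\<bar> \<le> (\<epsilon> / (\<bar>d'\<bar> + 1)) * \<bar>d s / s\<bar>"
          using divide_right_mono[OF elim(2), of "\<bar>s\<bar>"] by (simp add: abs_divide)
        also have "\<dots> < (\<epsilon> / (\<bar>d'\<bar> + 1)) * (\<bar>d'\<bar> + 1)"
          using elim(1) \<open>\<epsilon> > 0\<close> by (intro mult_strict_left_mono) auto
        also have "\<dots> = \<epsilon>" by (simp add: add_nonneg_eq_0_iff)
        finally show ?case by simp
      qed
    qed
    moreover have "R 0 = 0" using del(2) by (simp add: R_def)
    ultimately show ?thesis
      by (simp add: has_vector_derivative_def has_derivative_at)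
  qed
  moreover have "((\<lambda>s. d s *\<^sub>R c) has_vector_derivative d' *\<^sub>R c) (at 0)"
    using del(1) by (auto intro!: derivative_eq_intros)
  ultimately have "((\<lambda>s. R s + g (X s) + d s *\<^sub>R c) has_vector_derivative 0 + D + d' *\<^sub>R c) (at 0)"
    using gX by (intro has_vector_derivative_add)
  then show ?thesis by (simp add: R_def c_def)
qed

text \<open>
  Starting from the constant path at \<open>\<gamma> 0\<close>, the coordinates of \<open>\<gamma>\<close> are switched on one after the
  other, each time by \<open>chain_step\<close>.
\<close>

lemma chain_rule:
  fixes g :: "pt \<Rightarrow> 'b::real_normed_vector"
  assumes V: "coord_open m n V" and g: "ck_on 1 m n V g"
    and \<gamma>: "\<gamma> 0 \<in> V" "\<forall>\<^sub>F s in nhds 0. \<gamma> s \<in> Cspace m \<times> Rspace n"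
    and d: "\<And>e. e \<in> dirs m n \<Longrightarrow> ((\<lambda>s. real_coord e (\<gamma> s)) has_real_derivative d e) (at 0)"
  shows "((\<lambda>s. g (\<gamma> s)) has_vector_derivative (\<Sum>e\<in>dirs m n. d e *\<^sub>R pd e g (\<gamma> 0))) (at 0)"
proof -
  \<comment> \<open>follows \<open>\<gamma>\<close> in the coordinates \<open>es\<close> and stays at \<open>\<gamma> 0\<close> in all others\<close>
  define X where "X es s = foldr (\<lambda>e. move e (real_coord e (\<gamma> s) - real_coord e (\<gamma> 0))) es (\<gamma> 0)" for es s
  have 0: "\<gamma> 0 \<in> Cspace m \<times> Rspace n" using \<gamma>(1) coord_open_subset[OF V] by auto
  have X0: "X es 0 = \<gamma> 0" for es by (induction es) (auto simp: X_def)
  have main: "isCont (X es) 0 \<and> (\<forall>s. X es s \<in> Cspace m \<times> Rspace n) \<and>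
      ((\<lambda>s. g (X es s)) has_vector_derivative (\<Sum>e\<in>set es. d e *\<^sub>R pd e g (\<gamma> 0))) (at 0) \<and>
      (\<forall>s e. real_coord e (X es s) = (if e \<in> set es then real_coord e (\<gamma> s) else real_coord e (\<gamma> 0)))"
    if "distinct es" "set es \<subseteq> dirs m n" for es
    using that
  proof (induction es)
    case Nil
    then show ?case using 0 by (simp add: X_def)
  next
    case (Cons e es)
    then have e: "e \<in> dirs m n" by simp
    define dl where "dl s = real_coord e (\<gamma> s) - real_coord e (\<gamma> 0)" for s
    have X': "X (e # es) = (\<lambda>s. move e (dl s) (X es s))" by (auto simp: X_def dl_def)
    have dl: "(dl has_real_derivative d e) (at 0)" "dl 0 = 0"
      using DERIV_diff[OF d[OF e] DERIV_const[of "real_coord e (\<gamma> 0)"]] by (simp_all add: dl_def[abs_def])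
    have IH: "isCont (X es) 0" "\<And>s. X es s \<in> Cspace m \<times> Rspace n"
        "((\<lambda>s. g (X es s)) has_vector_derivative (\<Sum>e\<in>set es. d e *\<^sub>R pd e g (\<gamma> 0))) (at 0)"
        "\<And>s e. real_coord e (X es s) = (if e \<in> set es then real_coord e (\<gamma> s) else real_coord e (\<gamma> 0))"
      using Cons by auto
    have "isCont dl 0" using dl(1) DERIV_isCont by blast
    then have "isCont (X (e # es)) 0"
      using IH(1) unfolding X' isCont_def by (intro tendsto_move) auto
    moreover have "((\<lambda>s. g (X (e # es) s)) has_vector_derivative
        (\<Sum>e\<in>set es. d e *\<^sub>R pd e g (\<gamma> 0)) + d e *\<^sub>R pd e g (X es 0)) (at 0)"
      unfolding X' using IH \<gamma>(1) X0 dl by (intro chain_step[OF V g e]) auto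
    ultimately show ?case
      using Cons.prems IH(2,4) move_in_space[OF e]
      by (auto simp: X0 X' real_coord_move dl_def add.commute simp del: split_paired_All)
  qed
  obtain es where es: "set es = dirs m n" "distinct es"
    using finite_distinct_list[OF finite_dirs] by blast
  note m = main[OF es(2)]
  have eq: "\<forall>\<^sub>F s in nhds 0. s \<in> UNIV \<longrightarrow> g (X es s) = g (\<gamma> s)"
    using \<gamma>(2)
  proof eventually_elim
    case (elim s)
    have "X es s = \<gamma> s" using m es elim by (intro pt_eqI[of _ m n]) auto
    then show ?case by simp
  qed
  then have "((\<lambda>s. g (X es s)) has_vector_derivative D) (at 0) \<longleftrightarrow>
      ((\<lambda>s. g (\<gamma> s)) has_vector_derivative D) (at 0)" for D
    by (rule has_vector_derivative_cong_ev) (simp add: X0)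
  then show ?thesis using m es by simp
qed

section \<open>Symmetry of second derivatives and composition\<close>

text \<open>
  Integration of \<open>f1\<close> in the first variable recovers \<open>f\<close>.  Differentiation under the integral sign
  then writes \<open>f2 s 0\<close> as an integral of \<open>f12\<close> with upper limit \<open>s\<close>.
\<close>

lemma real_mixed_partials:
  fixes f :: "real \<Rightarrow> real \<Rightarrow> 'b::banach"
  assumes r: "r > 0"
    and f1: "\<And>s t. \<bar>s\<bar> < r \<Longrightarrow> \<bar>t\<bar> < r \<Longrightarrow> ((\<lambda>s. f s t) has_vector_derivative f1 s t) (at s)"
    and f2: "\<And>s t. \<bar>s\<bar> < r \<Longrightarrow> \<bar>t\<bar> < r \<Longrightarrow> ((\<lambda>t. f s t) has_vector_derivative f2 s t) (at t)"
    and f12: "\<And>s t. \<bar>s\<bar> < r \<Longrightarrow> \<bar>t\<bar> < r \<Longrightarrow> ((\<lambda>t. f1 s t) has_vector_derivative f12 s t) (at t)"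
    and cont: "continuous_on ({-r<..<r} \<times> {-r<..<r}) (\<lambda>(s, t). f12 s t)"
  shows "((\<lambda>s. f2 s 0) has_vector_derivative f12 0 0) (at 0)"
proof -
  \<comment> \<open>\<open>f12\<close> is continuous on the open square of side \<open>2 r\<close>; the integrals run over compact intervals inside\<close>
  define \<rho> where "\<rho> = r / 2"
  have \<rho>: "0 < \<rho>" "\<rho> < r" using r by (auto simp: \<rho>_def)
  let ?U = "{-\<rho><..<\<rho>}"
  have contf1: "continuous_on {-\<rho>..s} (\<lambda>u. f12 u 0)" if "\<bar>s\<bar> < r" for s
    by (rule continuous_on_compose2[OF cont, where f = "\<lambda>u. (u, 0)" and s = "{-\<rho>..s}", simplified])
      (use that \<rho> in \<open>auto intro!: continuous_intros\<close>)
  have eq: "f2 s 0 = f2 (-\<rho>) 0 + integral {-\<rho>..s} (\<lambda>u. f12 u 0)" if s: "s \<in> ?U" for s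
  proof -
    have sr: "-\<rho> \<le> s" "\<bar>s\<bar> < r" using s \<rho> by auto
    have ftc: "((\<lambda>u. f1 u t) has_integral f s t - f (-\<rho>) t) {-\<rho>..s}" if "t \<in> ?U" for t
      using sr \<rho> that
      by (intro fundamental_theorem_of_calculus f1[THEN has_vector_derivative_at_within]) auto
    have fs: "f s t = f (-\<rho>) t + integral {-\<rho>..s} (\<lambda>u. f1 u t)" if "t \<in> ?U" for t
      using integral_unique[OF ftc[OF that]] by simp
    have "((\<lambda>t. integral (cbox (-\<rho>) s) (\<lambda>u. f1 u t)) has_vector_derivative
        integral (cbox (-\<rho>) s) (\<lambda>u. f12 u 0)) (at 0 within ?U)"
    proof (rule leibniz_rule_vector_derivative[where fx = "\<lambda>t u. f12 u t" and f = "\<lambda>t u. f1 u t"])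
      show "((\<lambda>t. f1 u t) has_vector_derivative f12 u t) (at t within ?U)"
        if "t \<in> ?U" "u \<in> cbox (-\<rho>) s" for t u
        using that sr \<rho> by (intro f12[THEN has_vector_derivative_at_within]) auto
      show "(\<lambda>u. f1 u t) integrable_on cbox (-\<rho>) s" if "t \<in> ?U" for t
        using ftc[OF that] by (auto simp: has_integral_integrable)
      have "continuous_on (?U \<times> cbox (-\<rho>) s) (\<lambda>z. (\<lambda>(s, t). f12 s t) (snd z, fst z))"
        using sr \<rho> by (intro continuous_on_compose2[OF cont]) (auto intro!: continuous_intros)
      then show "continuous_on (?U \<times> cbox (-\<rho>) s) (\<lambda>(t, u). f12 u t)"
        by (simp add: case_prod_unfold)
    qed (use \<rho> in auto)
    then have "((\<lambda>t. integral {-\<rho>..s} (\<lambda>u. f1 u t)) has_vector_derivative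
        integral {-\<rho>..s} (\<lambda>u. f12 u 0)) (at 0)"
      using \<rho> at_within_open[of 0 ?U] by simp
    moreover have "((\<lambda>t. f (-\<rho>) t) has_vector_derivative f2 (-\<rho>) 0) (at 0)"
      using \<rho> by (intro f2) auto
    ultimately have "((\<lambda>t. f (-\<rho>) t + integral {-\<rho>..s} (\<lambda>u. f1 u t)) has_vector_derivative
        f2 (-\<rho>) 0 + integral {-\<rho>..s} (\<lambda>u. f12 u 0)) (at 0)"
      by (rule has_vector_derivative_add[rotated])
    then have "((\<lambda>t. f s t) has_vector_derivative f2 (-\<rho>) 0 + integral {-\<rho>..s} (\<lambda>u. f12 u 0)) (at 0)"
      by (rule has_vector_derivative_transform_within_open[of _ _ _ ?U]) (use \<rho> fs in auto)
    moreover have "((\<lambda>t. f s t) has_vector_derivative f2 s 0) (at 0)"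
      using sr r by (intro f2) auto
    ultimately show ?thesis by (metis vector_derivative_at)
  qed
  have "((\<lambda>s. integral {-\<rho>..s} (\<lambda>u. f12 u 0)) has_vector_derivative f12 0 0) (at 0 within {-\<rho>..\<rho>})"
    using \<rho> by (intro integral_has_vector_derivative contf1) auto
  then have "((\<lambda>s. integral {-\<rho>..s} (\<lambda>u. f12 u 0)) has_vector_derivative f12 0 0) (at 0)"
    using \<rho> at_within_Icc_at[of "-\<rho>" 0 \<rho>] by simp
  then have "((\<lambda>s. f2 (-\<rho>) 0 + integral {-\<rho>..s} (\<lambda>u. f12 u 0)) has_vector_derivative 0 + f12 0 0) (at 0)"
    by (intro has_vector_derivative_add has_vector_derivative_const)
  then have "((\<lambda>s. f2 (-\<rho>) 0 + integral {-\<rho>..s} (\<lambda>u. f12 u 0)) has_vector_derivative f12 0 0) (at 0)"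
    by simp
  then show ?thesis
    by (rule has_vector_derivative_transform_within_open[of _ _ _ ?U]) (use \<rho> eq in auto)
qed

lemma pd_commute:
  fixes F :: "pt \<Rightarrow> 'b::banach"
  assumes U: "coord_open m n U" "y \<in> U" and F: "ck_on 2 m n U F"
    and e: "e \<in> dirs m n" "e' \<in> dirs m n"
  shows "pd e (pd e' F) y = pd e' (pd e F) y"
proof -
  have lim: "((\<lambda>(s, t). move e s (move e' t y)) \<longlongrightarrow> move e 0 (move e' 0 y)) (nhds 0 \<times>\<^sub>F nhds 0)"
    unfolding case_prod_unfold
    by (intro tendsto_move filterlim_fst filterlim_snd tendsto_const)
  have S: "move e s (move e' t y) \<in> Cspace m \<times> Rspace n" for s t
    using move_in_space e coord_open_subset[OF U(1)] U(2) by blast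
  have "\<forall>\<^sub>F (s, t) in nhds 0 \<times>\<^sub>F nhds 0. move e s (move e' t y) \<in> U"
    using eventually_coord_open[OF U(1) _ lim] S U(2) by (auto simp: case_prod_unfold)
  then obtain P where P: "eventually P (nhds 0)"
      "\<And>s t. P s \<Longrightarrow> P t \<Longrightarrow> move e s (move e' t y) \<in> U"
    by (auto simp: eventually_prod_same)
  then obtain r where r: "r > 0" "\<And>t. \<bar>t\<bar> < r \<Longrightarrow> P t"
    by (auto simp: eventually_nhds_metric dist_real_def)
  have inU: "move e s (move e' t y) \<in> U" if "\<bar>s\<bar> < r" "\<bar>t\<bar> < r" for s t
    using P r that by blast
  have F': "\<And>e y. e \<in> dirs m n \<Longrightarrow> y \<in> U \<Longrightarrow> (\<lambda>t. F (move e t y)) differentiable (at 0)"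
      "\<And>e d y. e \<in> dirs m n \<Longrightarrow> d \<in> dirs m n \<Longrightarrow> y \<in> U \<Longrightarrow>
         (\<lambda>t. pd e F (move d t y)) differentiable (at 0)"
      "\<And>e d. e \<in> dirs m n \<Longrightarrow> d \<in> dirs m n \<Longrightarrow> continuous_on U (pd d (pd e F))"
    using F by (auto simp: numeral_2_eq_2)
  have "((\<lambda>s. pd e' F (move e s (move e' 0 y))) has_vector_derivative
      pd e' (pd e F) (move e 0 (move e' 0 y))) (at 0)"
  proof (rule real_mixed_partials[OF r(1), where f = "\<lambda>s t. F (move e s (move e' t y))"
        and ?f1.0 = "\<lambda>s t. pd e F (move e s (move e' t y))"
        and ?f2.0 = "\<lambda>s t. pd e' F (move e s (move e' t y))"
        and ?f12.0 = "\<lambda>s t. pd e' (pd e F) (move e s (move e' t y))"])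
    fix s t :: real assume st: "\<bar>s\<bar> < r" "\<bar>t\<bar> < r"
    show "((\<lambda>s. F (move e s (move e' t y))) has_vector_derivative pd e F (move e s (move e' t y))) (at s)"
      using F'(1)[OF e(1) inU[OF st]] by (rule has_vector_derivative_move)
    show "((\<lambda>t. F (move e s (move e' t y))) has_vector_derivative pd e' F (move e s (move e' t y))) (at t)"
      using has_vector_derivative_move[of F e' t "move e s y"] F'(1)[OF e(2) inU[OF st]]
      by (simp add: move_commute[of e])
    show "((\<lambda>t. pd e F (move e s (move e' t y))) has_vector_derivative
        pd e' (pd e F) (move e s (move e' t y))) (at t)"
      using has_vector_derivative_move[of "pd e F" e' t "move e s y"] F'(2)[OF e inU[OF st]]
      by (simp add: move_commute[of e])
  next
    have "continuous_on UNIV (\<lambda>p::real \<times> real. move e (fst p) (move e' (snd p) y))"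
      by (auto simp: continuous_on_def intro!: tendsto_move tendsto_intros)
    then have "continuous_on ({-r<..<r} \<times> {-r<..<r}) (\<lambda>p. pd e' (pd e F) (move e (fst p) (move e' (snd p) y)))"
      using inU by (intro continuous_on_compose2[OF F'(3)[OF e]])
        (auto intro: continuous_on_subset simp: abs_less_iff minus_less_iff)
    then show "continuous_on ({-r<..<r} \<times> {-r<..<r}) (\<lambda>(s, t). pd e' (pd e F) (move e s (move e' t y)))"
      by (simp add: case_prod_unfold)
  qed
  then show ?thesis by (intro pd_eqI) simp
qed

lemma ck_on_has_pd:
  assumes "ck_on k m n U F" "k \<noteq> 0" "e \<in> dirs m n" "y \<in> U"
  shows "((\<lambda>t. F (move e t y)) has_vector_derivative pd e F y) (at 0)"
  using assms by (cases k) (auto simp: pd_works[symmetric])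

lemma pd_bounded_linear:
  assumes "bounded_linear T" "(\<lambda>t. F (move e t y)) differentiable (at 0)"
  shows "pd e (\<lambda>y. T (F y)) y = T (pd e F y)"
  using assms(2) unfolding pd_works by (rule pd_eqI[OF bounded_linear.has_vector_derivative[OF assms(1)]])

lemma ck_on_real_coord:
  assumes U: "coord_open m n U"
    and "\<And>b. ck_on k m n U (\<lambda>y. fst (G y) b)" "\<And>l. ck_on k m n U (\<lambda>y. snd (G y) l)"
  shows "ck_on k m n U (\<lambda>y. real_coord e (G y))"
  using ck_on_bounded_linear[OF bounded_linear_Re U] ck_on_bounded_linear[OF bounded_linear_Im U] assms
  by (cases e) auto

lemma pd_compose:
  fixes g :: "pt \<Rightarrow> 'b::real_normed_vector"
  assumes V: "coord_open m' n' V" and g: "ck_on 1 m' n' V g"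
    and U: "coord_open m n U" and G: "G ` U \<subseteq> V"
      "\<And>e'. e' \<in> dirs m' n' \<Longrightarrow> ck_on 1 m n U (\<lambda>y. real_coord e' (G y))"
    and y: "y \<in> U" and e: "e \<in> dirs m n"
  shows "((\<lambda>t. g (G (move e t y))) has_vector_derivative
     (\<Sum>e'\<in>dirs m' n'. pd e (\<lambda>y. real_coord e' (G y)) y *\<^sub>R pd e' g (G y))) (at 0)"
proof -
  have "((\<lambda>t. g (G (move e t y))) has_vector_derivative
     (\<Sum>e'\<in>dirs m' n'. pd e (\<lambda>y. real_coord e' (G y)) y *\<^sub>R pd e' g (G (move e 0 y)))) (at 0)"
  proof (rule chain_rule[OF V g])
    show "\<forall>\<^sub>F t in nhds 0. G (move e t y) \<in> Cspace m' \<times> Rspace n'"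
      using eventually_move_in[OF U y e]
      by eventually_elim (use G coord_open_subset[OF V] in blast)
    show "((\<lambda>t. real_coord e' (G (move e t y))) has_real_derivative pd e (\<lambda>y. real_coord e' (G y)) y) (at 0)"
      if "e' \<in> dirs m' n'" for e'
      unfolding has_real_derivative_iff_has_vector_derivative
      using ck_on_has_pd[OF G(2)[OF that] _ e y] by simp
  qed (use y G in auto)
  then show ?thesis by simp
qed

text \<open>
  Induction on \<open>k\<close>: by the chain rule a partial derivative of the composite is a sum of products of
  partial derivatives of \<open>G\<close> with composites of partial derivatives of \<open>g\<close>.
\<close>

lemma ck_on_compose:
  fixes g :: "pt \<Rightarrow> 'b::real_normed_vector"
  assumes V: "coord_open m' n' V" and g: "ck_on k m' n' V g"
    and U: "coord_open m n U" and GV: "G ` U \<subseteq> V" and G: "continuous_on U G"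
      "\<And>e'. e' \<in> dirs m' n' \<Longrightarrow> ck_on k m n U (\<lambda>y. real_coord e' (G y))"
  shows "ck_on k m n U (\<lambda>y. g (G y))"
  using g G(2)
proof (induction k arbitrary: g)
  case 0
  then show ?case using continuous_on_compose2[OF _ G(1) GV] by simp
next
  case (Suc k)
  have ck1: "ck_on 1 m' n' V g" "\<And>e'. e' \<in> dirs m' n' \<Longrightarrow> ck_on 1 m n U (\<lambda>y. real_coord e' (G y))"
    using Suc.prems by (auto intro: ck_on_continuous)
  note d = pd_compose[OF V ck1(1) U GV ck1(2)]
  have "ck_on k m n U (pd e (\<lambda>y. g (G y)))" if e: "e \<in> dirs m n" for e
  proof (rule ck_on_cong[OF U, THEN iffD2])
    show "pd e (\<lambda>y. g (G y)) y = (\<Sum>e'\<in>dirs m' n'. pd e (\<lambda>y. real_coord e' (G y)) y *\<^sub>R pd e' g (G y))"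
      if "y \<in> U" for y
      by (rule pd_eqI[OF d[OF _ that e]])
    show "ck_on k m n U (\<lambda>y. \<Sum>e'\<in>dirs m' n'. pd e (\<lambda>y. real_coord e' (G y)) y *\<^sub>R pd e' g (G y))"
    proof (intro ck_on_sum[OF U] ck_on_bilinear[OF bounded_bilinear_scaleR U] Suc.IH)
      fix e' assume e': "e' \<in> dirs m' n'"
      show "ck_on k m n U (pd e (\<lambda>y. real_coord e' (G y)))"
        using Suc.prems(2)[OF e'] e by simp
      show "ck_on k m' n' V (pd e' g)" using Suc.prems(1) e' by simp
      show "\<And>e'. e' \<in> dirs m' n' \<Longrightarrow> ck_on k m n U (\<lambda>y. real_coord e' (G y))"
        using Suc.prems(2) ck_on_Suc_imp by blast
    qed
  qed
  moreover have "continuous_on U (\<lambda>y. g (G y))"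
    using continuous_on_compose2[OF ck_on_continuous[OF Suc.prems(1)] G(1) GV] by simp
  ultimately show ?case
    using differentiableI_vector[OF d] by auto
qed

section \<open>Alternating sums\<close>

text \<open>
  The sign pattern common to the product with a covector and to exterior differentiation: in both,
  each argument in turn is taken out of the list and treated separately.
\<close>

definition alt_sum :: "('v \<Rightarrow> 'v list \<Rightarrow> complex) \<Rightarrow> 'v list \<Rightarrow> complex" where
  "alt_sum S ws = (\<Sum>r<length ws. (-1) ^ r * S (ws ! r) (take r ws @ drop (Suc r) ws))"

lemma alt_sum_Nil [simp]: "alt_sum S [] = 0"
  by (simp add: alt_sum_def)

lemma alt_sum_Cons: "alt_sum S (w # ws) = S w ws - alt_sum (\<lambda>u vs. S u (w # vs)) ws"
  by (simp add: alt_sum_def sum.lessThan_Suc_shift sum_negf del: sum.lessThan_Suc)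

lemma alt_sum_cong:
  assumes "\<And>u vs. set ws = insert u (set vs) \<Longrightarrow> length ws = Suc (length vs) \<Longrightarrow> S u vs = S' u vs"
  shows "alt_sum S ws = alt_sum S' ws"
  unfolding alt_sum_def
proof (rule sum.cong[OF refl])
  fix r assume r: "r \<in> {..<length ws}"
  have "take r ws @ ws ! r # drop (Suc r) ws = ws"
    using r by (simp add: id_take_nth_drop[symmetric])
  from arg_cong[OF this, of set] r
  have "S (ws ! r) (take r ws @ drop (Suc r) ws) = S' (ws ! r) (take r ws @ drop (Suc r) ws)"
    by (intro assms) auto
  then show "(-1) ^ r * S (ws ! r) (take r ws @ drop (Suc r) ws) =
      (-1) ^ r * S' (ws ! r) (take r ws @ drop (Suc r) ws)" by simp
qed

lemma alt_sum_0 [simp]: "alt_sum (\<lambda>u vs. 0) ws = 0"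
  by (simp add: alt_sum_def)

lemma alt_sum_add: "alt_sum (\<lambda>u vs. S u vs + S' u vs) ws = alt_sum S ws + alt_sum S' ws"
  by (simp add: alt_sum_def sum.distrib algebra_simps)

lemma alt_sum_mult: "alt_sum (\<lambda>u vs. c * S u vs) ws = c * alt_sum S ws"
  by (simp add: alt_sum_def sum_distrib_left algebra_simps)

lemma alt_sum_uminus: "alt_sum (\<lambda>u vs. - S u vs) ws = - alt_sum S ws"
  using alt_sum_mult[of "-1" S ws] by simp

lemma alt_sum_diff: "alt_sum (\<lambda>u vs. S u vs - S' u vs) ws = alt_sum S ws - alt_sum S' ws"
  by (simp add: alt_sum_def sum_subtractf algebra_simps)

lemma alt_sum_sum: "alt_sum (\<lambda>u vs. \<Sum>i\<in>I. S i u vs) ws = (\<Sum>i\<in>I. alt_sum (S i) ws)"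
  by (induction I rule: infinite_finite_induct) (simp_all add: alt_sum_add)

lemma alt_sum_map: "alt_sum S (map g ws) = alt_sum (\<lambda>u vs. S (g u) (map g vs)) ws"
  by (simp add: alt_sum_def take_map drop_map)

text \<open>
  Taking out \<open>u\<close> and then \<open>v\<close> carries the opposite sign of taking out \<open>v\<close> and then \<open>u\<close>.  This accounts
  both for the square of the twisted operator being 0 and for the disappearance of second derivatives
  when it is compared with a pullback.
\<close>

lemma alt_sum_alt_sum_symmetric:
  assumes "\<And>u v xs. S u v xs = S v u xs"
  shows "alt_sum (\<lambda>u. alt_sum (S u)) ws = 0"
  using assms
proof (induction ws arbitrary: S)
  case (Cons w ws)
  have "alt_sum (\<lambda>u. alt_sum (S u)) (w # ws) =
      alt_sum (S w) ws - alt_sum (\<lambda>u vs. S u w vs - alt_sum (\<lambda>v xs. S u v (w # xs)) vs) ws"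
    by (simp add: alt_sum_Cons)
  also have "\<dots> = alt_sum (S w) ws - alt_sum (\<lambda>u vs. S u w vs) ws"
    using Cons.IH[of "\<lambda>u v xs. S u v (w # xs)"] Cons.prems by (simp add: alt_sum_diff)
  also have "alt_sum (\<lambda>u vs. S u w vs) ws = alt_sum (S w) ws"
    using Cons.prems by (intro alt_sum_cong) simp
  finally show ?case by simp
qed simp

definition alternating :: "('v list \<Rightarrow> complex) \<Rightarrow> bool" where
  "alternating \<phi> \<longleftrightarrow> (\<forall>xs u v ys. \<phi> (xs @ u # v # ys) = - \<phi> (xs @ v # u # ys))"

lemma alternatingD: "alternating \<phi> \<Longrightarrow> \<phi> (xs @ u # v # ys) = - \<phi> (xs @ v # u # ys)"
  unfolding alternating_def by blast

lemma alternating_Cons: "alternating \<phi> \<Longrightarrow> alternating (\<lambda>vs. \<phi> (w # vs))"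
  unfolding alternating_def by (metis append_Cons)

lemma alternating_swap: "alternating \<phi> \<Longrightarrow> \<phi> (u # v # ys) = - \<phi> (v # u # ys)"
  using alternatingD[of \<phi> "[]" u v ys] by simp

lemma alternating_alt_sum:
  assumes "\<And>u. alternating (S u)"
  shows "alternating (alt_sum S)"
proof -
  have "alt_sum S (xs @ u # v # ys) = - alt_sum S (xs @ v # u # ys)" for xs u v ys
    using assms
  proof (induction xs arbitrary: S)
    case Nil
    have "alt_sum (\<lambda>w vs. S w (u # v # vs)) ys = alt_sum (\<lambda>w vs. - S w (v # u # vs)) ys"
      by (rule alt_sum_cong) (rule alternating_swap[OF Nil])
    then show ?case by (simp add: alt_sum_Cons alt_sum_uminus)
  next
    case (Cons x xs)
    show ?case
      using Cons.IH[of "\<lambda>u vs. S u (x # vs)"] Cons.prems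
      by (simp add: alt_sum_Cons alternating_Cons alternatingD[of "S x" xs u v ys])
  qed
  then show ?thesis unfolding alternating_def by blast
qed

lemma alternating_move_front:
  assumes "alternating \<phi>"
  shows "\<phi> (xs @ u # ys) = 0 \<longleftrightarrow> \<phi> (u # xs @ ys) = 0"
  using assms
proof (induction xs arbitrary: \<phi>)
  case (Cons x xs)
  have "\<phi> (x # xs @ u # ys) = 0 \<longleftrightarrow> \<phi> (x # u # xs @ ys) = 0"
    by (rule Cons.IH[OF alternating_Cons[OF Cons.prems]])
  then show ?case using alternating_swap[OF Cons.prems, of x u] by simp
qed simp

text \<open>
  Comparing the vanishing of values instead of the values themselves spares the sign of a
  permutation.
\<close>

lemma alternating_perm_zero:
  assumes "alternating \<phi>" "mset xs = mset ys"
  shows "\<phi> xs = 0 \<longleftrightarrow> \<phi> ys = 0"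
  using assms
proof (induction xs arbitrary: \<phi> ys)
  case (Cons x xs)
  then obtain y1 y2 where ys: "ys = y1 @ x # y2"
    by (metis list.set_intros(1) mset_eq_setD split_list)
  have "\<phi> (x # xs) = 0 \<longleftrightarrow> \<phi> (x # y1 @ y2) = 0"
    using Cons.prems ys by (intro Cons.IH alternating_Cons) auto
  then show ?case using alternating_move_front[OF Cons.prems(1), of y1 x y2] ys by simp
qed simp

lemma alternating_not_distinct:
  assumes "alternating \<phi>" "\<not> distinct xs"
  shows "\<phi> xs = 0"
proof -
  obtain a x b c where "xs = a @ [x] @ b @ [x] @ c"
    using not_distinct_decomp[OF assms(2)] by blast
  then have "mset xs = mset (x # x # a @ b @ c)" by simp
  moreover have "\<phi> (x # x # a @ b @ c) = 0"
    using alternating_swap[OF assms(1), of x x "a @ b @ c"] by simp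
  ultimately show ?thesis using alternating_perm_zero[OF assms(1)] by blast
qed

section \<open>Forms of a given type at a point\<close>

text \<open>
  One numbering of all the vectors \<open>\<partial>/\<partial>z\<^sup>a\<close> and \<open>\<partial>/\<partial>z\<bar>\<^sup>a\<close>, the holomorphic ones first: a pair of
  multi-indices becomes a single increasing list.
\<close>

definition frame :: "nat \<Rightarrow> nat \<Rightarrow> cvec" where
  "frame m c = (if c < m then vz c else vz_bar (c - m))"

definition coframe :: "nat \<Rightarrow> nat \<Rightarrow> cvec \<Rightarrow> complex" where
  "coframe m c = (if c < m then dz c else dz_bar (c - m))"

lemma coframe_frame: "c < 2 * m \<Longrightarrow> d < 2 * m \<Longrightarrow> coframe m c (frame m d) = of_bool (c = d)"
  by (auto simp: coframe_def frame_def dz_def dz_bar_def vz_def vz_bar_def)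

text \<open>
  Multilinearity, together with dependence on the first \<open>m\<close> components of the arguments only, stated
  as expansion in a frame.
\<close>

definition multilinear :: "nat \<Rightarrow> altform \<Rightarrow> bool" where
  "multilinear m \<phi> \<longleftrightarrow>
    (\<forall>xs w ys. \<phi> (xs @ w # ys) = (\<Sum>c<2*m. coframe m c w * \<phi> (xs @ frame m c # ys)))"

lemma multilinearD:
  "multilinear m \<phi> \<Longrightarrow> \<phi> (xs @ w # ys) = (\<Sum>c<2*m. coframe m c w * \<phi> (xs @ frame m c # ys))"
  unfolding multilinear_def by blast

lemma multilinear_head:
  "multilinear m \<phi> \<Longrightarrow> \<phi> (w # ys) = (\<Sum>c<2*m. coframe m c w * \<phi> (frame m c # ys))"
  using multilinearD[of m \<phi> "[]" w ys] by simp

lemma multilinear_Cons: "multilinear m \<phi> \<Longrightarrow> multilinear m (\<lambda>vs. \<phi> (w # vs))"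
  unfolding multilinear_def
proof (intro allI)
  fix xs u ys
  assume *: "\<forall>xs w ys. \<phi> (xs @ w # ys) = (\<Sum>c<2*m. coframe m c w * \<phi> (xs @ frame m c # ys))"
  show "\<phi> (w # xs @ u # ys) = (\<Sum>c<2*m. coframe m c u * \<phi> (w # xs @ frame m c # ys))"
    using *[rule_format, of "w # xs" u ys] by simp
qed

lemma multilinear_alt_sum:
  assumes "\<And>u. multilinear m (S u)"
    and "\<And>u vs. S u vs = (\<Sum>c<2*m. coframe m c u * S (frame m c) vs)"
  shows "multilinear m (alt_sum S)"
proof -
  have "alt_sum S (xs @ w # ys) = (\<Sum>c<2*m. coframe m c w * alt_sum S (xs @ frame m c # ys))" for xs w ys
    using assms
  proof (induction xs arbitrary: S)
    case Nil
    have "alt_sum (\<lambda>u vs. S u (w # vs)) ys =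
        alt_sum (\<lambda>u vs. \<Sum>c<2*m. coframe m c w * S u (frame m c # vs)) ys"
      by (rule alt_sum_cong) (rule multilinear_head[OF Nil(1)])
    then show ?case
      using Nil(2)[of w ys]
      by (simp add: alt_sum_Cons alt_sum_sum alt_sum_mult right_diff_distrib sum_subtractf)
  next
    case (Cons x xs)
    have "alt_sum (\<lambda>u vs. S u (x # vs)) (xs @ w # ys) =
       (\<Sum>c<2*m. coframe m c w * alt_sum (\<lambda>u vs. S u (x # vs)) (xs @ frame m c # ys))"
      using Cons.prems by (intro Cons.IH multilinear_Cons)
    then show ?case
      using multilinearD[OF Cons.prems(1)[of x], of xs w ys]
      by (simp add: alt_sum_Cons right_diff_distrib sum_subtractf)
  qed
  then show ?thesis unfolding multilinear_def by blast
qed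

definition zscale :: "complex \<Rightarrow> cvec \<Rightarrow> cvec" where
  "zscale s w = ((\<lambda>a. s * fst w a), snd w)"

text \<open>
  The type enters through the total degree and a weight.  The weight is manifestly preserved when the
  arguments are transformed by a linear map that respects the splitting into holomorphic and
  antiholomorphic vectors, which makes pullback straightforward.  Negative \<open>p\<close> or \<open>q\<close> leave only the
  zero form.
\<close>

definition pq_form :: "nat \<Rightarrow> int \<Rightarrow> int \<Rightarrow> altform \<Rightarrow> bool" where
  "pq_form m p q \<phi> \<longleftrightarrow> alternating \<phi> \<and> multilinear m \<phi> \<and>
     (\<forall>ws. \<phi> ws \<noteq> 0 \<longrightarrow> int (length ws) = p + q) \<and>
     (\<forall>s ws. s \<noteq> 0 \<longrightarrow> \<phi> (map (zscale s) ws) = s powi p * \<phi> ws)"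

lemma pq_formD:
  assumes "pq_form m p q \<phi>"
  shows "alternating \<phi>" "multilinear m \<phi>" "\<phi> ws \<noteq> 0 \<Longrightarrow> int (length ws) = p + q"
    "s \<noteq> 0 \<Longrightarrow> \<phi> (map (zscale s) ws) = s powi p * \<phi> ws"
  using assms unfolding pq_form_def by blast+

lemma pq_form_0: "pq_form m p q (\<lambda>ws. 0)"
  by (simp add: pq_form_def alternating_def multilinear_def)

lemma pq_form_lincomb:
  assumes "pq_form m p q \<phi>" "pq_form m p q \<psi>"
  shows "pq_form m p q (\<lambda>ws. a * \<phi> ws + b * \<psi> ws)"
proof -
  have "a * \<phi> ws + b * \<psi> ws \<noteq> 0 \<Longrightarrow> int (length ws) = p + q" for ws
    using pq_formD(3)[OF assms(1), of ws] pq_formD(3)[OF assms(2), of ws] by fastforce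
  moreover have "alternating (\<lambda>ws. a * \<phi> ws + b * \<psi> ws)"
    unfolding alternating_def
  proof (intro allI)
    fix xs u v ys
    show "a * \<phi> (xs @ u # v # ys) + b * \<psi> (xs @ u # v # ys) =
        - (a * \<phi> (xs @ v # u # ys) + b * \<psi> (xs @ v # u # ys))"
      using alternatingD[OF pq_formD(1)[OF assms(1)], of xs u v ys]
        alternatingD[OF pq_formD(1)[OF assms(2)], of xs u v ys] by simp
  qed
  moreover have "multilinear m (\<lambda>ws. a * \<phi> ws + b * \<psi> ws)"
    unfolding multilinear_def
  proof (intro allI)
    fix xs w ys
    show "a * \<phi> (xs @ w # ys) + b * \<psi> (xs @ w # ys) =
      (\<Sum>c<2*m. coframe m c w * (a * \<phi> (xs @ frame m c # ys) + b * \<psi> (xs @ frame m c # ys)))"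
      using multilinearD[OF pq_formD(2)[OF assms(1)], of xs w ys]
        multilinearD[OF pq_formD(2)[OF assms(2)], of xs w ys]
      by (simp add: sum_distrib_left sum.distrib algebra_simps)
  qed
  moreover have "s \<noteq> 0 \<Longrightarrow> a * \<phi> (map (zscale s) ws) + b * \<psi> (map (zscale s) ws) =
      s powi p * (a * \<phi> ws + b * \<psi> ws)" for s ws
    using pq_formD(4)[OF assms(1)] pq_formD(4)[OF assms(2)] by (simp add: algebra_simps)
  ultimately show ?thesis by (simp add: pq_form_def)
qed

lemma pq_form_add: "pq_form m p q \<phi> \<Longrightarrow> pq_form m p q \<psi> \<Longrightarrow> pq_form m p q (\<lambda>ws. \<phi> ws + \<psi> ws)"
  using pq_form_lincomb[of m p q \<phi> \<psi> 1 1] by simp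

lemma pq_form_scale: "pq_form m p q \<phi> \<Longrightarrow> pq_form m p q (\<lambda>ws. c * \<phi> ws)"
  using pq_form_lincomb[of m p q \<phi> \<phi> c 0] by simp

lemma pq_form_sum:
  "(\<And>i. i \<in> I \<Longrightarrow> pq_form m p q (\<phi> i)) \<Longrightarrow> pq_form m p q (\<lambda>ws. \<Sum>i\<in>I. \<phi> i ws)"
  by (induction I rule: infinite_finite_induct) (simp_all add: pq_form_0 pq_form_add)

text \<open>
  The cases of interest are the product with \<open>dz\<^sup>a\<close> (\<open>i = 1\<close>), the product with \<open>dz\<bar>\<^sup>a\<close> and the
  twisted operator (\<open>i = 0\<close> for both).
\<close>

lemma pq_form_alt_sum:
  assumes S: "\<And>u. pq_form m p q (S u)"
    and lin: "\<And>u vs. S u vs = (\<Sum>c<2*m. coframe m c u * S (frame m c) vs)"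
    and sc: "\<And>s u vs. s \<noteq> 0 \<Longrightarrow> S (zscale s u) vs = s powi i * S u vs"
    and pq: "p' = p + i" "p' + q' = p + q + 1"
  shows "pq_form m p' q' (alt_sum S)"
proof -
  have "int (length ws) = p' + q'" if "alt_sum S ws \<noteq> 0" for ws
  proof (rule ccontr)
    assume *: "int (length ws) \<noteq> p' + q'"
    have "alt_sum S ws = alt_sum (\<lambda>u vs. 0) ws"
    proof (rule alt_sum_cong)
      fix u and vs :: "cvec list" assume "length ws = Suc (length vs)"
      then show "S u vs = 0" using * pq pq_formD(3)[OF S, of u vs] by fastforce
    qed
    with that show False by simp
  qed
  moreover have "alt_sum S (map (zscale s) ws) = s powi p' * alt_sum S ws" if s: "s \<noteq> 0" for s ws
  proof -
    have "alt_sum S (map (zscale s) ws) = alt_sum (\<lambda>u vs. s powi p' * S u vs) ws"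
      unfolding alt_sum_map
      using sc[OF s] pq_formD(4)[OF S s] s pq(1)
      by (intro alt_sum_cong) (simp add: power_int_add)
    then show ?thesis by (simp add: alt_sum_mult)
  qed
  moreover have "multilinear m (alt_sum S)"
    by (rule multilinear_alt_sum[OF pq_formD(2)[OF S] lin])
  moreover have "alternating (alt_sum S)"
    by (rule alternating_alt_sum[OF pq_formD(1)[OF S]])
  ultimately show ?thesis
    unfolding pq_form_def by blast
qed

lemma wedge1_alt_sum: "wedge1 \<theta> \<phi> = alt_sum (\<lambda>u vs. \<theta> u * \<phi> vs)"
  by (simp add: fun_eq_iff wedge1_def alt_sum_def mult.assoc)

lemma coframe_expand:
  assumes "c < 2 * m"
  shows "coframe m c u = (\<Sum>d<2*m. coframe m d u * coframe m c (frame m d))"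
proof -
  have "(\<Sum>d<2*m. coframe m d u * coframe m c (frame m d)) = (\<Sum>d<2*m. if c = d then coframe m d u else 0)"
    using assms by (intro sum.cong) (auto simp: coframe_frame)
  then show ?thesis using assms by simp
qed

lemma coframe_zscale: "coframe m c (zscale s u) = (if c < m then s else 1) * coframe m c u"
  by (simp add: coframe_def zscale_def dz_def dz_bar_def)

lemma pq_form_wedge1:
  assumes "pq_form m p q \<phi>" "c < 2 * m"
  shows "pq_form m (if c < m then p + 1 else p) (if c < m then q else q + 1) (wedge1 (coframe m c) \<phi>)"
  unfolding wedge1_alt_sum
proof (rule pq_form_alt_sum[where i = "if c < m then 1 else 0"])
  show "pq_form m p q (\<lambda>vs. coframe m c u * \<phi> vs)" for u
    using assms(1) by (rule pq_form_scale)
  show "coframe m c u * \<phi> vs = (\<Sum>d<2*m. coframe m d u * (coframe m c (frame m d) * \<phi> vs))" for u vs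
    by (subst coframe_expand[OF assms(2)]) (simp add: sum_distrib_right mult.assoc)
  show "coframe m c (zscale s u) * \<phi> vs = s powi (if c < m then 1 else 0) * (coframe m c u * \<phi> vs)"
    if "s \<noteq> 0" for s u vs
    by (simp add: coframe_zscale)
qed auto

lemma pq_form_wedge_list:
  assumes "set cs \<subseteq> {..<2*m}"
  shows "pq_form m (length (filter (\<lambda>c. c < m) cs)) (length (filter (\<lambda>c. \<not> c < m) cs))
    (wedge_list (map (coframe m) cs))"
  using assms
proof (induction cs)
  case Nil
  have "pq_form m 0 0 (\<lambda>ws. if ws = [] then 1 else 0)"
    by (auto simp: pq_form_def alternating_def multilinear_def)
  then show ?case by simp
next
  case (Cons c cs)
  then have "pq_form m (length (filter (\<lambda>c. c < m) cs)) (length (filter (\<lambda>c. \<not> c < m) cs))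
    (wedge_list (map (coframe m) cs))" "c < 2 * m" by auto
  from pq_form_wedge1[OF this] show ?case by (simp add: add.commute split: if_splits)
qed

lemma wedge_list_zero:
  assumes "w \<in> set ws" "\<And>\<theta>. \<theta> \<in> set \<theta>s \<Longrightarrow> \<theta> w = 0"
  shows "wedge_list \<theta>s ws = 0"
  using assms
proof (induction \<theta>s arbitrary: ws)
  case (Cons \<theta> \<theta>s)
  have "alt_sum (\<lambda>u vs. \<theta> u * wedge_list \<theta>s vs) ws = alt_sum (\<lambda>u vs. 0) ws"
  proof (rule alt_sum_cong)
    fix u vs assume "set ws = insert u (set vs)"
    with Cons.prems(1) have "w = u \<or> w \<in> set vs" by auto
    then show "\<theta> u * wedge_list \<theta>s vs = 0" using Cons.IH[of vs] Cons.prems(2) by auto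
  qed
  then show ?case by (simp add: wedge1_alt_sum)
qed auto

text \<open>
  The value is a determinant of Kronecker symbols.  Expanding along the smallest index of \<open>I\<close>, a
  contribution from a later entry of \<open>J\<close> would leave an entry of \<open>J\<close> that is smaller than all of
  \<open>I\<close>, and such an entry is annihilated by all remaining covectors.
\<close>

lemma wedge_list_frame:
  assumes "sorted I" "distinct I" "set I \<subseteq> {..<2*m}" "sorted J" "distinct J" "set J \<subseteq> {..<2*m}"
  shows "wedge_list (map (coframe m) I) (map (frame m) J) = of_bool (I = J)"
  using assms
proof (induction I arbitrary: J)
  case (Cons i I)
  show ?case
  proof (cases J)
    case (Cons j J')
    note J = Cons and prems = Cons.prems[unfolded Cons]
    let ?W = "wedge_list (map (coframe m) I)"
    have "alt_sum (\<lambda>u vs. coframe m i u * ?W (frame m j # vs)) (map (frame m) J') = alt_sum (\<lambda>u vs. 0) (map (frame m) J')"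
      unfolding alt_sum_map
    proof (rule alt_sum_cong)
      fix k and vs :: "nat list" assume "set J' = insert k (set vs)"
      then have k: "k \<in> set J'" by simp
      show "coframe m i (frame m k) * ?W (frame m j # map (frame m) vs) = 0"
      proof (cases "i = k")
        case True
        then have "j < i" using k prems by (auto simp: less_le)
        then have "j \<notin> set I" using prems by auto
        then have "?W (frame m j # map (frame m) vs) = 0"
          using prems by (intro wedge_list_zero[of "frame m j"]) (auto simp: coframe_frame subset_iff)
        then show ?thesis by simp
      next
        case False
        then show ?thesis using prems k by (auto simp: coframe_frame subset_iff)
      qed
    qed
    then have "wedge_list (map (coframe m) (i # I)) (map (frame m) J) = of_bool (i = j) * ?W (map (frame m) J')"
      using J prems by (simp add: wedge1_alt_sum alt_sum_Cons coframe_frame)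
    also have "?W (map (frame m) J') = of_bool (I = J')"
      using prems by (intro Cons.IH) auto
    finally show ?thesis using J by simp
  qed (simp add: wedge1_alt_sum)
qed auto

definition merge_index :: "nat \<Rightarrow> nat set \<Rightarrow> nat set \<Rightarrow> nat list" where
  "merge_index m A B = sorted_list_of_set A @ map ((+) m) (sorted_list_of_set B)"

lemma merge_index:
  assumes "A \<in> multi_index m p" "B \<in> multi_index m q"
  shows "sorted (merge_index m A B)" "distinct (merge_index m A B)"
    "set (merge_index m A B) \<subseteq> {..<2*m}" "dzs A B = map (coframe m) (merge_index m A B)"
    "map vz (sorted_list_of_set A) @ map vz_bar (sorted_list_of_set B) = map (frame m) (merge_index m A B)"
    "int (length (filter (\<lambda>c. c < m) (merge_index m A B))) = p"
    "int (length (filter (\<lambda>c. \<not> c < m) (merge_index m A B))) = q"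
proof -
  have AB: "A \<subseteq> {..<m}" "B \<subseteq> {..<m}" "finite A" "finite B" "int (card A) = p" "int (card B) = q"
    using assms finite_subset[of _ "{..<m}"] by (auto simp: multi_index_def)
  then show "sorted (merge_index m A B)"
    by (auto simp: merge_index_def sorted_append sorted_wrt_map)
  show "distinct (merge_index m A B)" "set (merge_index m A B) \<subseteq> {..<2*m}"
    using AB by (auto simp: merge_index_def distinct_map)
  show "dzs A B = map (coframe m) (merge_index m A B)"
    "map vz (sorted_list_of_set A) @ map vz_bar (sorted_list_of_set B) = map (frame m) (merge_index m A B)"
    using AB by (auto simp: merge_index_def dzs_def coframe_def frame_def fun_eq_iff)
  have "filter (\<lambda>c. c < m) (merge_index m A B) = sorted_list_of_set A"
    "filter (\<lambda>c. \<not> c < m) (merge_index m A B) = map ((+) m) (sorted_list_of_set B)"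
    using AB by (auto simp: merge_index_def filter_map o_def filter_id_conv filter_empty_conv)
  then show "int (length (filter (\<lambda>c. c < m) (merge_index m A B))) = p"
    "int (length (filter (\<lambda>c. \<not> c < m) (merge_index m A B))) = q"
    using AB by simp_all
qed

lemma merge_index_inj:
  assumes "A \<in> multi_index m p" "B \<in> multi_index m q" "A' \<in> multi_index m p" "B' \<in> multi_index m q"
    and "merge_index m A B = merge_index m A' B'"
  shows "A = A' \<and> B = B'"
proof -
  have fin: "C \<subseteq> {..<m} \<and> finite C" if "C \<in> multi_index m r" for C r
    using that finite_subset[of _ "{..<m}"] by (auto simp: multi_index_def)
  have "set (merge_index m A B) \<inter> {..<m} = A" "{c. m + c \<in> set (merge_index m A B)} = B"
    if "A \<in> multi_index m p" "B \<in> multi_index m q" for A B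
    using fin[OF that(1)] fin[OF that(2)] by (auto simp: merge_index_def)
  from this[OF assms(1,2)] this[OF assms(3,4)] assms(5) show ?thesis by simp
qed

lemma finite_multi_index: "finite (multi_index m p)"
  by (rule finite_subset[of _ "Pow {..<m}"]) (auto simp: multi_index_def)

lemma coeff_form_wedge_list:
  assumes "A \<in> multi_index m p" "B \<in> multi_index m q" "A' \<in> multi_index m p" "B' \<in> multi_index m q"
  shows "coeff_form A B (wedge_list (dzs A' B')) = of_bool (A = A' \<and> B = B')"
proof -
  have "coeff_form A B (wedge_list (dzs A' B')) = of_bool (merge_index m A' B' = merge_index m A B)"
    unfolding coeff_form_def merge_index(4)[OF assms(3,4)] merge_index(5)[OF assms(1,2)]
    using merge_index[OF assms(1,2)] merge_index[OF assms(3,4)] by (intro wedge_list_frame)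
  also have "merge_index m A' B' = merge_index m A B \<longleftrightarrow> A = A' \<and> B = B'"
    using merge_index_inj[OF assms] by metis
  finally show ?thesis .
qed

lemma pq_form_wedge_dzs:
  assumes "A \<in> multi_index m p" "B \<in> multi_index m q"
  shows "pq_form m p q (wedge_list (dzs A B))"
  using pq_form_wedge_list[OF merge_index(3)[OF assms]] merge_index[OF assms] by simp

text \<open>
  Linearity and alternation reduce the arguments to increasing lists of frame vectors.  There the
  weight forces \<open>p\<close> of the vectors to be holomorphic, as \<open>2\<^sup>i = 2\<^sup>p\<close> only for \<open>i = p\<close>, and the value is
  one of the coefficients.
\<close>

lemma pq_form_unique:
  assumes \<psi>: "pq_form m p q \<psi>"
    and 0: "\<And>A B. A \<in> multi_index m p \<Longrightarrow> B \<in> multi_index m q \<Longrightarrow> coeff_form A B \<psi> = 0"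
  shows "\<psi> ws = 0"
proof -
  note D = pq_formD[OF \<psi>]
  have sorted: "\<psi> (map (frame m) J) = 0" if J: "sorted J" "distinct J" "set J \<subseteq> {..<2*m}" for J
  proof (rule ccontr)
    assume nz: "\<psi> (map (frame m) J) \<noteq> 0"
    define A where "A = set J \<inter> {..<m}"
    define B where "B = {c. c < m \<and> m + c \<in> set J}"
    have set: "set (merge_index m A B) = set J"
    proof -
      have "c \<in> A \<union> (+) m ` B" if "c \<in> set J" for c
        using that J(3) by (cases "c < m") (auto simp: A_def B_def image_iff intro!: bexI[of _ "c - m"] exI[of _ "c - m"])
      then show ?thesis by (auto simp: merge_index_def A_def B_def)
    qed
    have len: "int (length J) = p + q" using D(3)[OF nz] by simp
    have mem: "A \<in> multi_index m (card A)" "B \<in> multi_index m (card B)"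
      by (auto simp: multi_index_def A_def B_def)
    have eq: "merge_index m A B = J"
      using merge_index(1,2)[OF mem] J set by (intro sorted_distinct_set_unique) auto
    have scale: "\<psi> (map (zscale s \<circ> frame m) cs @ ys) = s ^ length (filter (\<lambda>c. c < m) cs) * \<psi> (map (frame m) cs @ ys)"
      if "alternating \<psi>" "multilinear m \<psi>" for s cs ys \<psi>
      using that
    proof (induction cs arbitrary: \<psi>)
      case (Cons c cs)
      have "\<psi> (zscale s (frame m c) # vs) = (if c < m then s else 1) * \<psi> (frame m c # vs)" for vs
        using multilinear_head[OF Cons.prems(2), of "zscale s (frame m c)" vs]
          multilinear_head[OF Cons.prems(2), of "frame m c" vs]
        by (simp add: sum_distrib_left coframe_zscale) (auto simp: coframe_def frame_def dz_def dz_bar_def vz_def vz_bar_def intro!: sum.cong)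
      then show ?case
        using Cons.IH[OF alternating_Cons[OF Cons.prems(1)] multilinear_Cons[OF Cons.prems(2)], of "frame m c"]
        by simp
    qed simp
    \<comment> \<open>the factor of the scaling by 2, once read off from the vectors and once from the weight\<close>
    have "2 ^ card A * \<psi> (map (frame m) J) = 2 powi p * \<psi> (map (frame m) J)"
    proof -
      have "length (filter (\<lambda>c. c < m) J) = card A"
        using merge_index(6)[OF mem] by (simp add: eq)
      then show ?thesis
        using scale[OF D(1,2), of 2 J "[]"] D(4)[of 2 "map (frame m) J"] by simp
    qed
    then have "(2::complex) powi int (card A) = 2 powi p" using nz by simp
    then have "(2::real) powi int (card A) = 2 powi p"
      by (metis norm_numeral norm_power_int)
    then have p: "int (card A) = p" using power_int_strict_increasing[of "int (card A)" p "2::real"]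
        power_int_strict_increasing[of p "int (card A)" "2::real"]
      by (cases rule: linorder_cases[of "int (card A)" p]) auto
    moreover have "length J = card A + card B"
      using arg_cong[OF eq, of length] by (simp add: merge_index_def A_def B_def)
    ultimately have "int (card B) = q" using len by simp
    then have "coeff_form A B \<psi> = 0" using 0 mem p by simp
    then show False using nz merge_index(5)[OF mem] eq by (simp add: coeff_form_def)
  qed
  have basis: "\<psi> (map (frame m) J) = 0" if "set J \<subseteq> {..<2*m}" for J
  proof (cases "distinct J")
    case True
    have "\<psi> (map (frame m) (sort J)) = 0" using that True by (intro sorted) auto
    then show ?thesis using alternating_perm_zero[OF D(1), of "map (frame m) (sort J)" "map (frame m) J"] by simp
  next
    case False
    then show ?thesis using alternating_not_distinct[OF D(1)] distinct_map by blast
  qed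
  have "\<psi> (map (frame m) J @ ws) = 0" if "set J \<subseteq> {..<2*m}" for J
    using that
  proof (induction ws arbitrary: J)
    case (Cons w ws)
    have "\<psi> (map (frame m) J @ frame m c # ws) = 0" if "c < 2 * m" for c
      using Cons.IH[of "J @ [c]"] Cons.prems that by simp
    then show ?case using multilinearD[OF D(2), of "map (frame m) J" w ws] by simp
  qed (simp add: basis)
  from this[of "[]"] show ?thesis by simp
qed

lemma pq_form_expand:
  assumes "pq_form m p q \<phi>"
  shows "\<phi> ws = (\<Sum>A\<in>multi_index m p. \<Sum>B\<in>multi_index m q.
    coeff_form A B \<phi> * wedge_list (dzs A B) ws)"
proof -
  define \<psi> where "\<psi> = (\<lambda>ws. 1 * \<phi> ws + (-1) * (\<Sum>A\<in>multi_index m p. \<Sum>B\<in>multi_index m q.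
    coeff_form A B \<phi> * wedge_list (dzs A B) ws))"
  have "\<psi> ws = 0"
  proof (rule pq_form_unique)
    show "pq_form m p q \<psi>"
      unfolding \<psi>_def
      by (intro pq_form_lincomb assms pq_form_sum pq_form_scale pq_form_wedge_dzs)
    fix A B assume AB: "A \<in> multi_index m p" "B \<in> multi_index m q"
    have "(\<Sum>A'\<in>multi_index m p. \<Sum>B'\<in>multi_index m q.
        coeff_form A' B' \<phi> * coeff_form A B (wedge_list (dzs A' B'))) =
      (\<Sum>A'\<in>multi_index m p. \<Sum>B'\<in>multi_index m q.
        of_bool (A' = A) * (of_bool (B' = B) * coeff_form A B \<phi>))"
      using AB by (intro sum.cong) (auto simp: coeff_form_wedge_list)
    also have "\<dots> = coeff_form A B \<phi>"
      using AB finite_multi_index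
      by (simp add: of_bool_def if_distribR flip: sum_distrib_left sum_distrib_right)
    finally show "coeff_form A B \<psi> = 0"
      by (simp add: coeff_form_def \<psi>_def)
  qed
  then show ?thesis by (simp add: \<psi>_def)
qed

section \<open>Leafwise derivatives\<close>

lemma smooth_on_const [simp]: "smooth_on m n U (\<lambda>y. c)"
  by (simp add: smooth_on_def ck_on_const)

lemma smooth_on_add:
  "coord_open m n U \<Longrightarrow> smooth_on m n U F \<Longrightarrow> smooth_on m n U G \<Longrightarrow> smooth_on m n U (\<lambda>y. F y + G y)"
  by (simp add: smooth_on_def ck_on_add)

lemma smooth_on_sum:
  "coord_open m n U \<Longrightarrow> (\<And>i. i \<in> I \<Longrightarrow> smooth_on m n U (F i)) \<Longrightarrow>
    smooth_on m n U (\<lambda>y. \<Sum>i\<in>I. F i y)"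
  by (simp add: smooth_on_def ck_on_sum)

lemma smooth_on_mult:
  fixes F G :: "pt \<Rightarrow> complex"
  shows "coord_open m n U \<Longrightarrow> smooth_on m n U F \<Longrightarrow> smooth_on m n U G \<Longrightarrow>
    smooth_on m n U (\<lambda>y. F y * G y)"
  by (simp add: smooth_on_def ck_on_bilinear[OF bounded_bilinear_mult])

lemma smooth_on_diff:
  fixes F G :: "pt \<Rightarrow> complex"
  assumes "coord_open m n U" "smooth_on m n U F" "smooth_on m n U G"
  shows "smooth_on m n U (\<lambda>y. F y - G y)"
  using smooth_on_add[OF assms(1,2) smooth_on_mult[OF assms(1) smooth_on_const[of _ _ _ "-1"] assms(3)]]
  by simp

lemma smooth_on_cnj:
  "coord_open m n U \<Longrightarrow> smooth_on m n U F \<Longrightarrow> smooth_on m n U (\<lambda>y. cnj (F y))"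
  by (simp add: smooth_on_def ck_on_bounded_linear[OF bounded_linear_cnj])

lemma smooth_on_pd:
  assumes "smooth_on m n U F" "e \<in> dirs m n"
  shows "smooth_on m n U (pd e F)"
  unfolding smooth_on_def
proof
  fix k
  have "ck_on (Suc k) m n U F" using assms(1) by (simp add: smooth_on_def)
  then show "ck_on k m n U (pd e F)" using assms(2) by simp
qed

lemma smooth_on_has_pd:
  assumes "smooth_on m n U F" "e \<in> dirs m n" "y \<in> U"
  shows "((\<lambda>t. F (move e t y)) has_vector_derivative pd e F y) (at 0)"
  by (rule ck_on_has_pd[of 1 m n U F e y]) (use assms in \<open>auto simp: smooth_on_def\<close>)

lemma smooth_on_cong:
  assumes "coord_open m n U" "\<And>y. y \<in> U \<Longrightarrow> F y = G y"
  shows "smooth_on m n U F \<longleftrightarrow> smooth_on m n U G"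
  unfolding smooth_on_def using ck_on_cong[OF assms] by simp

lemma smooth_on_mono: "smooth_on m n U F \<Longrightarrow> V \<subseteq> U \<Longrightarrow> smooth_on m n V F"
  unfolding smooth_on_def using ck_on_mono by blast

lemma smooth_on_local:
  assumes "U \<subseteq> Cspace m \<times> Rspace n"
    and *: "\<And>y. y \<in> U \<Longrightarrow> \<exists>V. coord_open m n V \<and> y \<in> V \<and> smooth_on m n V F"
  shows "smooth_on m n U F"
  unfolding smooth_on_def
proof
  fix k show "ck_on k m n U F"
  proof (rule ck_on_local[OF assms(1)])
    fix y assume "y \<in> U"
    from *[OF this] show "\<exists>V. coord_open m n V \<and> y \<in> V \<and> ck_on k m n V F"
      by (auto simp: smooth_on_def)
  qed
qed

lemma smooth_on_continuous: "smooth_on m n U F \<Longrightarrow> continuous_on U F"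
  unfolding smooth_on_def by (rule ck_on_continuous[of 0]) blast

lemma sum_dirs:
  "(\<Sum>e\<in>dirs m n. h e) = (\<Sum>a<m. h (DRe a) + h (DIm a)) + (\<Sum>k<n. h (DTr k))"
proof -
  have "(\<Sum>e\<in>dirs m n. h e) =
      (\<Sum>e\<in>DRe ` {..<m}. h e) + (\<Sum>e\<in>DIm ` {..<m}. h e) + (\<Sum>e\<in>DTr ` {..<n}. h e)"
    unfolding dirs_def by (subst sum.union_disjoint, force, force, force)+ simp
  then show ?thesis by (simp add: sum.reindex inj_on_def sum.distrib)
qed

lemma dirs_leaf: "e \<in> dirs m 0 \<Longrightarrow> e \<in> dirs m n"
  by (auto simp: dirs_def)

text \<open>
  The derivative in the direction of a complexified leafwise vector; the components of \<open>leaf_diff\<close> are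
  derivatives of this kind.
\<close>

definition leaf_deriv :: "nat \<Rightarrow> cvec \<Rightarrow> (pt \<Rightarrow> complex) \<Rightarrow> pt \<Rightarrow> complex" where
  "leaf_deriv m w g y = (\<Sum>a<m. wirt a g y * fst w a + wirt_bar a g y * snd w a)"

text \<open>
  Components of a complexified leafwise vector with respect to the real directions in \<open>dirs m 0\<close>, for
  which the product rule and the symmetry of second derivatives are available.
\<close>

fun real_coef :: "cvec \<Rightarrow> dir \<Rightarrow> complex" where
  "real_coef w (DRe a) = (fst w a + snd w a) / 2"
| "real_coef w (DIm a) = \<i> * (snd w a - fst w a) / 2"
| "real_coef w (DTr k) = 0"

lemma leaf_deriv_pd: "leaf_deriv m w g y = (\<Sum>e\<in>dirs m 0. real_coef w e * pd e g y)"
  unfolding leaf_deriv_def sum_dirs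
  by (auto intro!: sum.cong simp: wirt_def wirt_bar_def field_simps)

lemma leaf_deriv_const [simp]: "leaf_deriv m w (\<lambda>y. c) y = 0"
proof -
  have "pd e (\<lambda>y. c) y = 0" for e by (auto intro!: pd_eqI derivative_eq_intros)
  then show ?thesis by (simp add: leaf_deriv_pd)
qed

lemma leaf_deriv_cong:
  assumes U: "coord_open m n U" "y \<in> U" and eq: "\<And>y. y \<in> U \<Longrightarrow> F y = G y"
  shows "leaf_deriv m w F y = leaf_deriv m w G y"
  unfolding leaf_deriv_pd using pd_cong[OF U dirs_leaf, of _ F G] eq by (auto intro!: sum.cong)

lemma leaf_deriv_add:
  assumes "smooth_on m n U F" "smooth_on m n U G" "y \<in> U"
  shows "leaf_deriv m w (\<lambda>y. F y + G y) y = leaf_deriv m w F y + leaf_deriv m w G y"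
proof -
  have "pd e (\<lambda>y. F y + G y) y = pd e F y + pd e G y" if "e \<in> dirs m 0" for e
    using assms dirs_leaf[OF that, of n]
    by (intro pd_eqI has_vector_derivative_add smooth_on_has_pd[of m n U])
  then show ?thesis by (simp add: leaf_deriv_pd sum.distrib algebra_simps)
qed

lemma leaf_deriv_mult:
  assumes "smooth_on m n U F" "smooth_on m n U G" "y \<in> U"
  shows "leaf_deriv m w (\<lambda>y. F y * G y) y = F y * leaf_deriv m w G y + leaf_deriv m w F y * G y"
proof -
  have "pd e (\<lambda>y. F y * G y) y = F y * pd e G y + pd e F y * G y" if "e \<in> dirs m 0" for e
  proof (rule pd_eqI)
    have "((\<lambda>t. F (move e t y) * G (move e t y)) has_vector_derivative
        F (move e 0 y) * pd e G y + pd e F y * G (move e 0 y)) (at 0)"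
      using assms dirs_leaf[OF that, of n]
      by (intro has_vector_derivative_mult smooth_on_has_pd[of m n U])
    then show "((\<lambda>t. F (move e t y) * G (move e t y)) has_vector_derivative
        F y * pd e G y + pd e F y * G y) (at 0)" by simp
  qed
  then show ?thesis
    by (simp add: leaf_deriv_pd sum.distrib sum_distrib_left sum_distrib_right algebra_simps)
qed

lemma leaf_deriv_cmult:
  assumes "smooth_on m n U F" "y \<in> U"
  shows "leaf_deriv m w (\<lambda>y. c * F y) y = c * leaf_deriv m w F y"
  using leaf_deriv_mult[OF smooth_on_const assms] by simp

lemma leaf_deriv_diff:
  assumes "coord_open m n U" "smooth_on m n U F" "smooth_on m n U G" "y \<in> U"
  shows "leaf_deriv m w (\<lambda>y. F y - G y) y = leaf_deriv m w F y - leaf_deriv m w G y"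
  using leaf_deriv_add[OF assms(2) smooth_on_mult[OF assms(1) smooth_on_const[of _ _ _ "-1"] assms(3)] assms(4)]
    leaf_deriv_cmult[OF assms(3,4), of w "-1"] by simp

lemma leaf_deriv_sum:
  assumes U: "coord_open m n U" "y \<in> U" and F: "\<And>i. i \<in> I \<Longrightarrow> smooth_on m n U (F i)"
  shows "leaf_deriv m w (\<lambda>y. \<Sum>i\<in>I. F i y) y = (\<Sum>i\<in>I. leaf_deriv m w (F i) y)"
  using F
proof (induction I rule: infinite_finite_induct)
  case (insert i I)
  have "leaf_deriv m w (\<lambda>y. F i y + (\<Sum>i\<in>I. F i y)) y = leaf_deriv m w (F i) y + leaf_deriv m w (\<lambda>y. \<Sum>i\<in>I. F i y) y"
    using insert.prems by (intro leaf_deriv_add[of m n U] smooth_on_sum U) auto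
  then show ?case using insert by simp
qed simp_all

lemma smooth_on_leaf_deriv:
  assumes "coord_open m n U" "smooth_on m n U F"
  shows "smooth_on m n U (leaf_deriv m w F)"
proof -
  have "smooth_on m n U (\<lambda>y. \<Sum>e\<in>dirs m 0. real_coef w e * pd e F y)"
    using assms dirs_leaf[of _ m n]
    by (intro smooth_on_sum smooth_on_mult smooth_on_const smooth_on_pd)
  then show ?thesis by (simp add: leaf_deriv_pd[abs_def])
qed

lemma pd_sum_scaled:
  assumes "\<And>i. i \<in> I \<Longrightarrow> smooth_on m n U (F i)" "y \<in> U" "e \<in> dirs m n"
  shows "pd e (\<lambda>y. \<Sum>i\<in>I. (c i :: complex) * F i y) y = (\<Sum>i\<in>I. c i * pd e (F i) y)"
  using assms
  by (intro pd_eqI has_vector_derivative_sum has_vector_derivative_mult_right smooth_on_has_pd)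

lemma leaf_deriv_commute:
  assumes U: "coord_open m n U" "y \<in> U" and F: "smooth_on m n U F"
  shows "leaf_deriv m u (leaf_deriv m v F) y = leaf_deriv m v (leaf_deriv m u F) y"
proof -
  have eq: "leaf_deriv m u (leaf_deriv m v F) y =
      (\<Sum>e\<in>dirs m 0. \<Sum>e'\<in>dirs m 0. real_coef u e * (real_coef v e' * pd e (pd e' F) y))" for u v
  proof -
    have "pd e (leaf_deriv m v F) y = (\<Sum>e'\<in>dirs m 0. real_coef v e' * pd e (pd e' F) y)"
      if "e \<in> dirs m 0" for e
      unfolding leaf_deriv_pd[abs_def]
      using dirs_leaf that by (intro pd_sum_scaled[of _ m n U] smooth_on_pd F U)
    then show ?thesis by (simp add: leaf_deriv_pd[of m u] sum_distrib_left)
  qed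
  have "pd e (pd e' F) y = pd e' (pd e F) y" if "e \<in> dirs m 0" "e' \<in> dirs m 0" for e e'
    using that F by (intro pd_commute[OF U]) (auto simp: smooth_on_def dirs_leaf)
  then show ?thesis
    unfolding eq by (subst sum.swap) (auto intro!: sum.cong)
qed

lemma sum_lessThan_add: "(\<Sum>c<m + k. h c) = (\<Sum>c<m. h c) + (\<Sum>c<(k::nat). h (m + c) :: complex)"
  by (induction k) (simp_all add: add.assoc)

lemma leaf_deriv_expand: "leaf_deriv m w g y = (\<Sum>c<2*m. coframe m c w * leaf_deriv m (frame m c) g y)"
proof -
  have dir: "leaf_deriv m (frame m c) g y = (if c < m then wirt c g y else wirt_bar (c - m) g y)" if "c < 2 * m" for c
  proof -
    have "leaf_deriv m (frame m c) g y =
      (\<Sum>a<m. if a = (if c < m then c else c - m) then (if c < m then wirt c g y else wirt_bar (c - m) g y) else 0)"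
      unfolding leaf_deriv_def by (intro sum.cong) (auto simp: frame_def vz_def vz_bar_def)
    then show ?thesis using that by auto
  qed
  have "(\<Sum>c<2*m. coframe m c w * leaf_deriv m (frame m c) g y) =
      (\<Sum>c<m + m. coframe m c w * (if c < m then wirt c g y else wirt_bar (c - m) g y))"
    by (intro sum.cong) (auto simp: dir)
  also have "\<dots> = (\<Sum>c<m. fst w c * wirt c g y) + (\<Sum>c<m. snd w c * wirt_bar c g y)"
    by (simp add: sum_lessThan_add coframe_def dz_def dz_bar_def)
  finally show ?thesis by (simp add: leaf_deriv_def sum.distrib mult.commute)
qed

text \<open>
  Restricting the direction of differentiation to the antiholomorphic part turns the leafwise
  derivative into the operator \<open>\<partial>\<bar>\<close>.
\<close>

definition barpart :: "cvec \<Rightarrow> cvec" where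
  "barpart w = ((\<lambda>a. 0), snd w)"

lemma leaf_deriv_barpart: "leaf_deriv m (barpart w) g y = (\<Sum>a<m. wirt_bar a g y * snd w a)"
  by (simp add: leaf_deriv_def barpart_def)

lemma leaf_deriv_barpart_expand:
  "leaf_deriv m (barpart w) g y = (\<Sum>c<2*m. coframe m c w * leaf_deriv m (barpart (frame m c)) g y)"
proof -
  have "coframe m c (barpart w) * leaf_deriv m (frame m c) g y = coframe m c w * leaf_deriv m (barpart (frame m c)) g y" for c
    by (auto simp: coframe_def frame_def barpart_def dz_def dz_bar_def vz_def vz_bar_def leaf_deriv_def)
  then show ?thesis by (subst leaf_deriv_expand) simp
qed

section \<open>Leafwise holomorphic maps between coordinate domains\<close>

text \<open>
  What coordinate changes and local expressions of morphisms have in common: they are smooth,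
  holomorphic along the leaves, and map leaves into leaves.
\<close>

definition leaf_map ::
  "nat \<Rightarrow> nat \<Rightarrow> nat \<Rightarrow> nat \<Rightarrow> pt set \<Rightarrow> pt set \<Rightarrow> (pt \<Rightarrow> pt) \<Rightarrow> bool" where
  "leaf_map m n m' n' U V G \<longleftrightarrow> coord_open m n U \<and> coord_open m' n' V \<and> G ` U \<subseteq> V \<and>
     (\<forall>b. smooth_on m n U (\<lambda>y. fst (G y) b)) \<and> (\<forall>k. smooth_on m n U (\<lambda>y. snd (G y) k)) \<and>
     (\<forall>y\<in>U. (\<forall>a<m. \<forall>b. wirt_bar a (\<lambda>y. fst (G y) b) y = 0) \<and>
        (\<forall>e\<in>dirs m 0. \<forall>k. pd e (\<lambda>y. snd (G y) k) y = 0))"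

lemma leaf_mapD:
  assumes "leaf_map m n m' n' U V G"
  shows "coord_open m n U" "coord_open m' n' V" "y \<in> U \<Longrightarrow> G y \<in> V"
    "smooth_on m n U (\<lambda>y. fst (G y) b)" "smooth_on m n U (\<lambda>y. snd (G y) k)"
    "y \<in> U \<Longrightarrow> a < m \<Longrightarrow> wirt_bar a (\<lambda>y. fst (G y) b) y = 0"
    "y \<in> U \<Longrightarrow> e \<in> dirs m 0 \<Longrightarrow> pd e (\<lambda>y. snd (G y) k) y = 0"
  using assms unfolding leaf_map_def by blast+

lemma leaf_map_real_coord:
  assumes "leaf_map m n m' n' U V G"
  shows "ck_on k m n U (\<lambda>y. real_coord e (G y))"
  using leaf_mapD(4,5)[OF assms] by (intro ck_on_real_coord leaf_mapD(1)[OF assms]) (auto simp: smooth_on_def)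

lemma smooth_on_leaf_map:
  assumes G: "leaf_map m n m' n' U V G" and g: "smooth_on m' n' V g"
  shows "smooth_on m n U (\<lambda>y. g (G y))"
  unfolding smooth_on_def
proof
  fix k
  have "continuous_on U (\<lambda>y. fst (G y))" "continuous_on U (\<lambda>y. snd (G y))"
    using leaf_mapD(4,5)[OF G]
    by (intro continuous_on_coordinatewise_then_product smooth_on_continuous; blast)+
  then have "continuous_on U (\<lambda>y. (fst (G y), snd (G y)))" by (rule continuous_on_Pair)
  then have "continuous_on U G" by simp
  moreover have "ck_on k m' n' V g" "G ` U \<subseteq> V"
    using g leaf_mapD(3)[OF G] by (auto simp: smooth_on_def)
  ultimately show "ck_on k m n U (\<lambda>y. g (G y))"
    by (intro ck_on_compose[OF leaf_mapD(2)[OF G] _ leaf_mapD(1)[OF G] _ _ leaf_map_real_coord[OF G]])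
qed

lemma fst_leaf_diff: "fst (leaf_diff m G y w) b = leaf_deriv m w (\<lambda>y. fst (G y) b) y"
  by (simp add: leaf_diff_def leaf_deriv_def)

lemma snd_leaf_diff: "snd (leaf_diff m G y w) b = leaf_deriv m w (\<lambda>y. cnj (fst (G y) b)) y"
  by (simp add: leaf_diff_def leaf_deriv_def)

lemma pd_cnj:
  assumes "smooth_on m n U F" "e \<in> dirs m n" "y \<in> U"
  shows "pd e (\<lambda>y. cnj (F y)) y = cnj (pd e F y)"
  by (rule pd_bounded_linear[OF bounded_linear_cnj])
    (rule differentiableI_vector[OF smooth_on_has_pd[OF assms]])

text \<open>
  Leaves are mapped into leaves, so the transversal derivatives of \<open>g\<close> do not contribute.
\<close>

lemma leaf_deriv_leaf_map:
  assumes G: "leaf_map m n m' n' U V G" and g: "smooth_on m' n' V g" and y: "y \<in> U"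
  shows "leaf_deriv m w (\<lambda>y. g (G y)) y = leaf_deriv m' (leaf_diff m G y w) g (G y)"
proof -
  note GD = leaf_mapD[OF G]
  have pd: "pd e (\<lambda>y. g (G y)) y =
      (\<Sum>b<m'. pd e (\<lambda>y. fst (G y) b) y * wirt b g (G y) + pd e (\<lambda>y. cnj (fst (G y) b)) y * wirt_bar b g (G y))"
    if e: "e \<in> dirs m 0" for e
  proof -
    have e': "e \<in> dirs m n" using e by (rule dirs_leaf)
    have "pd e (\<lambda>y. g (G y)) y = (\<Sum>e'\<in>dirs m' n'. pd e (\<lambda>y. real_coord e' (G y)) y *\<^sub>R pd e' g (G y))"
      using g GD(3)
      by (intro pd_eqI[OF pd_compose[OF GD(2) _ GD(1) _ leaf_map_real_coord[OF G] y e']])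
        (auto simp: smooth_on_def)
    also have "\<dots> = (\<Sum>b<m'. pd e (\<lambda>y. real_coord (DRe b) (G y)) y *\<^sub>R pd (DRe b) g (G y) +
        pd e (\<lambda>y. real_coord (DIm b) (G y)) y *\<^sub>R pd (DIm b) g (G y))"
      using GD(7)[OF y e] by (simp add: sum_dirs)
    also have "\<dots> = (\<Sum>b<m'. pd e (\<lambda>y. fst (G y) b) y * wirt b g (G y) +
        pd e (\<lambda>y. cnj (fst (G y) b)) y * wirt_bar b g (G y))"
    proof (rule sum.cong[OF refl])
      fix b
      let ?p = "pd e (\<lambda>y. fst (G y) b) y"
      have d: "(\<lambda>t. fst (G (move e t y)) b) differentiable (at 0)"
        by (rule differentiableI_vector[OF smooth_on_has_pd[OF GD(4) e' y]])
      have "pd e (\<lambda>y. real_coord (DRe b) (G y)) y = Re ?p" "pd e (\<lambda>y. real_coord (DIm b) (G y)) y = Im ?p"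
        using pd_bounded_linear[OF bounded_linear_Re d] pd_bounded_linear[OF bounded_linear_Im d]
        by simp_all
      moreover have "pd e (\<lambda>y. cnj (fst (G y) b)) y = cnj ?p"
        by (rule pd_cnj[OF GD(4) e' y])
      ultimately show "pd e (\<lambda>y. real_coord (DRe b) (G y)) y *\<^sub>R pd (DRe b) g (G y) +
          pd e (\<lambda>y. real_coord (DIm b) (G y)) y *\<^sub>R pd (DIm b) g (G y) =
        ?p * wirt b g (G y) + pd e (\<lambda>y. cnj (fst (G y) b)) y * wirt_bar b g (G y)"
        by (simp add: wirt_def wirt_bar_def complex_eq_iff field_simps)
    qed
    finally show ?thesis .
  qed
  have "leaf_deriv m w (\<lambda>y. g (G y)) y =
      (\<Sum>e\<in>dirs m 0. \<Sum>b<m'. real_coef w e * pd e (\<lambda>y. fst (G y) b) y * wirt b g (G y) +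
         real_coef w e * pd e (\<lambda>y. cnj (fst (G y) b)) y * wirt_bar b g (G y))"
    by (simp add: leaf_deriv_pd pd sum_distrib_left algebra_simps)
  also have "\<dots> = leaf_deriv m' (leaf_diff m G y w) g (G y)"
    unfolding leaf_deriv_def[of m'] fst_leaf_diff snd_leaf_diff
    by (subst sum.swap) (simp add: leaf_deriv_pd sum.distrib sum_distrib_left sum_distrib_right mult.commute mult.left_commute)
  finally show ?thesis .
qed

lemma leaf_map_wirt_cnj:
  assumes G: "leaf_map m n m' n' U V G" and "y \<in> U" "a < m"
  shows "wirt a (\<lambda>y. cnj (fst (G y) b)) y = 0"
proof -
  have "wirt a (\<lambda>y. cnj (fst (G y) b)) y = cnj (wirt_bar a (\<lambda>y. fst (G y) b) y)"
    using pd_cnj[OF leaf_mapD(4)[OF G] _ assms(2), of _ b] assms(3)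
    by (simp add: wirt_def wirt_bar_def dirs_def)
  then show ?thesis using leaf_mapD(6)[OF G assms(2,3)] by simp
qed

lemma leaf_diff_barpart:
  assumes G: "leaf_map m n m' n' U V G" and y: "y \<in> U"
  shows "leaf_diff m G y (barpart w) = barpart (leaf_diff m G y w)"
  using leaf_mapD(6)[OF G y] leaf_map_wirt_cnj[OF G y]
  by (simp add: leaf_diff_def barpart_def)

lemma leaf_diff_zscale:
  assumes G: "leaf_map m n m' n' U V G" and y: "y \<in> U"
  shows "leaf_diff m G y (zscale s w) = zscale s (leaf_diff m G y w)"
  using leaf_mapD(6)[OF G y] leaf_map_wirt_cnj[OF G y]
  by (simp add: leaf_diff_def zscale_def sum_distrib_left algebra_simps)

lemma coframe_leaf_diff:
  "coframe m' c (leaf_diff m G y w) = leaf_deriv m w (\<lambda>y. if c < m' then fst (G y) c else cnj (fst (G y) (c - m'))) y"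
  by (simp add: coframe_def dz_def dz_bar_def fst_leaf_diff snd_leaf_diff)

lemma smooth_on_coframe_leaf_diff:
  assumes G: "leaf_map m n m' n' U V G"
  shows "smooth_on m n U (\<lambda>y. coframe m' c (leaf_diff m G y w))"
  unfolding coframe_leaf_diff
  using leaf_mapD(1,4)[OF G] by (intro smooth_on_leaf_deriv; cases "c < m'") (auto intro: smooth_on_cnj)

section \<open>The twisted operator on local forms\<close>

lemma leaf_deriv_alt_sum:
  assumes U: "coord_open m n U" "y \<in> U" and g: "\<And>v xs. smooth_on m n U (\<lambda>y. g v xs y)"
  shows "leaf_deriv m w (\<lambda>y. alt_sum (\<lambda>v xs. g v xs y) vs) y = alt_sum (\<lambda>v xs. leaf_deriv m w (g v xs) y) vs"
proof -
  have "leaf_deriv m w (\<lambda>y. alt_sum (\<lambda>v xs. g v xs y) vs) y =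
      (\<Sum>r<length vs. leaf_deriv m w (\<lambda>y. (-1) ^ r * g (vs ! r) (take r vs @ drop (Suc r) vs) y) y)"
    unfolding alt_sum_def by (intro leaf_deriv_sum[OF U] smooth_on_mult[OF U(1)] smooth_on_const g)
  also have "\<dots> = alt_sum (\<lambda>v xs. leaf_deriv m w (g v xs) y) vs"
    unfolding alt_sum_def by (intro sum.cong refl leaf_deriv_cmult[OF g U(2)])
  finally show ?thesis .
qed

lemma smooth_on_alt_sum:
  assumes U: "coord_open m n U" and g: "\<And>v xs. smooth_on m n U (\<lambda>y. g v xs y)"
  shows "smooth_on m n U (\<lambda>y. alt_sum (\<lambda>v xs. g v xs y) vs)"
  unfolding alt_sum_def by (intro smooth_on_sum[OF U] smooth_on_mult[OF U] smooth_on_const g)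

text \<open>
  The part of \<open>f \<partial>\<bar>\<phi> - k \<partial>\<bar>f \<and> \<phi>\<close> in which \<open>u\<close> is the argument taken by the differential, \<open>g\<close> being
  the value of \<open>\<phi>\<close> at the other arguments.
\<close>

definition tw_deriv :: "nat \<Rightarrow> complex \<Rightarrow> (pt \<Rightarrow> complex) \<Rightarrow> cvec \<Rightarrow> (pt \<Rightarrow> complex) \<Rightarrow> pt \<Rightarrow> complex" where
  "tw_deriv m k f u g y = f y * leaf_deriv m (barpart u) g y - k * leaf_deriv m (barpart u) f y * g y"

lemma smooth_on_tw_deriv:
  assumes "coord_open m n U" "smooth_on m n U f" "smooth_on m n U g"
  shows "smooth_on m n U (tw_deriv m k f u g)"
  unfolding tw_deriv_def[abs_def]
  by (intro smooth_on_diff smooth_on_mult smooth_on_leaf_deriv smooth_on_const assms)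

lemma tw_deriv_expand: "tw_deriv m k f u g y = (\<Sum>c<2*m. coframe m c u * tw_deriv m k f (frame m c) g y)"
  unfolding tw_deriv_def
  by (subst (1 2) leaf_deriv_barpart_expand)
    (simp add: sum_distrib_left sum_distrib_right sum_subtractf algebra_simps)

text \<open>
  Writing \<open>u\<close> and \<open>v\<close> for the two differentiations, the composite is
  \<open>f\<^sup>2 u(v g) - k f u(v f) g - k f (v f u g + u f v g) + k (k + 1) u f v f g\<close>.
  The increase of the twist by one is what makes the terms with one derivative on \<open>f\<close> and one on \<open>g\<close>
  symmetric.
\<close>

lemma tw_deriv_commute:
  assumes U: "coord_open m n U" "y \<in> U" and f: "smooth_on m n U f" and g: "smooth_on m n U g"
  shows "tw_deriv m (k + 1) f u (tw_deriv m k f v g) y = tw_deriv m (k + 1) f v (tw_deriv m k f u g) y"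
proof -
  have eq: "tw_deriv m (k + 1) f u (tw_deriv m k f v g) y =
      f y * f y * leaf_deriv m (barpart u) (leaf_deriv m (barpart v) g) y
      - k * f y * leaf_deriv m (barpart u) (leaf_deriv m (barpart v) f) y * g y
      - k * f y * (leaf_deriv m (barpart v) f y * leaf_deriv m (barpart u) g y + leaf_deriv m (barpart u) f y * leaf_deriv m (barpart v) g y)
      + k * (k + 1) * leaf_deriv m (barpart u) f y * leaf_deriv m (barpart v) f y * g y" for u v
  proof -
    let ?u = "barpart u" and ?v = "barpart v"
    note S = smooth_on_leaf_deriv[OF U(1) f, of ?v] smooth_on_leaf_deriv[OF U(1) g, of ?v]
    have kf: "smooth_on m n U (\<lambda>y. k * leaf_deriv m ?v f y)"
      by (intro smooth_on_mult[OF U(1)] smooth_on_const S)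
    have "leaf_deriv m ?u (tw_deriv m k f v g) y =
        leaf_deriv m ?u (\<lambda>y. f y * leaf_deriv m ?v g y) y - leaf_deriv m ?u (\<lambda>y. k * leaf_deriv m ?v f y * g y) y"
      unfolding tw_deriv_def[abs_def]
      by (intro leaf_deriv_diff[OF U(1) _ _ U(2)] smooth_on_mult[OF U(1)] f g S kf)
    also have "\<dots> = f y * leaf_deriv m ?u (leaf_deriv m ?v g) y + leaf_deriv m ?u f y * leaf_deriv m ?v g y
        - (k * leaf_deriv m ?v f y * leaf_deriv m ?u g y + k * leaf_deriv m ?u (leaf_deriv m ?v f) y * g y)"
      by (simp add: leaf_deriv_mult[OF f S(2) U(2)] leaf_deriv_mult[OF kf g U(2)] leaf_deriv_cmult[OF S(1) U(2)])
    finally show ?thesis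
      by (simp add: tw_deriv_def[of m "k + 1"]) (simp add: tw_deriv_def algebra_simps)
  qed
  show ?thesis
    unfolding eq using leaf_deriv_commute[OF U f, of "barpart u" "barpart v"]
      leaf_deriv_commute[OF U g, of "barpart u" "barpart v"]
    by (simp add: algebra_simps)
qed

lemma tw_deriv_alt_sum:
  assumes U: "coord_open m n U" "y \<in> U" and g: "\<And>v xs. smooth_on m n U (\<lambda>y. g v xs y)"
  shows "tw_deriv m k f u (\<lambda>y. alt_sum (\<lambda>v xs. g v xs y) vs) y = alt_sum (\<lambda>v xs. tw_deriv m k f u (g v xs) y) vs"
  unfolding tw_deriv_def leaf_deriv_alt_sum[OF U g] by (simp add: alt_sum_diff alt_sum_mult)

definition local_form :: "nat \<Rightarrow> nat \<Rightarrow> int \<Rightarrow> int \<Rightarrow> pt set \<Rightarrow> (pt \<Rightarrow> altform) \<Rightarrow> bool" where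
  "local_form m n p q V \<phi> \<longleftrightarrow>
     (\<forall>y\<in>V. pq_form m p q (\<phi> y)) \<and> (\<forall>ws. smooth_on m n V (\<lambda>y. \<phi> y ws))"

lemma local_formD:
  assumes "local_form m n p q V \<phi>"
  shows "y \<in> V \<Longrightarrow> pq_form m p q (\<phi> y)" "smooth_on m n V (\<lambda>y. \<phi> y ws)"
  using assms by (auto simp: local_form_def)

lemma local_form_iff_coefficients:
  assumes V: "coord_open m n V"
  shows "local_form m n p q V \<phi> \<longleftrightarrow>
    (\<exists>c. (\<forall>A\<in>multi_index m p. \<forall>B\<in>multi_index m q. smooth_on m n V (c A B)) \<and>
      (\<forall>y\<in>V. \<forall>ws. \<phi> y ws = (\<Sum>A\<in>multi_index m p. \<Sum>B\<in>multi_index m q. c A B y * wedge_list (dzs A B) ws)))"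
    (is "_ \<longleftrightarrow> (\<exists>c. ?P c)")
proof
  assume L: "local_form m n p q V \<phi>"
  have "?P (\<lambda>A B y. coeff_form A B (\<phi> y))"
    using local_formD[OF L] pq_form_expand by (auto simp: coeff_form_def[abs_def])
  then show "\<exists>c. ?P c" by (rule exI[of ?P "\<lambda>A B y. coeff_form A B (\<phi> y)"])
next
  assume "\<exists>c. ?P c"
  then obtain c where c: "?P c" by blast
  then have eq: "\<phi> y = (\<lambda>ws. \<Sum>A\<in>multi_index m p. \<Sum>B\<in>multi_index m q. c A B y * wedge_list (dzs A B) ws)"
    if "y \<in> V" for y using that by auto
  have "pq_form m p q (\<phi> y)" if "y \<in> V" for y
    unfolding eq[OF that] by (intro pq_form_sum pq_form_scale pq_form_wedge_dzs)
  moreover have "smooth_on m n V (\<lambda>y. \<phi> y ws)" for ws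
  proof (rule smooth_on_cong[OF V, THEN iffD2])
    show "\<phi> y ws = (\<Sum>A\<in>multi_index m p. \<Sum>B\<in>multi_index m q. c A B y * wedge_list (dzs A B) ws)"
      if "y \<in> V" for y using eq[OF that] by simp
    show "smooth_on m n V (\<lambda>y. \<Sum>A\<in>multi_index m p. \<Sum>B\<in>multi_index m q. c A B y * wedge_list (dzs A B) ws)"
      using c by (intro smooth_on_sum[OF V] smooth_on_mult[OF V] smooth_on_const) blast
  qed
  ultimately show "local_form m n p q V \<phi>" by (simp add: local_form_def)
qed

text \<open>
  The products \<open>dz\<^sup>A \<and> dz\<bar>\<^sup>B\<close> are constant in the coordinates, so differentiating coefficients amounts to
  differentiating the values at constant arguments.
\<close>

lemma dbar_eq_alt_sum:
  assumes V: "coord_open m n V" "y \<in> V" and L: "local_form m n p q V \<phi>"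
  shows "(\<Sum>a<m. \<Sum>A\<in>multi_index m p. \<Sum>B\<in>multi_index m q.
      wirt_bar a (\<lambda>y. coeff_form A B (\<phi> y)) y * wedge_list (dz_bar a # dzs A B) ws) =
    alt_sum (\<lambda>u vs. leaf_deriv m (barpart u) (\<lambda>y. \<phi> y vs) y) ws"
proof -
  let ?I = "multi_index m p" and ?J = "multi_index m q"
  have sm: "smooth_on m n V (\<lambda>y. coeff_form A B (\<phi> y))" for A B
    using local_formD(2)[OF L] by (simp add: coeff_form_def)
  have "leaf_deriv m (barpart u) (\<lambda>y. \<phi> y vs) y =
      (\<Sum>A\<in>?I. \<Sum>B\<in>?J. \<Sum>a<m.
        wirt_bar a (\<lambda>y. coeff_form A B (\<phi> y)) y * (dz_bar a u * wedge_list (dzs A B) vs))" for u vs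
  proof -
    have "leaf_deriv m (barpart u) (\<lambda>y. \<phi> y vs) y = leaf_deriv m (barpart u) (\<lambda>y.
        \<Sum>A\<in>?I. \<Sum>B\<in>?J. wedge_list (dzs A B) vs * coeff_form A B (\<phi> y)) y"
      using pq_form_expand[OF local_formD(1)[OF L]]
      by (intro leaf_deriv_cong[OF V]) (simp add: mult.commute)
    also have "\<dots> = (\<Sum>A\<in>?I. \<Sum>B\<in>?J.
        leaf_deriv m (barpart u) (\<lambda>y. wedge_list (dzs A B) vs * coeff_form A B (\<phi> y)) y)"
      by (subst leaf_deriv_sum[OF V], intro smooth_on_sum[OF V(1)] smooth_on_mult[OF V(1)] smooth_on_const sm,
          intro sum.cong refl leaf_deriv_sum[OF V] smooth_on_mult[OF V(1)] smooth_on_const sm)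
    also have "\<dots> = (\<Sum>A\<in>?I. \<Sum>B\<in>?J.
        wedge_list (dzs A B) vs * leaf_deriv m (barpart u) (\<lambda>y. coeff_form A B (\<phi> y)) y)"
      by (simp add: leaf_deriv_cmult[OF sm V(2)])
    finally show ?thesis
      by (simp add: leaf_deriv_barpart sum_distrib_left dz_bar_def mult.commute mult.left_commute)
  qed
  then have "alt_sum (\<lambda>u vs. leaf_deriv m (barpart u) (\<lambda>y. \<phi> y vs) y) ws =
      (\<Sum>A\<in>?I. \<Sum>B\<in>?J. \<Sum>a<m.
        wirt_bar a (\<lambda>y. coeff_form A B (\<phi> y)) y * wedge_list (dz_bar a # dzs A B) ws)"
    by (simp add: alt_sum_sum alt_sum_mult wedge1_alt_sum)
  also have "\<dots> = (\<Sum>A\<in>?I. \<Sum>a<m. \<Sum>B\<in>?J.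
        wirt_bar a (\<lambda>y. coeff_form A B (\<phi> y)) y * wedge_list (dz_bar a # dzs A B) ws)"
    by (intro sum.cong refl sum.swap)
  also have "\<dots> = (\<Sum>a<m. \<Sum>A\<in>?I. \<Sum>B\<in>?J.
        wirt_bar a (\<lambda>y. coeff_form A B (\<phi> y)) y * wedge_list (dz_bar a # dzs A B) ws)"
    by (rule sum.swap)
  finally show ?thesis by simp
qed

definition tw_dbar :: "nat \<Rightarrow> complex \<Rightarrow> (pt \<Rightarrow> complex) \<Rightarrow> (pt \<Rightarrow> altform) \<Rightarrow> pt \<Rightarrow> altform" where
  "tw_dbar m k f \<phi> y = alt_sum (\<lambda>u vs. tw_deriv m k f u (\<lambda>y. \<phi> y vs) y)"

lemma tw_dbar_cong:
  assumes V: "coord_open m n V" "y \<in> V" and "\<And>y. y \<in> V \<Longrightarrow> f y = g y" "\<And>y. y \<in> V \<Longrightarrow> \<phi> y = \<psi> y"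
  shows "tw_dbar m k f \<phi> y = tw_dbar m k g \<psi> y"
proof -
  have "tw_deriv m k f u (\<lambda>y. \<phi> y vs) y = tw_deriv m k g u (\<lambda>y. \<psi> y vs) y" for u vs
    using leaf_deriv_cong[OF V, of f g "barpart u"] assms
      leaf_deriv_cong[OF V, of "\<lambda>y. \<phi> y vs" "\<lambda>y. \<psi> y vs" "barpart u"] by (simp add: tw_deriv_def)
  then show ?thesis by (simp add: tw_dbar_def)
qed

text \<open>
  Each defining property of a form is linear and holds near \<open>y\<close>, hence survives differentiation.
\<close>

lemma pq_form_tw_deriv:
  assumes V: "coord_open m n V" "y \<in> V" and L: "local_form m n p q V \<phi>"
  shows "pq_form m p q (\<lambda>vs. tw_deriv m k f u (\<lambda>y. \<phi> y vs) y)"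
proof -
  note LD = local_formD[OF L]
  note P = pq_formD[OF LD(1)]
  have lin: "tw_deriv m k f u (\<lambda>y. c * \<phi> y vs) y = c * tw_deriv m k f u (\<lambda>y. \<phi> y vs) y" for c vs
    by (simp add: tw_deriv_def leaf_deriv_cmult[OF LD(2) V(2)] algebra_simps)
  have cong: "tw_deriv m k f u g y = tw_deriv m k f u h y" if "\<And>y. y \<in> V \<Longrightarrow> g y = h y" for g h
    using leaf_deriv_cong[OF V that] that[OF V(2)] by (simp add: tw_deriv_def)
  have "alternating (\<lambda>vs. tw_deriv m k f u (\<lambda>y. \<phi> y vs) y)"
    unfolding alternating_def
  proof (intro allI)
    fix xs v w ys
    have "tw_deriv m k f u (\<lambda>y. \<phi> y (xs @ v # w # ys)) y = tw_deriv m k f u (\<lambda>y. (-1) * \<phi> y (xs @ w # v # ys)) y"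
    proof (rule cong)
      fix y assume "y \<in> V"
      from alternatingD[OF P(1)[OF this], of xs v w ys]
      show "\<phi> y (xs @ v # w # ys) = (-1) * \<phi> y (xs @ w # v # ys)" by simp
    qed
    then show "tw_deriv m k f u (\<lambda>y. \<phi> y (xs @ v # w # ys)) y = - tw_deriv m k f u (\<lambda>y. \<phi> y (xs @ w # v # ys)) y"
      unfolding lin by simp
  qed
  moreover have "multilinear m (\<lambda>vs. tw_deriv m k f u (\<lambda>y. \<phi> y vs) y)"
    unfolding multilinear_def
  proof (intro allI)
    fix xs w ys
    have "tw_deriv m k f u (\<lambda>y. \<phi> y (xs @ w # ys)) y =
        tw_deriv m k f u (\<lambda>y. \<Sum>c<2*m. coframe m c w * \<phi> y (xs @ frame m c # ys)) y"
      by (rule cong) (rule multilinearD[OF P(2)])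
    also have "\<dots> = (\<Sum>c<2*m. coframe m c w * tw_deriv m k f u (\<lambda>y. \<phi> y (xs @ frame m c # ys)) y)"
      unfolding tw_deriv_def
      by (subst leaf_deriv_sum[OF V], intro smooth_on_mult[OF V(1)] smooth_on_const LD(2))
        (simp add: leaf_deriv_cmult[OF LD(2) V(2)] sum_distrib_left sum_subtractf algebra_simps)
    finally show "tw_deriv m k f u (\<lambda>y. \<phi> y (xs @ w # ys)) y =
      (\<Sum>c<2*m. coframe m c w * tw_deriv m k f u (\<lambda>y. \<phi> y (xs @ frame m c # ys)) y)" .
  qed
  moreover have "int (length ws) = p + q" if "tw_deriv m k f u (\<lambda>y. \<phi> y ws) y \<noteq> 0" for ws
  proof (rule ccontr)
    assume "int (length ws) \<noteq> p + q"
    then have "tw_deriv m k f u (\<lambda>y. \<phi> y ws) y = tw_deriv m k f u (\<lambda>y. 0) y"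
      using P(3) by (intro cong) blast
    with that show False by (simp add: tw_deriv_def)
  qed
  moreover have "tw_deriv m k f u (\<lambda>y. \<phi> y (map (zscale s) ws)) y = s powi p * tw_deriv m k f u (\<lambda>y. \<phi> y ws) y"
    if "s \<noteq> 0" for s ws
    unfolding lin[symmetric] by (rule cong) (rule P(4)[OF _ that])
  ultimately show ?thesis by (simp only: pq_form_def) blast
qed

lemma local_form_tw_dbar:
  assumes V: "coord_open m n V" and f: "smooth_on m n V f" and L: "local_form m n p q V \<phi>"
  shows "local_form m n p (q + 1) V (tw_dbar m k f \<phi>)"
  unfolding local_form_def
proof (intro conjI ballI allI)
  fix y assume y: "y \<in> V"
  show "pq_form m p (q + 1) (tw_dbar m k f \<phi> y)"
    unfolding tw_dbar_def
  proof (rule pq_form_alt_sum[where i = 0])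
    show "tw_deriv m k f (zscale s u) (\<lambda>y. \<phi> y vs) y = s powi 0 * tw_deriv m k f u (\<lambda>y. \<phi> y vs) y" for s u vs
      by (simp add: tw_deriv_def barpart_def zscale_def)
  qed (rule pq_form_tw_deriv[OF V y L] tw_deriv_expand | simp)+
next
  show "smooth_on m n V (\<lambda>y. tw_dbar m k f \<phi> y ws)" for ws
    unfolding tw_dbar_def by (intro smooth_on_alt_sum[OF V] smooth_on_tw_deriv[OF V f] local_formD(2)[OF L])
qed

lemma tw_dbar_tw_dbar:
  assumes V: "coord_open m n V" "y \<in> V" and f: "smooth_on m n V f" and L: "local_form m n p q V \<phi>"
  shows "tw_dbar m (k + 1) f (tw_dbar m k f \<phi>) y ws = 0"
proof -
  note S = local_formD(2)[OF L]
  have "tw_dbar m (k + 1) f (tw_dbar m k f \<phi>) y ws =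
      alt_sum (\<lambda>u vs. alt_sum (\<lambda>v xs. tw_deriv m (k + 1) f u (tw_deriv m k f v (\<lambda>y. \<phi> y xs)) y) vs) ws"
    unfolding tw_dbar_def by (subst tw_deriv_alt_sum[OF V smooth_on_tw_deriv[OF V(1) f S]]) simp
  also have "\<dots> = 0"
    by (rule alt_sum_alt_sum_symmetric) (rule tw_deriv_commute[OF V f S])
  finally show ?thesis .
qed

lemma tw_dbar_lincomb:
  assumes V: "coord_open m n V" "y \<in> V" and L: "local_form m n p q V \<phi>" "local_form m n p q V \<psi>"
  shows "tw_dbar m k f (\<lambda>y ws. a * \<phi> y ws + b * \<psi> y ws) y ws = a * tw_dbar m k f \<phi> y ws + b * tw_dbar m k f \<psi> y ws"
proof -
  note S = local_formD(2)[OF L(1)] local_formD(2)[OF L(2)]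
  have "leaf_deriv m w (\<lambda>y. a * \<phi> y vs + b * \<psi> y vs) y =
      leaf_deriv m w (\<lambda>y. a * \<phi> y vs) y + leaf_deriv m w (\<lambda>y. b * \<psi> y vs) y" for w vs
    by (intro leaf_deriv_add[of m n V] smooth_on_mult[OF V(1)] smooth_on_const S V(2))
  then have "tw_deriv m k f u (\<lambda>y. a * \<phi> y vs + b * \<psi> y vs) y =
      a * tw_deriv m k f u (\<lambda>y. \<phi> y vs) y + b * tw_deriv m k f u (\<lambda>y. \<psi> y vs) y" for u vs
    by (simp add: tw_deriv_def leaf_deriv_cmult[OF S(1) V(2)] leaf_deriv_cmult[OF S(2) V(2)] algebra_simps)
  then show ?thesis by (simp add: tw_dbar_def alt_sum_add alt_sum_mult)
qed

section \<open>Pullback of local forms\<close>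

definition pull :: "nat \<Rightarrow> (pt \<Rightarrow> pt) \<Rightarrow> (pt \<Rightarrow> altform) \<Rightarrow> pt \<Rightarrow> altform" where
  "pull m G \<phi> y ws = \<phi> (G y) (map (leaf_diff m G y) ws)"

lemma multilinear_pull:
  assumes \<phi>: "multilinear m' \<psi>"
  shows "multilinear m (\<lambda>ws. \<psi> (map (leaf_diff m G y) ws))"
  unfolding multilinear_def
proof (intro allI)
  fix xs w ys
  let ?L = "leaf_diff m G y"
  have "\<psi> (map ?L (xs @ w # ys)) =
      (\<Sum>c<2*m'. (\<Sum>d<2*m. coframe m d w * coframe m' c (?L (frame m d))) * \<psi> (map ?L xs @ frame m' c # map ?L ys))"
    using multilinearD[OF \<phi>, of "map ?L xs" "?L w" "map ?L ys"] leaf_deriv_expand[of m w]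
    by (simp add: coframe_leaf_diff)
  also have "\<dots> = (\<Sum>c<2*m'. \<Sum>d<2*m. coframe m d w * (coframe m' c (?L (frame m d)) * \<psi> (map ?L xs @ frame m' c # map ?L ys)))"
    by (simp add: sum_distrib_right mult.assoc)
  also have "\<dots> = (\<Sum>d<2*m. coframe m d w * (\<Sum>c<2*m'. coframe m' c (?L (frame m d)) * \<psi> (map ?L xs @ frame m' c # map ?L ys)))"
    by (subst sum.swap) (simp add: sum_distrib_left)
  also have "\<dots> = (\<Sum>d<2*m. coframe m d w * \<psi> (map ?L (xs @ frame m d # ys)))"
    using multilinearD[OF \<phi>, of "map ?L xs" "?L _" "map ?L ys"] by simp
  finally show "\<psi> (map ?L (xs @ w # ys)) = (\<Sum>d<2*m. coframe m d w * \<psi> (map ?L (xs @ frame m d # ys)))" .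
qed

lemma pq_form_pull:
  assumes G: "leaf_map m n m' n' U V G" and y: "y \<in> U" and \<phi>: "pq_form m' p q (\<phi> (G y))"
  shows "pq_form m p q (pull m G \<phi> y)"
proof -
  note P = pq_formD[OF \<phi>]
  have "alternating (pull m G \<phi> y)"
    unfolding alternating_def
  proof (intro allI)
    fix xs u v ys
    show "pull m G \<phi> y (xs @ u # v # ys) = - pull m G \<phi> y (xs @ v # u # ys)"
      using alternatingD[OF P(1), of "map (leaf_diff m G y) xs" "leaf_diff m G y u"
          "leaf_diff m G y v" "map (leaf_diff m G y) ys"]
      by (simp add: pull_def)
  qed
  moreover have "multilinear m (pull m G \<phi> y)"
    using multilinear_pull[OF P(2)] by (simp add: pull_def[abs_def])
  moreover have "pull m G \<phi> y (map (zscale s) ws) = s powi p * pull m G \<phi> y ws" if "s \<noteq> 0" for s ws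
    using P(4)[OF that, of "map (leaf_diff m G y) ws"]
    by (simp add: pull_def leaf_diff_zscale[OF G y] o_def)
  moreover have "int (length ws) = p + q" if "pull m G \<phi> y ws \<noteq> 0" for ws
    using P(3)[of "map (leaf_diff m G y) ws"] that by (simp add: pull_def)
  ultimately show ?thesis unfolding pq_form_def by blast
qed

lemma smooth_on_pull:
  assumes G: "leaf_map m n m' n' U V G"
    and "\<And>y. y \<in> V \<Longrightarrow> multilinear m' (\<phi> y)" "\<And>ws. smooth_on m' n' V (\<lambda>y. \<phi> y ws)"
  shows "smooth_on m n U (\<lambda>y. pull m G \<phi> y ws)"
  using assms(2,3)
proof (induction ws arbitrary: \<phi>)
  case Nil
  then show ?case using smooth_on_leaf_map[OF G, of "\<lambda>y. \<phi> y []"] by (simp add: pull_def)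
next
  case (Cons w ws)
  note U = leaf_mapD(1)[OF G]
  show ?case
  proof (rule smooth_on_cong[OF U, THEN iffD2])
    show "pull m G \<phi> y (w # ws) =
      (\<Sum>c<2*m'. coframe m' c (leaf_diff m G y w) * pull m G (\<lambda>y vs. \<phi> y (frame m' c # vs)) y ws)"
      if "y \<in> U" for y
      using multilinear_head[OF Cons.prems(1)[OF leaf_mapD(3)[OF G that]],
          of "leaf_diff m G y w" "map (leaf_diff m G y) ws"]
      by (simp add: pull_def)
    show "smooth_on m n U (\<lambda>y. \<Sum>c<2*m'. coframe m' c (leaf_diff m G y w) * pull m G (\<lambda>y vs. \<phi> y (frame m' c # vs)) y ws)"
      using Cons.prems
      by (intro smooth_on_sum[OF U] smooth_on_mult[OF U] smooth_on_coframe_leaf_diff[OF G] Cons.IH multilinear_Cons)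
  qed
qed

lemma local_form_pull:
  assumes G: "leaf_map m n m' n' U V G" and L: "local_form m' n' p q V \<phi>"
  shows "local_form m n p q U (pull m G \<phi>)"
  unfolding local_form_def
proof (intro conjI ballI allI)
  show "pq_form m p q (pull m G \<phi> y)" if "y \<in> U" for y
    by (rule pq_form_pull[where \<phi> = \<phi>, OF G that local_formD(1)[OF L leaf_mapD(3)[OF G that]]])
  show "smooth_on m n U (\<lambda>y. pull m G \<phi> y ws)" for ws
    by (rule smooth_on_pull[OF G pq_formD(2)[OF local_formD(1)[OF L]] local_formD(2)[OF L]])
qed

text \<open>
  The derivative of the leafwise differential of \<open>G\<close>, applied to \<open>v\<close>, in the direction \<open>u\<close>.
\<close>

definition leaf_hess :: "nat \<Rightarrow> (pt \<Rightarrow> pt) \<Rightarrow> pt \<Rightarrow> cvec \<Rightarrow> cvec \<Rightarrow> cvec" where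
  "leaf_hess m G y u v =
     ((\<lambda>b. leaf_deriv m u (\<lambda>y. fst (leaf_diff m G y v) b) y), (\<lambda>b. leaf_deriv m u (\<lambda>y. snd (leaf_diff m G y v) b) y))"

lemma coframe_leaf_hess: "coframe m' c (leaf_hess m G y u v) = leaf_deriv m u (\<lambda>y. coframe m' c (leaf_diff m G y v)) y"
  by (simp add: coframe_def leaf_hess_def dz_def dz_bar_def)

text \<open>
  The holomorphic components of both sides vanish, because \<open>\<partial>\<bar>\<close> commutes with \<open>v\<close> and annihilates the
  holomorphic functions \<open>fst (G y) b\<close>.  For the antiholomorphic components only the antiholomorphic
  part of the second vector matters, and second derivatives commute.
\<close>

lemma leaf_hess_barpart_commute:
  assumes G: "leaf_map m n m' n' U V G" and y: "y \<in> U"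
  shows "leaf_hess m G y (barpart u) v = leaf_hess m G y (barpart v) u"
proof -
  note GD = leaf_mapD[OF G]
  have "leaf_deriv m (barpart u) (leaf_deriv m v (\<lambda>y. fst (G y) b)) y = 0" for u v b
  proof -
    have "leaf_deriv m (barpart u) (leaf_deriv m v (\<lambda>y. fst (G y) b)) y =
        leaf_deriv m v (leaf_deriv m (barpart u) (\<lambda>y. fst (G y) b)) y"
      by (rule leaf_deriv_commute[OF GD(1) y GD(4)])
    also have "\<dots> = leaf_deriv m v (\<lambda>y. 0) y"
      by (rule leaf_deriv_cong[OF GD(1) y]) (simp add: leaf_deriv_barpart GD(6))
    finally show ?thesis by simp
  qed
  moreover have "leaf_deriv m (barpart u) (leaf_deriv m v (\<lambda>y. cnj (fst (G y) b))) y =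
      leaf_deriv m (barpart u) (leaf_deriv m (barpart v) (\<lambda>y. cnj (fst (G y) b))) y" for u v b
    by (rule leaf_deriv_cong[OF GD(1) y]) (simp add: leaf_deriv_def barpart_def leaf_map_wirt_cnj[OF G])
  ultimately show ?thesis
    using leaf_deriv_commute[OF GD(1) y smooth_on_cnj[OF GD(1) GD(4)], of "barpart u" "barpart v"]
    by (simp add: leaf_hess_def fst_leaf_diff snd_leaf_diff)
qed

text \<open>
  By the product rule the derivative falls on \<open>\<phi>\<close> or on one of its arguments.  Alternation moves the
  differentiated argument to the front, which makes the sum over the arguments an alternating sum.
\<close>

lemma leaf_deriv_pull:
  assumes G: "leaf_map m n m' n' U V G" and y: "y \<in> U"
    and "\<And>y. y \<in> V \<Longrightarrow> alternating (\<phi> y)" "\<And>y. y \<in> V \<Longrightarrow> multilinear m' (\<phi> y)"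
      "\<And>ws. smooth_on m' n' V (\<lambda>y. \<phi> y ws)"
  shows "leaf_deriv m u (\<lambda>y. pull m G \<phi> y vs) y =
    leaf_deriv m' (leaf_diff m G y u) (\<lambda>z. \<phi> z (map (leaf_diff m G y) vs)) (G y) +
    alt_sum (\<lambda>v xs. \<phi> (G y) (leaf_hess m G y u v # map (leaf_diff m G y) xs)) vs"
  using assms(3-5)
proof (induction vs arbitrary: \<phi>)
  case Nil
  then show ?case using leaf_deriv_leaf_map[OF G _ y, of "\<lambda>y. \<phi> y []"] by (simp add: pull_def)
next
  case (Cons v vs)
  note U = leaf_mapD(1)[OF G] and V = leaf_mapD(2)[OF G]
  let ?L = "leaf_diff m G y"
  have Gy: "G y \<in> V" by (rule leaf_mapD(3)[OF G y])
  define \<phi>c where "\<phi>c c z vs = \<phi> z (frame m' c # vs)" for c z vs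
  have IH: "leaf_deriv m u (\<lambda>y. pull m G (\<phi>c c) y vs) y =
      leaf_deriv m' (?L u) (\<lambda>z. \<phi>c c z (map ?L vs)) (G y) +
      alt_sum (\<lambda>v xs. \<phi>c c (G y) (leaf_hess m G y u v # map ?L xs)) vs" for c
    unfolding \<phi>c_def
    using Cons.prems by (intro Cons.IH alternating_Cons multilinear_Cons)
  have sm1: "smooth_on m n U (\<lambda>y. coframe m' c (leaf_diff m G y v))" for c
    by (rule smooth_on_coframe_leaf_diff[OF G])
  have sm2: "smooth_on m n U (\<lambda>y. pull m G (\<phi>c c) y vs)" for c
    unfolding \<phi>c_def using Cons.prems by (intro smooth_on_pull[OF G] multilinear_Cons)
  have "leaf_deriv m u (\<lambda>y. pull m G \<phi> y (v # vs)) y =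
      leaf_deriv m u (\<lambda>y. \<Sum>c<2*m'. coframe m' c (leaf_diff m G y v) * pull m G (\<phi>c c) y vs) y"
  proof (rule leaf_deriv_cong[OF U y])
    fix y assume "y \<in> U"
    from multilinear_head[OF Cons.prems(2)[OF leaf_mapD(3)[OF G this]],
        of "leaf_diff m G y v" "map (leaf_diff m G y) vs"]
    show "pull m G \<phi> y (v # vs) = (\<Sum>c<2*m'. coframe m' c (leaf_diff m G y v) * pull m G (\<phi>c c) y vs)"
      by (simp add: pull_def \<phi>c_def)
  qed
  also have "\<dots> = (\<Sum>c<2*m'. leaf_deriv m u (\<lambda>y. coframe m' c (leaf_diff m G y v) * pull m G (\<phi>c c) y vs) y)"
    by (intro leaf_deriv_sum[OF U y] smooth_on_mult[OF U] sm1 sm2)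
  also have "\<dots> = (\<Sum>c<2*m'. coframe m' c (?L v) * leaf_deriv m' (?L u) (\<lambda>z. \<phi>c c z (map ?L vs)) (G y))
      + (\<Sum>c<2*m'. coframe m' c (?L v) * alt_sum (\<lambda>v xs. \<phi>c c (G y) (leaf_hess m G y u v # map ?L xs)) vs)
      + (\<Sum>c<2*m'. coframe m' c (leaf_hess m G y u v) * \<phi>c c (G y) (map ?L vs))"
    by (simp add: leaf_deriv_mult[OF sm1 sm2 y] IH coframe_leaf_hess sum.distrib distrib_left) (simp add: pull_def)
  also have "(\<Sum>c<2*m'. coframe m' c (leaf_hess m G y u v) * \<phi>c c (G y) (map ?L vs)) =
      \<phi> (G y) (leaf_hess m G y u v # map ?L vs)"
    using multilinear_head[OF Cons.prems(2)[OF Gy], of "leaf_hess m G y u v" "map ?L vs"] by (simp add: \<phi>c_def)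
  also have "(\<Sum>c<2*m'. coframe m' c (?L v) * leaf_deriv m' (?L u) (\<lambda>z. \<phi>c c z (map ?L vs)) (G y)) =
      leaf_deriv m' (?L u) (\<lambda>z. \<phi> z (?L v # map ?L vs)) (G y)"
  proof -
    have "leaf_deriv m' (?L u) (\<lambda>z. \<phi> z (?L v # map ?L vs)) (G y) =
        leaf_deriv m' (?L u) (\<lambda>z. \<Sum>c<2*m'. coframe m' c (?L v) * \<phi>c c z (map ?L vs)) (G y)"
      using multilinear_head[OF Cons.prems(2), of _ "?L v" "map ?L vs"]
      by (intro leaf_deriv_cong[OF V Gy]) (simp add: \<phi>c_def)
    also have "\<dots> = (\<Sum>c<2*m'. leaf_deriv m' (?L u) (\<lambda>z. coframe m' c (?L v) * \<phi>c c z (map ?L vs)) (G y))"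
      unfolding \<phi>c_def by (intro leaf_deriv_sum[OF V Gy] smooth_on_mult[OF V] smooth_on_const Cons.prems(3))
    also have "\<dots> = (\<Sum>c<2*m'. coframe m' c (?L v) * leaf_deriv m' (?L u) (\<lambda>z. \<phi>c c z (map ?L vs)) (G y))"
      unfolding \<phi>c_def by (simp add: leaf_deriv_cmult[OF Cons.prems(3) Gy])
    finally show ?thesis by simp
  qed
  also have "(\<Sum>c<2*m'. coframe m' c (?L v) * alt_sum (\<lambda>v xs. \<phi>c c (G y) (leaf_hess m G y u v # map ?L xs)) vs) =
      alt_sum (\<lambda>w xs. \<phi> (G y) (?L v # leaf_hess m G y u w # map ?L xs)) vs"
    unfolding alt_sum_mult[symmetric] alt_sum_sum[symmetric] \<phi>c_def
    by (rule alt_sum_cong) (rule multilinear_head[OF Cons.prems(2)[OF Gy], symmetric])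
  also have "\<dots> = alt_sum (\<lambda>w xs. - \<phi> (G y) (leaf_hess m G y u w # ?L v # map ?L xs)) vs"
    by (rule alt_sum_cong) (rule alternating_swap[OF Cons.prems(1)[OF Gy]])
  finally show ?case by (simp add: alt_sum_Cons alt_sum_uminus)
qed

text \<open>
  Beside the pulled back derivative, \<open>leaf_deriv_pull\<close> contributes a double alternating sum over two
  arguments that enter through a symmetric second derivative; it is 0.
\<close>

lemma tw_dbar_pull:
  assumes G: "leaf_map m n m' n' U V G" and y: "y \<in> U"
    and L: "local_form m' n' p q V \<phi>" and f: "smooth_on m' n' V f"
  shows "tw_dbar m k (\<lambda>y. f (G y)) (pull m G \<phi>) y ws = pull m G (tw_dbar m' k f \<phi>) y ws"
proof -
  let ?L = "leaf_diff m G y"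
  note LD = local_formD[OF L]
  have Gy: "G y \<in> V" by (rule leaf_mapD(3)[OF G y])
  have "tw_deriv m k (\<lambda>y. f (G y)) u (\<lambda>y. pull m G \<phi> y vs) y =
      tw_deriv m' k f (?L u) (\<lambda>z. \<phi> z (map ?L vs)) (G y) +
      f (G y) * alt_sum (\<lambda>v xs. \<phi> (G y) (leaf_hess m G y (barpart u) v # map ?L xs)) vs" for u vs
    using leaf_deriv_pull[OF G y pq_formD(1)[OF LD(1)] pq_formD(2)[OF LD(1)] LD(2), of "barpart u" vs]
      leaf_deriv_leaf_map[OF G f y, of "barpart u"]
    by (simp add: tw_deriv_def leaf_diff_barpart[OF G y] algebra_simps) (simp add: pull_def)
  then have "tw_dbar m k (\<lambda>y. f (G y)) (pull m G \<phi>) y ws = pull m G (tw_dbar m' k f \<phi>) y ws +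
      f (G y) * alt_sum (\<lambda>u. alt_sum (\<lambda>v xs. \<phi> (G y) (leaf_hess m G y (barpart u) v # map ?L xs))) ws"
    by (simp add: tw_dbar_def pull_def[of _ _ "\<lambda>y. alt_sum _"] alt_sum_add alt_sum_mult alt_sum_map)
      (simp add: pull_def tw_dbar_def alt_sum_map)
  also have "alt_sum (\<lambda>u. alt_sum (\<lambda>v xs. \<phi> (G y) (leaf_hess m G y (barpart u) v # map ?L xs))) ws = 0"
    by (rule alt_sum_alt_sum_symmetric) (simp only: leaf_hess_barpart_commute[OF G y])
  finally show ?thesis by simp
qed

section \<open>Cochain complexes and mapping cones\<close>

locale cochain_complex =
  fixes K :: "'v::ab_group_add cochain"
  assumes zero_mem: "0 \<in> cdeg K q"
    and diff_mem: "x \<in> cdeg K q \<Longrightarrow> y \<in> cdeg K q \<Longrightarrow> x - y \<in> cdeg K q"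
    and scale_mem: "x \<in> cdeg K q \<Longrightarrow> cscale K c x \<in> cdeg K q"
    and d_mem: "x \<in> cdeg K q \<Longrightarrow> cdiff K q x \<in> cdeg K (q + 1)"
    and d_diff: "x \<in> cdeg K q \<Longrightarrow> y \<in> cdeg K q \<Longrightarrow> cdiff K q (x - y) = cdiff K q x - cdiff K q y"
    and d_scale: "x \<in> cdeg K q \<Longrightarrow> cdiff K q (cscale K c x) = cscale K c (cdiff K q x)"
    and d_d: "x \<in> cdeg K q \<Longrightarrow> cdiff K (q + 1) (cdiff K q x) = 0"
    and scale_diff: "cscale K c (x - y) = cscale K c x - cscale K c y"
begin

lemma scale_zero: "cscale K c 0 = 0"
  using scale_diff[of c 0 0] by simp

lemma d_zero: "cdiff K q 0 = 0"
  using d_diff[OF zero_mem zero_mem, of q] by simp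

lemma uminus_mem: "x \<in> cdeg K q \<Longrightarrow> - x \<in> cdeg K q"
  using diff_mem[OF zero_mem, of x q] by simp

lemma add_mem: "x \<in> cdeg K q \<Longrightarrow> y \<in> cdeg K q \<Longrightarrow> x + y \<in> cdeg K q"
  using diff_mem[OF _ uminus_mem] by fastforce

lemma d_uminus: "x \<in> cdeg K q \<Longrightarrow> cdiff K q (- x) = - cdiff K q x"
  using d_diff[OF zero_mem, of x q] by (simp add: d_zero)

lemma d_add: "x \<in> cdeg K q \<Longrightarrow> y \<in> cdeg K q \<Longrightarrow> cdiff K q (x + y) = cdiff K q x + cdiff K q y"
  using d_diff[OF _ uminus_mem, of x q y] by (simp add: d_uminus)

lemma cocyclesI: "x \<in> cdeg K q \<Longrightarrow> cdiff K q x = 0 \<Longrightarrow> x \<in> cocycles K q"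
  by (simp add: cocycles_def)

lemma cocyclesD: "x \<in> cocycles K q \<Longrightarrow> x \<in> cdeg K q" "x \<in> cocycles K q \<Longrightarrow> cdiff K q x = 0"
  by (simp_all add: cocycles_def)

lemma zero_cocycle: "0 \<in> cocycles K q"
  by (simp add: cocycles_def zero_mem d_zero)

lemma add_cocycle: "x \<in> cocycles K q \<Longrightarrow> y \<in> cocycles K q \<Longrightarrow> x + y \<in> cocycles K q"
  by (simp add: cocycles_def add_mem d_add)

lemma diff_cocycle: "x \<in> cocycles K q \<Longrightarrow> y \<in> cocycles K q \<Longrightarrow> x - y \<in> cocycles K q"
  by (simp add: cocycles_def diff_mem d_diff)

lemma scale_cocycle: "x \<in> cocycles K q \<Longrightarrow> cscale K c x \<in> cocycles K q"
  by (simp add: cocycles_def scale_mem d_scale scale_zero)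

lemma coboundary_cocycle: "x \<in> coboundaries K q \<Longrightarrow> x \<in> cocycles K q"
  using d_mem[of _ "q - 1"] d_d[of _ "q - 1"] by (auto simp: cocycles_def coboundaries_def)

lemma coboundariesI: "y \<in> cdeg K (q - 1) \<Longrightarrow> cdiff K (q - 1) y = x \<Longrightarrow> x \<in> coboundaries K q"
  by (auto simp: coboundaries_def)

lemma coboundariesE:
  assumes "x \<in> coboundaries K q"
  obtains y where "y \<in> cdeg K (q - 1)" "x = cdiff K (q - 1) y"
  using assms by (auto simp: coboundaries_def)

lemma zero_coboundary: "0 \<in> coboundaries K q"
  using zero_mem d_zero by (intro coboundariesI) auto

lemma diff_coboundary: "x \<in> coboundaries K q \<Longrightarrow> y \<in> coboundaries K q \<Longrightarrow> x - y \<in> coboundaries K q"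
  by (elim coboundariesE) (metis coboundariesI diff_mem d_diff)

lemma scale_coboundary: "x \<in> coboundaries K q \<Longrightarrow> cscale K c x \<in> coboundaries K q"
  by (elim coboundariesE) (metis coboundariesI scale_mem d_scale)

lemma group_cocycle_group: "comm_group (cocycle_group K q)"
proof (rule comm_groupI)
  fix x assume "x \<in> carrier (cocycle_group K q)"
  then show "\<exists>y\<in>carrier (cocycle_group K q). y \<otimes>\<^bsub>cocycle_group K q\<^esub> x = \<one>\<^bsub>cocycle_group K q\<^esub>"
    using diff_cocycle[OF zero_cocycle, of x q]
    by (auto simp: cocycle_group_def intro!: bexI[of _ "- x"])
qed (auto simp: cocycle_group_def zero_cocycle add_cocycle add_ac)

lemma inv_cocycle_group:
  assumes "x \<in> cocycles K q"
  shows "inv\<^bsub>cocycle_group K q\<^esub> x = - x"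
proof -
  interpret comm_group "cocycle_group K q" by (rule group_cocycle_group)
  show ?thesis
    using assms diff_cocycle[OF zero_cocycle assms]
    by (intro inv_equality) (auto simp: cocycle_group_def)
qed

lemma normal_coboundaries: "coboundaries K q \<lhd> cocycle_group K q"
proof -
  interpret comm_group "cocycle_group K q" by (rule group_cocycle_group)
  have "subgroup (coboundaries K q) (cocycle_group K q)"
  proof (rule subgroupI)
    show "coboundaries K q \<subseteq> carrier (cocycle_group K q)"
      using coboundary_cocycle by (auto simp: cocycle_group_def)
    show "coboundaries K q \<noteq> {}" using zero_coboundary by blast
    show "inv\<^bsub>cocycle_group K q\<^esub> x \<in> coboundaries K q" if "x \<in> coboundaries K q" for x
      using diff_coboundary[OF zero_coboundary that] inv_cocycle_group[OF coboundary_cocycle[OF that]]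
      by simp
    show "x \<otimes>\<^bsub>cocycle_group K q\<^esub> y \<in> coboundaries K q"
      if "x \<in> coboundaries K q" "y \<in> coboundaries K q" for x y
      using diff_coboundary[OF that(1) diff_coboundary[OF zero_coboundary that(2)]]
      by (simp add: cocycle_group_def)
  qed
  then show ?thesis by (rule subgroup_imp_normal)
qed

lemma group_cohomology: "group (cohomology K q)"
  unfolding cohomology_def by (rule normal.factorgroup_is_group[OF normal_coboundaries])

lemma carrier_cohomology: "carrier (cohomology K q) = coh_class K q ` cocycles K q"
  by (auto simp: cohomology_def carrier_FactGroup coh_class_def cocycle_group_def)

lemma mult_cohomology:
  assumes "x \<in> cocycles K q" "y \<in> cocycles K q"
  shows "coh_class K q x \<otimes>\<^bsub>cohomology K q\<^esub> coh_class K q y = coh_class K q (x + y)"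
  using normal.rcos_sum[OF normal_coboundaries, of x q y] assms
  by (simp add: cohomology_def coh_class_def cocycle_group_def)

lemma coh_class_eq: "coh_class K q x = (\<lambda>b. b + x) ` coboundaries K q"
  by (auto simp: coh_class_def r_coset_def cocycle_group_def)

lemma coh_class_eq_iff: "coh_class K q x = coh_class K q y \<longleftrightarrow> x - y \<in> coboundaries K q"
proof
  assume "coh_class K q x = coh_class K q y"
  moreover have "x \<in> coh_class K q x" using zero_coboundary by (force simp: coh_class_eq)
  ultimately obtain b where "b \<in> coboundaries K q" "x = b + y" by (auto simp: coh_class_eq)
  then show "x - y \<in> coboundaries K q" by simp
next
  have sub: "coh_class K q x \<subseteq> coh_class K q y" if *: "x - y \<in> coboundaries K q" for x y
  proof
    fix z assume "z \<in> coh_class K q x"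
    then obtain b where b: "b \<in> coboundaries K q" "z = b + x" by (auto simp: coh_class_eq)
    have "b - (0 - (x - y)) \<in> coboundaries K q"
      by (intro diff_coboundary b * zero_coboundary)
    then show "z \<in> coh_class K q y"
      using b by (auto simp: coh_class_eq image_iff algebra_simps intro!: bexI[of _ "b - (0 - (x - y))"])
  qed
  assume *: "x - y \<in> coboundaries K q"
  then have "y - x \<in> coboundaries K q" using diff_coboundary[OF zero_coboundary *] by simp
  with sub * show "coh_class K q x = coh_class K q y" by blast
qed

lemma one_cohomology: "\<one>\<^bsub>cohomology K q\<^esub> = coh_class K q 0"
  by (simp add: cohomology_def coh_class_eq)

lemma coh_class_eq_one_iff: "coh_class K q x = \<one>\<^bsub>cohomology K q\<^esub> \<longleftrightarrow> x \<in> coboundaries K q"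
  by (simp add: one_cohomology coh_class_eq_iff)

end

text \<open>
  A map on representatives between two single cohomology groups, not assumed to be part of a map of
  complexes: the inclusion into the cone commutes with the differentials only up to sign.
\<close>

locale cohomology_map =
  A: cochain_complex A + B: cochain_complex B
  for A :: "'v::ab_group_add cochain" and q :: int
    and B :: "'w::ab_group_add cochain" and r :: int and h :: "'v \<Rightarrow> 'w" +
  assumes map_cocycle: "x \<in> cocycles A q \<Longrightarrow> h x \<in> cocycles B r"
    and map_coboundary: "x \<in> coboundaries A q \<Longrightarrow> h x \<in> coboundaries B r"
    and map_diff: "x \<in> cocycles A q \<Longrightarrow> y \<in> cocycles A q \<Longrightarrow> h (x - y) = h x - h y"
begin

lemma induced_class:
  assumes x: "x \<in> cocycles A q"
  shows "induced B r h (coh_class A q x) = coh_class B r (h x)"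
proof -
  have "coh_class B r (h x') = coh_class B r (h x)" if x': "x' \<in> coh_class A q x" for x'
  proof -
    obtain b where b: "b \<in> coboundaries A q" "x' = b + x" using x' by (auto simp: A.coh_class_eq)
    have "x' \<in> cocycles A q" using b x A.coboundary_cocycle A.add_cocycle by blast
    then have "h x' - h x = h b" using map_diff[OF _ x, of x'] b by simp
    then show ?thesis using map_coboundary[OF b(1)] by (simp add: B.coh_class_eq_iff)
  qed
  moreover have "coh_class A q x \<noteq> {}" using A.zero_coboundary by (auto simp: A.coh_class_eq)
  ultimately show ?thesis unfolding induced_def by auto
qed

lemma map_add:
  assumes "x \<in> cocycles A q" "y \<in> cocycles A q"
  shows "h (x + y) = h x + h y"
  using map_diff[OF A.add_cocycle[OF assms] assms(2)] by (simp add: algebra_simps)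

lemma induces_linear:
  assumes scale: "\<And>c x. x \<in> cocycles A q \<Longrightarrow> h (cscale A c x) = cscale B c (h x)"
  shows "induces_linear A q B r h"
proof -
  have A_scale: "coh_scale A q c (coh_class A q x) = coh_class A q (cscale A c x)"
    if "x \<in> cocycles A q" for c x
  proof -
    interpret S: cohomology_map A q A q "cscale A c"
      by unfold_locales (auto intro: A.scale_cocycle A.scale_coboundary A.scale_diff)
    show ?thesis using S.induced_class[OF that] by (simp add: coh_scale_def)
  qed
  have B_scale: "coh_scale B r c (coh_class B r x) = coh_class B r (cscale B c x)"
    if "x \<in> cocycles B r" for c x
  proof -
    interpret S: cohomology_map B r B r "cscale B c"
      by unfold_locales (auto intro: B.scale_cocycle B.scale_coboundary B.scale_diff)
    show ?thesis using S.induced_class[OF that] by (simp add: coh_scale_def)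
  qed
  have "group_hom (cohomology A q) (cohomology B r) (induced B r h)"
  proof (intro group_hom.intro group_hom_axioms.intro A.group_cohomology B.group_cohomology homI)
    show "induced B r h X \<in> carrier (cohomology B r)" if "X \<in> carrier (cohomology A q)" for X
      using that map_cocycle by (auto simp: A.carrier_cohomology B.carrier_cohomology induced_class)
    show "induced B r h (X \<otimes>\<^bsub>cohomology A q\<^esub> Y) =
        induced B r h X \<otimes>\<^bsub>cohomology B r\<^esub> induced B r h Y"
      if "X \<in> carrier (cohomology A q)" "Y \<in> carrier (cohomology A q)" for X Y
      using that map_cocycle
      by (auto simp: A.carrier_cohomology A.mult_cohomology B.mult_cohomology induced_class
          A.add_cocycle map_add)
  qed
  moreover have "induced B r h (coh_scale A q c X) = coh_scale B r c (induced B r h X)"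
    if "X \<in> carrier (cohomology A q)" for c X
    using that map_cocycle
    by (auto simp: A.carrier_cohomology A_scale B_scale induced_class A.scale_cocycle scale)
  ultimately show ?thesis
    unfolding induces_linear_def using map_cocycle induced_class by blast
qed

end

lemma kernel_eq_image:
  assumes g: "cohomology_map A q B r g" and h: "cohomology_map B r C s h"
    and zero: "\<And>z. z \<in> cocycles A q \<Longrightarrow> h (g z) \<in> coboundaries C s"
    and lift: "\<And>x. x \<in> cocycles B r \<Longrightarrow> h x \<in> coboundaries C s \<Longrightarrow>
       \<exists>z\<in>cocycles A q. x - g z \<in> coboundaries B r"
  shows "kernel (cohomology B r) (cohomology C s) (induced C s h) =
    induced B r g ` carrier (cohomology A q)"
proof -
  interpret g: cohomology_map A q B r g by (rule g)
  interpret h: cohomology_map B r C s h by (rule h)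
  show ?thesis
  proof (intro equalityI subsetI)
    fix X assume "X \<in> kernel (cohomology B r) (cohomology C s) (induced C s h)"
    then obtain x where x: "x \<in> cocycles B r" "X = coh_class B r x" "h x \<in> coboundaries C s"
      by (auto simp: kernel_def g.B.carrier_cohomology h.induced_class h.B.coh_class_eq_one_iff)
    then obtain z where z: "z \<in> cocycles A q" "x - g z \<in> coboundaries B r" using lift by blast
    then have "X = induced B r g (coh_class A q z)"
      using x by (simp add: g.induced_class g.B.coh_class_eq_iff)
    then show "X \<in> induced B r g ` carrier (cohomology A q)"
      using z by (auto simp: g.A.carrier_cohomology)
  next
    fix X assume "X \<in> induced B r g ` carrier (cohomology A q)"
    then obtain z where z: "z \<in> cocycles A q" "X = coh_class B r (g z)"
      by (auto simp: g.A.carrier_cohomology g.induced_class)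
    then show "X \<in> kernel (cohomology B r) (cohomology C s) (induced C s h)"
      using g.map_cocycle zero
      by (auto simp: kernel_def g.B.carrier_cohomology h.induced_class h.B.coh_class_eq_one_iff)
  qed
qed

definition mapping_cone :: "'v::ab_group_add cochain \<Rightarrow> 'w::ab_group_add cochain \<Rightarrow> ('v \<Rightarrow> 'w) \<Rightarrow> ('v \<times> 'w) cochain" where
  "mapping_cone K' K h =
     \<lparr>cdeg = (\<lambda>q. cdeg K' q \<times> cdeg K (q - 1)),
      cdiff = (\<lambda>q (x, y). (cdiff K' q x, h x - cdiff K (q - 1) y)),
      cscale = (\<lambda>c (x, y). (cscale K' c x, cscale K c y))\<rparr>"

locale cochain_map =
  K': cochain_complex K' + K: cochain_complex K
  for K' :: "'v::ab_group_add cochain" and K :: "'w::ab_group_add cochain" and h :: "'v \<Rightarrow> 'w" +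
  assumes h_mem: "x \<in> cdeg K' q \<Longrightarrow> h x \<in> cdeg K q"
    and h_diff: "x \<in> cdeg K' q \<Longrightarrow> y \<in> cdeg K' q \<Longrightarrow> h (x - y) = h x - h y"
    and h_scale: "x \<in> cdeg K' q \<Longrightarrow> h (cscale K' c x) = cscale K c (h x)"
    and h_d: "x \<in> cdeg K' q \<Longrightarrow> h (cdiff K' q x) = cdiff K q (h x)"
begin

abbreviation Cone :: "('v \<times> 'w) cochain" where "Cone \<equiv> mapping_cone K' K h"

lemma h_zero: "h 0 = 0"
  using h_diff[OF K'.zero_mem K'.zero_mem] by simp

lemma cone_sel [simp]:
  "cdeg Cone q = cdeg K' q \<times> cdeg K (q - 1)"
  "cdiff Cone q (x, y) = (cdiff K' q x, h x - cdiff K (q - 1) y)"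
  "cscale Cone c (x, y) = (cscale K' c x, cscale K c y)"
  by (simp_all add: mapping_cone_def)

sublocale R: cochain_complex Cone
proof
  fix q and w :: "'v \<times> 'w" assume w: "w \<in> cdeg Cone q"
  obtain x y where xy: "w = (x, y)" "x \<in> cdeg K' q" "y \<in> cdeg K (q - 1)" using w by (cases w) auto
  have dy: "cdiff K (q - 1) y \<in> cdeg K q" "cdiff K q (cdiff K (q - 1) y) = 0"
    using K.d_mem[OF xy(3)] K.d_d[OF xy(3)] by simp_all
  show "cdiff Cone q w \<in> cdeg Cone (q + 1)"
    using xy dy K'.d_mem h_mem K.diff_mem by simp
  show "cdiff Cone (q + 1) (cdiff Cone q w) = 0"
    using xy dy K'.d_d h_d h_mem by (simp add: K.d_diff zero_prod_def)
  show "cscale Cone c w \<in> cdeg Cone q" for c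
    using xy K'.scale_mem K.scale_mem by simp
  show "cdiff Cone q (cscale Cone c w) = cscale Cone c (cdiff Cone q w)" for c
    using xy K'.d_scale K.d_scale h_scale K.scale_diff by simp
next
  fix q and w v :: "'v \<times> 'w"
  assume "w \<in> cdeg Cone q" "v \<in> cdeg Cone q"
  then show "w - v \<in> cdeg Cone q"
    "cdiff Cone q (w - v) = cdiff Cone q w - cdiff Cone q v"
    by (cases w; cases v; auto simp: K'.diff_mem K.diff_mem K'.d_diff K.d_diff h_diff)+
next
  show "0 \<in> cdeg Cone q" for q
    by (simp add: zero_prod_def K'.zero_mem K.zero_mem)
  show "cscale Cone c (w - v) = cscale Cone c w - cscale Cone c v" for c w v
    by (cases w; cases v) (simp add: K'.scale_diff K.scale_diff)
qed

lemma cone_cocycle_iff: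
  "(x, y) \<in> cocycles Cone q \<longleftrightarrow>
     x \<in> cocycles K' q \<and> y \<in> cdeg K (q - 1) \<and> cdiff K (q - 1) y = h x"
  by (auto simp: cocycles_def zero_prod_def)

lemma cohomology_map_inclusion: "cohomology_map K (q - 1) Cone q (\<lambda>y. (0, y))"
proof
  show "(0, y) \<in> cocycles Cone q" if "y \<in> cocycles K (q - 1)" for y
    using that by (simp add: cone_cocycle_iff K'.zero_cocycle h_zero K.cocyclesD)
  show "(0, y) \<in> coboundaries Cone q" if y: "y \<in> coboundaries K (q - 1)" for y
  proof -
    obtain z where z: "z \<in> cdeg K (q - 1 - 1)" "y = cdiff K (q - 1 - 1) z"
      using y by (rule K.coboundariesE)
    then show ?thesis
      by (intro R.coboundariesI[of "(0, - z)"])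
        (simp_all add: K'.zero_mem K.uminus_mem K'.d_zero h_zero K.d_uminus)
  qed
qed simp

lemma cohomology_map_projection: "cohomology_map Cone q K' q fst"
proof
  show "fst w \<in> cocycles K' q" if "w \<in> cocycles Cone q" for w
    using that by (cases w) (simp add: cone_cocycle_iff)
  show "fst w \<in> coboundaries K' q" if "w \<in> coboundaries Cone q" for w
    using that by (rule R.coboundariesE) (auto intro!: K'.coboundariesI)
qed simp

lemma cohomology_map_self: "cohomology_map K' q K q h"
proof
  show "h x \<in> cocycles K q" if "x \<in> cocycles K' q" for x
    using K'.cocyclesD[OF that] h_d[of x q] by (intro K.cocyclesI h_mem) (simp_all add: h_zero)
  show "h x \<in> coboundaries K q" if "x \<in> coboundaries K' q" for x
    using that by (rule K'.coboundariesE) (auto intro!: K.coboundariesI h_mem simp: h_d)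
  show "h (x - y) = h x - h y" if "x \<in> cocycles K' q" "y \<in> cocycles K' q" for x y
    by (rule h_diff[OF K'.cocyclesD(1)[OF that(1)] K'.cocyclesD(1)[OF that(2)]])
qed

lemma induces_linear_inclusion: "induces_linear K (q - 1) Cone q (\<lambda>y. (0, y))"
  by (rule cohomology_map.induces_linear[OF cohomology_map_inclusion]) (simp add: K'.scale_zero)

lemma induces_linear_projection: "induces_linear Cone q K' q fst"
  by (rule cohomology_map.induces_linear[OF cohomology_map_projection]) (simp add: mapping_cone_def split: prod.splits)

lemma induces_linear_self: "induces_linear K' q K q h"
  by (rule cohomology_map.induces_linear[OF cohomology_map_self]) (intro h_scale K'.cocyclesD)

text \<open>
  If \<open>x\<close> is the coboundary of \<open>z\<close>, subtracting the coboundary of \<open>(z, 0)\<close> moves \<open>(x, y)\<close> to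
  \<open>(0, y - h z)\<close>.
\<close>

lemma exact_at_cone:
  "kernel (cohomology Cone q) (cohomology K' q) (induced K' q fst) =
     induced Cone q (\<lambda>y. (0, y)) ` carrier (cohomology K (q - 1))"
proof (rule kernel_eq_image[OF cohomology_map_inclusion cohomology_map_projection])
  show "fst (0, y) \<in> coboundaries K' q" for y :: 'w
    by (simp add: K'.zero_coboundary)
  fix w assume w: "w \<in> cocycles Cone q" "fst w \<in> coboundaries K' q"
  obtain x y where xy: "w = (x, y)" by (cases w)
  then have y: "y \<in> cdeg K (q - 1)" "cdiff K (q - 1) y = h x" using w by (auto simp: cone_cocycle_iff)
  obtain z where z: "z \<in> cdeg K' (q - 1)" "x = cdiff K' (q - 1) z"
    using w xy by (auto elim: K'.coboundariesE)
  have "y - h z \<in> cocycles K (q - 1)"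
    using y z h_mem[OF z(1)] by (intro K.cocyclesI K.diff_mem) (simp_all add: K.d_diff h_d)
  moreover have "w - (0, y - h z) \<in> coboundaries Cone q"
    using z xy by (intro R.coboundariesI[of "(z, 0)"]) (simp_all add: K.zero_mem K.d_zero)
  ultimately show "\<exists>z\<in>cocycles K (q - 1). w - (0, z) \<in> coboundaries Cone q" by blast
qed

text \<open>
  A cocycle \<open>x\<close> extends to a cocycle \<open>(x, y)\<close> of the cone precisely when \<open>h x\<close> is the coboundary of
  some \<open>y\<close>.
\<close>

lemma exact_at_target:
  "kernel (cohomology K' q) (cohomology K q) (induced K q h) =
     induced K' q fst ` carrier (cohomology Cone q)"
proof (rule kernel_eq_image[OF cohomology_map_projection cohomology_map_self])
  show "h (fst w) \<in> coboundaries K q" if "w \<in> cocycles Cone q" for w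
    using that by (cases w) (auto simp: cone_cocycle_iff intro: K.coboundariesI)
  fix x assume x: "x \<in> cocycles K' q" "h x \<in> coboundaries K q"
  then obtain y where "y \<in> cdeg K (q - 1)" "h x = cdiff K (q - 1) y" by (auto elim: K.coboundariesE)
  then have "(x, y) \<in> cocycles Cone q" using x by (simp add: cone_cocycle_iff)
  then show "\<exists>w\<in>cocycles Cone q. x - fst w \<in> coboundaries K' q"
    by (rule bexI[rotated]) (simp add: K'.zero_coboundary)
qed

text \<open>
  The coboundary of \<open>(x, z)\<close> has the form \<open>(0, y)\<close> precisely when \<open>x\<close> is a cocycle and \<open>y\<close> differs
  from \<open>h x\<close> by the coboundary of \<open>z\<close>.
\<close>

lemma exact_at_source:
  "kernel (cohomology K q) (cohomology Cone (q + 1)) (induced Cone (q + 1) (\<lambda>y. (0, y))) =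
     induced K q h ` carrier (cohomology K' q)"
proof (rule kernel_eq_image[OF cohomology_map_self])
  show "cohomology_map K q Cone (q + 1) (\<lambda>y. (0, y))"
    using cohomology_map_inclusion[of "q + 1"] by simp
  show "(0, h x) \<in> coboundaries Cone (q + 1)" if "x \<in> cocycles K' q" for x
    using K'.cocyclesD[OF that]
    by (intro R.coboundariesI[of "(x, 0)"]) (simp_all add: K.zero_mem K.d_zero)
  fix y assume "y \<in> cocycles K q" "(0, y) \<in> coboundaries Cone (q + 1)"
  then obtain w where w: "w \<in> cdeg Cone (q + 1 - 1)" "(0, y) = cdiff Cone (q + 1 - 1) w"
    by (elim R.coboundariesE)
  then obtain x z where xz: "x \<in> cdeg K' q" "z \<in> cdeg K (q - 1)" "cdiff K' q x = 0"
      "y = h x - cdiff K (q - 1) z"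
    by (cases w) auto
  have "y - h x \<in> coboundaries K q"
    using xz by (intro K.coboundariesI[of "- z"]) (simp_all add: K.uminus_mem K.d_uminus)
  then show "\<exists>x\<in>cocycles K' q. y - h x \<in> coboundaries K q"
    using xz K'.cocyclesI by blast
qed

end

section \<open>Adapted charts and morphisms in coordinates\<close>

lemma leaf_map_restrict:
  assumes "leaf_map m n m' n' U V G" "coord_open m n U'" "U' \<subseteq> U" "coord_open m' n' V'" "G ` U' \<subseteq> V'"
  shows "leaf_map m n m' n' U' V' G"
proof -
  note GD = leaf_mapD[OF assms(1)]
  show ?thesis
    unfolding leaf_map_def
    using assms(2-5) GD(6,7) smooth_on_mono[OF GD(4) assms(3)] smooth_on_mono[OF GD(5) assms(3)]
      subsetD[OF assms(3)]
    by simp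
qed

lemma leaf_diff_comp:
  assumes G: "leaf_map m n m' n' U V G" and H: "leaf_map m' n' m'' n'' V W H"
    and y: "y \<in> U" and T: "\<And>y. y \<in> U \<Longrightarrow> T y = H (G y)"
  shows "leaf_diff m T y w = leaf_diff m' H (G y) (leaf_diff m G y w)"
proof -
  have "leaf_deriv m w (\<lambda>y. fst (T y) b) y = leaf_deriv m' (leaf_diff m G y w) (\<lambda>z. fst (H z) b) (G y)" for b
    using leaf_deriv_cong[OF leaf_mapD(1)[OF G] y, of "\<lambda>y. fst (T y) b" "\<lambda>y. fst (H (G y)) b" w]
      leaf_deriv_leaf_map[OF G leaf_mapD(4)[OF H] y, of w b] T by simp
  moreover have "leaf_deriv m w (\<lambda>y. cnj (fst (T y) b)) y =
      leaf_deriv m' (leaf_diff m G y w) (\<lambda>z. cnj (fst (H z) b)) (G y)" for b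
    using leaf_deriv_cong[OF leaf_mapD(1)[OF G] y, of "\<lambda>y. cnj (fst (T y) b)" "\<lambda>y. cnj (fst (H (G y)) b)" w]
      leaf_deriv_leaf_map[OF G smooth_on_cnj[OF leaf_mapD(2)[OF G] leaf_mapD(4)[OF H]] y, of w b] T by simp
  ultimately show ?thesis
    by (simp add: prod_eq_iff fun_eq_iff fst_leaf_diff snd_leaf_diff)
qed

lemma pull_comp:
  assumes G: "leaf_map m n m' n' U V G" and H: "leaf_map m' n' m'' n'' V W H"
    and y: "y \<in> U" and T: "\<And>y. y \<in> U \<Longrightarrow> T y = H (G y)"
  shows "pull m T \<phi> y ws = pull m' H \<phi> (G y) (map (leaf_diff m G y) ws)"
proof -
  have "map (leaf_diff m T y) ws = map (leaf_diff m' H (G y)) (map (leaf_diff m G y) ws)"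
    by (simp add: leaf_diff_comp[OF assms])
  then show ?thesis unfolding pull_def T[OF y] by (simp only:)
qed

lemma local_form_lincomb:
  assumes V: "coord_open m n V" and L: "local_form m n p q V \<phi>" "local_form m n p q V \<psi>"
  shows "local_form m n p q V (\<lambda>y ws. a * \<phi> y ws + b * \<psi> y ws)"
  using local_formD[OF L(1)] local_formD[OF L(2)]
  by (simp add: local_form_def pq_form_lincomb smooth_on_add[OF V] smooth_on_mult[OF V])

lemma wirt_bar_holomorphic:
  assumes "holomorphic_several m W (\<lambda>z. H (z, x))" "z \<in> W" "a < m"
  shows "wirt_bar a H (z, x) = 0"
proof -
  obtain D where D: "((\<lambda>t. H (z(a := t), x)) has_field_derivative D) (at (z a))"
    using assms by (auto simp: holomorphic_several_def field_differentiable_def)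
  have chain: "((\<lambda>t. H (z(a := z a + c * of_real t), x)) has_vector_derivative c * D) (at 0)" for c
  proof -
    have "((\<lambda>t. z a + c * of_real t) has_vector_derivative c) (at 0)"
      by (auto intro!: derivative_eq_intros simp: has_vector_derivative_def scaleR_conv_of_real mult.commute)
    from field_vector_diff_chain_at[OF this, of "\<lambda>t. H (z(a := t), x)" D] D
    show ?thesis by (simp add: o_def)
  qed
  have "pd (DRe a) H (z, x) = D" "pd (DIm a) H (z, x) = \<i> * D"
    using chain[of 1] chain[of \<i>] by (auto intro!: pd_eqI)
  then show ?thesis by (simp add: wirt_bar_def)
qed

lemma pd_eventually_const:
  assumes "\<forall>\<^sub>F t in nhds 0. H (move e t y) = c"
  shows "pd e H y = 0"
proof (rule pd_eqI)
  have "((\<lambda>t. H (move e t y)) has_vector_derivative 0) (at 0) \<longleftrightarrow> ((\<lambda>t. c) has_vector_derivative 0) (at 0)"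
    using assms eventually_nhds_x_imp_x[OF assms] by (intro has_vector_derivative_cong_ev) auto
  then show "((\<lambda>t. H (move e t y)) has_vector_derivative 0) (at 0)" by simp
qed

lemma snd_move_leaf: "e \<in> dirs m 0 \<Longrightarrow> snd (move e t y) = snd y"
  by (cases y) (auto simp: dirs_def)

lemma open_polydisc_openin:
  assumes "open_polydisc m D"
  shows "openin (top_of_set (Cspace m)) D"
proof -
  obtain c r where D: "D = {z \<in> Cspace m. \<forall>a<m. cmod (z a - c a) < r a}"
    using assms by (auto simp: open_polydisc_def)
  have "open {z::nat \<Rightarrow> complex. cmod (z a - c a) < r a}" for a
    by (intro open_Collect_less continuous_intros continuous_on_product_coordinates)
  then have "open (\<Inter>a\<in>{..<m}. {z::nat \<Rightarrow> complex. cmod (z a - c a) < r a})" by (intro open_INT) auto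
  moreover have "D = Cspace m \<inter> (\<Inter>a\<in>{..<m}. {z. cmod (z a - c a) < r a})" using D by auto
  ultimately show ?thesis by (auto simp: openin_open)
qed

lemma open_ball_openin:
  assumes "open_ball n D"
  shows "openin (top_of_set (Rspace n)) D"
proof -
  obtain c r where D: "D = {x \<in> Rspace n. L2_set (\<lambda>k. x k - c k) {..<n} < r}"
    using assms by (auto simp: open_ball_def)
  have "open {x::nat \<Rightarrow> real. L2_set (\<lambda>k. x k - c k) {..<n} < r}"
    unfolding L2_set_def
    by (intro open_Collect_less continuous_intros continuous_on_product_coordinates)
  moreover have "D = Rspace n \<inter> {x. L2_set (\<lambda>k. x k - c k) {..<n} < r}" using D by auto
  ultimately show ?thesis by (auto simp: openin_open)
qed

lemma foliationD:
  assumes "complex_foliation F" "i \<in> idx F"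
  shows "coord_open (ldim F) (cdim F) (dom_ch F i)" "inj_on (chart F i) (dom_ch F i)"
    "continuous_map (top_of_set (dom_ch F i)) (man F) (chart F i)"
    "openin (man F) (img_ch F i)"
proof -
  have *: "open_polydisc (ldim F) (ldom F i)" "open_ball (cdim F) (tdom F i)" "openin (man F) (img_ch F i)"
      "homeomorphic_map (top_of_set (dom_ch F i)) (subtopology (man F) (img_ch F i)) (chart F i)"
    using assms by (auto simp: complex_foliation_def)
  show "coord_open (ldim F) (cdim F) (dom_ch F i)"
    unfolding dom_ch_def using * by (intro openin_Times open_polydisc_openin open_ball_openin)
  show "inj_on (chart F i) (dom_ch F i)"
    using homeomorphic_imp_injective_map[OF *(4)] by simp
  show "continuous_map (top_of_set (dom_ch F i)) (man F) (chart F i)"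
    using homeomorphic_imp_continuous_map[OF *(4)] by (simp add: continuous_map_in_subtopology)
  show "openin (man F) (img_ch F i)" by (rule *(3))
qed

lemma foliation_cover:
  "complex_foliation F \<Longrightarrow> (\<Union>i\<in>idx F. img_ch F i) = topspace (man F)"
  by (simp add: complex_foliation_def)

lemma chart_topspace:
  assumes "complex_foliation F" "i \<in> idx F" "y \<in> dom_ch F i"
  shows "chart F i y \<in> topspace (man F)"
  using foliation_cover[OF assms(1)] assms(2,3) by (auto simp: img_ch_def)

lemma loc_mem:
  assumes "y \<in> loc_dom F F' h i j"
  shows "y \<in> dom_ch F i" "loc F F' h i j y \<in> dom_ch F' j" "chart F' j (loc F F' h i j y) = h (chart F i y)"
  using assms unfolding loc_dom_def loc_def img_ch_def
  by (auto intro: inv_into_into f_inv_into_f)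

lemma loc_domI: "y \<in> dom_ch F i \<Longrightarrow> h (chart F i y) \<in> img_ch F' j \<Longrightarrow> y \<in> loc_dom F F' h i j"
  by (simp add: loc_dom_def)

lemma loc_eqI:
  assumes "complex_foliation F'" "j \<in> idx F'" "z \<in> dom_ch F' j" "chart F' j z = h (chart F i y)"
  shows "loc F F' h i j y = z"
  using inv_into_f_f[OF foliationD(2)[OF assms(1,2)] assms(3)] assms(4) by (simp add: loc_def)

lemma coord_open_loc_dom:
  assumes F: "complex_foliation F" "i \<in> idx F" and F': "complex_foliation F'" "j \<in> idx F'"
    and h: "continuous_map (man F) (man F') h"
  shows "coord_open (ldim F) (cdim F) (loc_dom F F' h i j)"
proof -
  have "continuous_map (top_of_set (dom_ch F i)) (man F') (h \<circ> chart F i)"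
    by (rule continuous_map_compose[OF foliationD(3)[OF F] h])
  from openin_continuous_map_preimage[OF this foliationD(4)[OF F']]
  have "openin (top_of_set (dom_ch F i)) (loc_dom F F' h i j)"
    by (simp add: loc_dom_def)
  then show ?thesis using foliationD(1)[OF F] openin_trans by blast
qed

lemma dom_ch_Cspace:
  assumes "complex_foliation F" "i \<in> idx F" "y \<in> dom_ch F i"
  shows "a \<ge> ldim F \<Longrightarrow> fst y a = 0" "k \<ge> cdim F \<Longrightarrow> snd y k = 0"
  using coord_open_subset[OF foliationD(1)[OF assms(1,2)]] assms(3)
  by (cases y; auto simp: Cspace_def Rspace_def)+

lemma leaf_map_locI:
  assumes F: "complex_foliation F" "i \<in> idx F" and F': "complex_foliation F'" "j \<in> idx F'"
    and h: "continuous_map (man F) (man F') h" and sm: "smooth_loc F F' h i j"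
    and hol: "\<And>y a b. y \<in> loc_dom F F' h i j \<Longrightarrow> a < ldim F \<Longrightarrow> b < ldim F' \<Longrightarrow>
      wirt_bar a (\<lambda>y. fst (loc F F' h i j y) b) y = 0"
    and tr: "\<And>y e k. y \<in> loc_dom F F' h i j \<Longrightarrow> e \<in> dirs (ldim F) 0 \<Longrightarrow>
      pd e (\<lambda>y. snd (loc F F' h i j y) k) y = 0"
  shows "leaf_map (ldim F) (cdim F) (ldim F') (cdim F') (loc_dom F F' h i j) (dom_ch F' j) (loc F F' h i j)"
proof -
  let ?U = "loc_dom F F' h i j" and ?G = "loc F F' h i j"
  note U = coord_open_loc_dom[OF F F' h]
  have fst0: "fst (?G y) b = 0" if "y \<in> ?U" "b \<ge> ldim F'" for y b
    using dom_ch_Cspace(1)[OF F' loc_mem(2)[OF that(1)] that(2)] .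
  have snd0: "snd (?G y) k = 0" if "y \<in> ?U" "k \<ge> cdim F'" for y k
    using dom_ch_Cspace(2)[OF F' loc_mem(2)[OF that(1)] that(2)] .
  have sm1: "smooth_on (ldim F) (cdim F) ?U (\<lambda>y. fst (?G y) b)" for b
  proof (cases "b < ldim F'")
    case False
    then show ?thesis
      using smooth_on_cong[OF U, of "\<lambda>y. fst (?G y) b" "\<lambda>y. 0"] fst0[of _ b] by simp
  qed (use sm in \<open>simp add: smooth_loc_def\<close>)
  have sm2: "smooth_on (ldim F) (cdim F) ?U (\<lambda>y. snd (?G y) k)" for k
  proof (cases "k < cdim F'")
    case False
    then show ?thesis
      using smooth_on_cong[OF U, of "\<lambda>y. snd (?G y) k" "\<lambda>y. 0"] snd0[of _ k] by simp
  qed (use sm in \<open>simp add: smooth_loc_def\<close>)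
  have hol': "wirt_bar a (\<lambda>y. fst (?G y) b) y = 0" if "y \<in> ?U" "a < ldim F" for y a b
  proof (cases "b < ldim F'")
    case False
    have "pd e (\<lambda>y. fst (?G y) b) y = 0" if "e \<in> dirs (ldim F) (cdim F)" for e
      using eventually_move_in[OF U \<open>y \<in> ?U\<close> that]
      by (rule pd_eventually_const[OF eventually_mono]) (use False fst0 in auto)
    then show ?thesis using that(2) by (simp add: wirt_bar_def dirs_def)
  qed (use hol that in auto)
  show ?thesis
    unfolding leaf_map_def
    using U foliationD(1)[OF F'] loc_mem(2)[of _ F F' h i j] sm1 sm2 hol' tr
    by (simp add: image_subset_iff)
qed

lemma leaf_map_transition:
  assumes F: "complex_foliation F" and ij: "i \<in> idx F" "j \<in> idx F"
  shows "leaf_map (ldim F) (cdim F) (ldim F) (cdim F) (loc_dom F F id i j) (dom_ch F j) (loc F F id i j)"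
proof (rule leaf_map_locI[OF F ij(1) F ij(2)])
  let ?U = "loc_dom F F id i j" and ?G = "loc F F id i j"
  have *: "smooth_loc F F id i j" "\<exists>g. \<forall>(z, x)\<in>?U. snd (?G (z, x)) = g x"
      "\<And>x b. b < ldim F \<Longrightarrow> holomorphic_several (ldim F) {z. (z, x) \<in> ?U} (\<lambda>z. fst (?G (z, x)) b)"
    using F ij by (auto simp: complex_foliation_def)
  show c: "continuous_map (man F) (man F) id" by simp
  show "smooth_loc F F id i j" by (rule *(1))
  show "wirt_bar a (\<lambda>y. fst (?G y) b) y = 0" if "y \<in> ?U" "a < ldim F" "b < ldim F" for y a b
  proof -
    have "fst y \<in> {z. (z, snd y) \<in> ?U}" using that by simp
    from wirt_bar_holomorphic[where H = "\<lambda>y. fst (?G y) b", OF *(3)[OF that(3)] this that(2)]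
    show ?thesis by (simp only: prod.collapse)
  qed
  obtain g where g: "\<And>y. y \<in> ?U \<Longrightarrow> snd (?G y) = g (snd y)"
    using *(2) by (auto simp: case_prod_unfold)
  show "pd e (\<lambda>y. snd (?G y) k) y = 0" if "y \<in> ?U" "e \<in> dirs (ldim F) 0" for y e k
  proof (rule pd_eventually_const)
    show "\<forall>\<^sub>F t in nhds 0. snd (?G (move e t y)) k = g (snd y) k"
      using eventually_move_in[OF coord_open_loc_dom[OF F ij(1) F ij(2) c] that(1) dirs_leaf[OF that(2)]]
      by eventually_elim (simp add: g snd_move_leaf[OF that(2)])
  qed
qed

text \<open>
  Every point lies on a leaf, and around it the morphism maps a neighbourhood within the plaque into a
  single plaque of the target.  This gives both the vanishing of \<open>\<partial>\<bar>\<close> on the leaf coordinates and the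
  constancy of the transversal coordinates.
\<close>

lemma leaf_map_morphism:
  assumes F: "complex_foliation F" "i \<in> idx F" and F': "complex_foliation F'" "j \<in> idx F'"
    and mor: "foliation_morphism F F' h"
  shows "leaf_map (ldim F) (cdim F) (ldim F') (cdim F') (loc_dom F F' h i j) (dom_ch F' j) (loc F F' h i j)"
proof (rule leaf_map_locI[OF F F'])
  let ?U = "loc_dom F F' h i j" and ?G = "loc F F' h i j"
  show "continuous_map (man F) (man F') h" "smooth_loc F F' h i j"
    using mor F F' by (auto simp: foliation_morphism_def smooth_map_def)
  have W: "\<exists>W x'. openin (top_of_set (Cspace (ldim F))) W \<and> fst y \<in> W \<and>
       (\<forall>w\<in>W. snd (?G (w, snd y)) = x') \<and>
       (\<forall>b<ldim F'. holomorphic_several (ldim F) W (\<lambda>w. fst (?G (w, snd y)) b))" if y: "y \<in> ?U" for y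
  proof -
    let ?x' = "snd (?G y)"
    have y': "y \<in> dom_ch F i" "?G y \<in> dom_ch F' j" "chart F' j (?G y) = h (chart F i y)"
      using loc_mem[OF y] by auto
    let ?L = "(same_plaque F)\<^sup>* `` {chart F i y}"
    have "?L \<in> leaves F"
      using chart_topspace[OF F y'(1)] by (auto simp: leaves_def)
    then obtain L' where L': "leaf_holomorphic F F' ?L L' h"
      using mor by (auto simp: foliation_morphism_def)
    have mem: "?G y \<in> ldom F' j \<times> tdom F' j" using y'(2) by (simp add: dom_ch_def)
    then have x': "?x' \<in> tdom F' j" by (simp add: mem_Times_iff)
    have pl: "h (chart F i y) \<in> plaque F' j ?x'"
      unfolding plaque_def
      by (rule image_eqI[of _ _ "?G y"], rule y'(3)[symmetric]) (use mem in \<open>simp add: mem_Times_iff\<close>)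
    have "\<forall>j\<in>idx F'. \<forall>x'\<in>tdom F' j. h (chart F i y) \<in> plaque F' j x' \<longrightarrow>
        (\<exists>W. openin (top_of_set (Cspace (ldim F))) W \<and> fst y \<in> W \<and> W \<subseteq> ldom F i \<and>
          h ` chart F i ` (W \<times> {snd y}) \<subseteq> plaque F' j x' \<and>
          (\<forall>b<ldim F'. holomorphic_several (ldim F) W (\<lambda>w. fst (loc F F' h i j (w, snd y)) b)))"
      using L'[unfolded leaf_holomorphic_def, THEN conjunct2, rule_format, OF F(2) y'(1)]
      by (simp add: case_prod_unfold)
    from this[rule_format, OF F'(2) x' pl]
    obtain W where W: "openin (top_of_set (Cspace (ldim F))) W" "fst y \<in> W"
        "h ` chart F i ` (W \<times> {snd y}) \<subseteq> plaque F' j ?x'"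
        "\<forall>b<ldim F'. holomorphic_several (ldim F) W (\<lambda>w. fst (?G (w, snd y)) b)"
      by blast
    have "snd (?G (w, snd y)) = ?x'" if "w \<in> W" for w
    proof -
      have "h (chart F i (w, snd y)) \<in> plaque F' j ?x'" using W(3) that by auto
      then obtain w' where w': "w' \<in> ldom F' j" "chart F' j (w', ?x') = h (chart F i (w, snd y))"
        by (auto simp: plaque_def)
      then have "?G (w, snd y) = (w', ?x')"
        using x' by (intro loc_eqI[OF F']) (auto simp: dom_ch_def)
      then show ?thesis by simp
    qed
    with W show ?thesis by blast
  qed
  show "wirt_bar a (\<lambda>y. fst (?G y) b) y = 0"
    if y: "y \<in> ?U" and a: "a < ldim F" and b: "b < ldim F'" for y a b
  proof -
    obtain W where "fst y \<in> W" "holomorphic_several (ldim F) W (\<lambda>w. fst (?G (w, snd y)) b)"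
      using W[OF y] b by blast
    from wirt_bar_holomorphic[where H = "\<lambda>y. fst (?G y) b", OF this(2,1) a]
    show ?thesis by (simp only: prod.collapse)
  qed
  show "pd e (\<lambda>y. snd (?G y) k) y = 0" if y: "y \<in> ?U" and e: "e \<in> dirs (ldim F) 0" for y e k
  proof -
    obtain W x' where W: "openin (top_of_set (Cspace (ldim F))) W" "fst y \<in> W"
        "\<And>w. w \<in> W \<Longrightarrow> snd (?G (w, snd y)) = x'"
      using W[OF y] by blast
    have "coord_open (ldim F) (cdim F) (W \<times> Rspace (cdim F))"
      using W(1) by (intro openin_Times) auto
    moreover have "y \<in> W \<times> Rspace (cdim F)"
      using W(2) loc_mem(1)[OF y] coord_open_subset[OF foliationD(1)[OF F]]
      by (auto simp: mem_Times_iff)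
    ultimately have "\<forall>\<^sub>F t in nhds 0. move e t y \<in> W \<times> Rspace (cdim F)"
      by (rule eventually_move_in[OF _ _ dirs_leaf[OF e]])
    then have "\<forall>\<^sub>F t in nhds 0. snd (?G (move e t y)) k = x' k"
    proof eventually_elim
      case (elim t)
      then show ?case
        using W(3)[of "fst (move e t y)"] snd_move_leaf[OF e, of t y]
        by (metis mem_Times_iff prod.collapse)
    qed
    then show ?thesis by (rule pd_eventually_const)
  qed
qed

section \<open>Foliated forms on a foliated manifold\<close>

lemma foliated_forms_iff:
  assumes F: "complex_foliation F"
  shows "\<phi> \<in> foliated_forms F p q \<longleftrightarrow>
    (\<forall>i\<in>idx F. local_form (ldim F) (cdim F) p q (dom_ch F i) (\<phi> i)) \<and>
    (\<forall>i\<in>idx F. \<forall>j\<in>idx F. \<forall>y\<in>loc_dom F F id i j. \<phi> i y = pull (ldim F) (loc F F id i j) (\<phi> j) y) \<and>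
    (\<forall>i y. i \<notin> idx F \<or> y \<notin> dom_ch F i \<longrightarrow> \<phi> i y = (\<lambda>ws. 0))"
  using local_form_iff_coefficients[OF foliationD(1)[OF F]]
  by (simp add: foliated_forms_def pull_def fun_eq_iff)

lemma foliated_formsD:
  assumes F: "complex_foliation F" and \<phi>: "\<phi> \<in> foliated_forms F p q"
  shows "i \<in> idx F \<Longrightarrow> local_form (ldim F) (cdim F) p q (dom_ch F i) (\<phi> i)"
    "i \<in> idx F \<Longrightarrow> j \<in> idx F \<Longrightarrow> y \<in> loc_dom F F id i j \<Longrightarrow> \<phi> i y = pull (ldim F) (loc F F id i j) (\<phi> j) y"
    "i \<notin> idx F \<or> y \<notin> dom_ch F i \<Longrightarrow> \<phi> i y = (\<lambda>ws. 0)"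
  using \<phi> unfolding foliated_forms_iff[OF F] by blast+

lemma foliated_forms_lincomb:
  assumes F: "complex_foliation F" and "\<phi> \<in> foliated_forms F p q" "\<psi> \<in> foliated_forms F p q"
  shows "(\<lambda>i y ws. a * \<phi> i y ws + b * \<psi> i y ws) \<in> foliated_forms F p q"
  unfolding foliated_forms_iff[OF F]
proof (intro conjI ballI allI impI)
  note D = foliated_formsD[OF F assms(2)] foliated_formsD[OF F assms(3)]
  show "local_form (ldim F) (cdim F) p q (dom_ch F i) (\<lambda>y ws. a * \<phi> i y ws + b * \<psi> i y ws)"
    if "i \<in> idx F" for i
    by (intro local_form_lincomb foliationD(1)[OF F that] D(1,4) that)
  show "(\<lambda>ws. a * \<phi> i y ws + b * \<psi> i y ws) =
      pull (ldim F) (loc F F id i j) (\<lambda>y ws. a * \<phi> j y ws + b * \<psi> j y ws) y"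
    if "i \<in> idx F" "j \<in> idx F" "y \<in> loc_dom F F id i j" for i j y
    using D(2,5)[OF that] by (simp add: pull_def fun_eq_iff)
  show "(\<lambda>ws. a * \<phi> i y ws + b * \<psi> i y ws) = (\<lambda>ws. 0)" if "i \<notin> idx F \<or> y \<notin> dom_ch F i" for i y
    using D(3,6)[OF that] by simp
qed

lemma dbar_tw_eq:
  assumes F: "complex_foliation F" and \<phi>: "\<phi> \<in> foliated_forms F p q"
  shows "dbar_tw F f p q \<phi> i y =
    (if i \<in> idx F \<and> y \<in> dom_ch F i
     then tw_dbar (ldim F) (of_int (p + q)) (\<lambda>y. f (chart F i y)) (\<phi> i) y else (\<lambda>ws. 0))"
proof (cases "i \<in> idx F \<and> y \<in> dom_ch F i")
  case True
  then have "dbar F p q \<phi> i y = alt_sum (\<lambda>u vs. leaf_deriv (ldim F) (barpart u) (\<lambda>y. \<phi> i y vs) y)"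
    using dbar_eq_alt_sum[OF foliationD(1)[OF F] _ foliated_formsD(1)[OF F \<phi>]]
    by (simp add: dbar_def fun_eq_iff)
  moreover have "dbar_fun F f i y u = leaf_deriv (ldim F) (barpart u) (\<lambda>y. f (chart F i y)) y" for u
    by (simp add: dbar_fun_def leaf_deriv_barpart dz_bar_def)
  ultimately show ?thesis
    using True
    by (simp add: fun_eq_iff dbar_tw_def wedge1_alt_sum tw_dbar_def tw_deriv_def alt_sum_diff alt_sum_mult mult.assoc)
next
  case False
  then show ?thesis
    using foliated_formsD(3)[OF F \<phi>, of i y]
    by (auto simp: fun_eq_iff dbar_tw_def dbar_def wedge1_def)
qed

lemma smooth_functionD:
  "smooth_function F f \<Longrightarrow> i \<in> idx F \<Longrightarrow> smooth_on (ldim F) (cdim F) (dom_ch F i) (\<lambda>y. f (chart F i y))"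
  by (simp add: smooth_function_def)

text \<open>
  Compatibility of the local expressions is the naturality of the twisted operator under coordinate
  changes.
\<close>

lemma dbar_tw_mem:
  assumes F: "complex_foliation F" and f: "smooth_function F f" and \<phi>: "\<phi> \<in> foliated_forms F p q"
  shows "dbar_tw F f p q \<phi> \<in> foliated_forms F p (q + 1)"
  unfolding foliated_forms_iff[OF F]
proof (intro conjI ballI allI impI)
  let ?d = "\<lambda>i. tw_dbar (ldim F) (of_int (p + q)) (\<lambda>y. f (chart F i y)) (\<phi> i)"
  note D = foliated_formsD[OF F \<phi>]
  have eq: "dbar_tw F f p q \<phi> i y = ?d i y" if "i \<in> idx F" "y \<in> dom_ch F i" for i y
    using dbar_tw_eq[OF F \<phi>] that by simp
  show "local_form (ldim F) (cdim F) p (q + 1) (dom_ch F i) (dbar_tw F f p q \<phi> i)" if i: "i \<in> idx F" for i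
  proof -
    note V = foliationD(1)[OF F i]
    have "local_form (ldim F) (cdim F) p (q + 1) (dom_ch F i) (?d i)"
      by (rule local_form_tw_dbar[OF V smooth_functionD[OF f i] D(1)[OF i]])
    then show ?thesis
      using smooth_on_cong[OF V, of "\<lambda>y. dbar_tw F f p q \<phi> i y _" "\<lambda>y. ?d i y _"] eq[OF i]
      by (simp add: local_form_def)
  qed
  show "dbar_tw F f p q \<phi> i y = pull (ldim F) (loc F F id i j) (dbar_tw F f p q \<phi> j) y"
    if ij: "i \<in> idx F" "j \<in> idx F" and y: "y \<in> loc_dom F F id i j" for i j y
  proof
    fix ws
    let ?G = "loc F F id i j"
    note G = leaf_map_transition[OF F ij]
    have "dbar_tw F f p q \<phi> i y ws =
        tw_dbar (ldim F) (of_int (p + q)) (\<lambda>y. f (chart F j (?G y))) (pull (ldim F) ?G (\<phi> j)) y ws"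
      unfolding eq[OF ij(1) loc_mem(1)[OF y]]
      using loc_mem(3)[of _ F F id i j] D(2)[OF ij]
      by (intro fun_cong[OF tw_dbar_cong[OF leaf_mapD(1)[OF G] y]]) auto
    also have "\<dots> = pull (ldim F) ?G (?d j) y ws"
      by (rule tw_dbar_pull[OF G y D(1)[OF ij(2)] smooth_functionD[OF f ij(2)]])
    also have "\<dots> = pull (ldim F) ?G (dbar_tw F f p q \<phi> j) y ws"
      using eq[OF ij(2) loc_mem(2)[OF y]] by (simp add: pull_def)
    finally show "dbar_tw F f p q \<phi> i y ws = pull (ldim F) ?G (dbar_tw F f p q \<phi> j) y ws" .
  qed
  show "dbar_tw F f p q \<phi> i y = (\<lambda>ws. 0)" if "i \<notin> idx F \<or> y \<notin> dom_ch F i" for i y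
    using dbar_tw_eq[OF F \<phi>, of f i y] that by auto
qed

lemma dbar_tw_lincomb:
  assumes F: "complex_foliation F" and \<phi>: "\<phi> \<in> foliated_forms F p q" and \<psi>: "\<psi> \<in> foliated_forms F p q"
  shows "dbar_tw F f p q (\<lambda>i y ws. a * \<phi> i y ws + b * \<psi> i y ws) i y ws =
    a * dbar_tw F f p q \<phi> i y ws + b * dbar_tw F f p q \<psi> i y ws"
  using tw_dbar_lincomb[OF foliationD(1)[OF F] _ foliated_formsD(1)[OF F \<phi>] foliated_formsD(1)[OF F \<psi>]]
  by (simp add: dbar_tw_eq[OF F \<phi>] dbar_tw_eq[OF F \<psi>] dbar_tw_eq[OF F foliated_forms_lincomb[OF F \<phi> \<psi>]])

lemma dbar_tw_dbar_tw:
  assumes F: "complex_foliation F" and f: "smooth_function F f" and \<phi>: "\<phi> \<in> foliated_forms F p q"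
  shows "dbar_tw F f p (q + 1) (dbar_tw F f p q \<phi>) = 0"
proof (intro ext)
  fix i y ws
  show "dbar_tw F f p (q + 1) (dbar_tw F f p q \<phi>) i y ws = 0 i y ws"
  proof (cases "i \<in> idx F \<and> y \<in> dom_ch F i")
    case True
    then have i: "i \<in> idx F" and y: "y \<in> dom_ch F i" by auto
    note V = foliationD(1)[OF F i]
    have "dbar_tw F f p (q + 1) (dbar_tw F f p q \<phi>) i y ws =
        tw_dbar (ldim F) (of_int (p + (q + 1))) (\<lambda>y. f (chart F i y)) (dbar_tw F f p q \<phi> i) y ws"
      using True by (simp add: dbar_tw_eq[OF F dbar_tw_mem[OF F f \<phi>]])
    also have "\<dots> = tw_dbar (ldim F) (of_int (p + q) + 1) (\<lambda>y. f (chart F i y))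
        (tw_dbar (ldim F) (of_int (p + q)) (\<lambda>y. f (chart F i y)) (\<phi> i)) y ws"
      using i by (subst tw_dbar_cong[OF V y refl, where \<psi> = "tw_dbar (ldim F) (of_int (p + q)) (\<lambda>y. f (chart F i y)) (\<phi> i)"])
        (simp_all add: dbar_tw_eq[OF F \<phi>] add.assoc)
    also have "\<dots> = 0"
      by (rule tw_dbar_tw_dbar[OF V y smooth_functionD[OF f i] foliated_formsD(1)[OF F \<phi> i]])
    finally show ?thesis by simp
  next
    case False
    then show ?thesis by (auto simp: dbar_tw_eq[OF F dbar_tw_mem[OF F f \<phi>]])
  qed
qed

lemma zero_foliated_form: "complex_foliation F \<Longrightarrow> 0 \<in> foliated_forms F p q"
  unfolding foliated_forms_iff
  using pq_form_0 by (auto simp: local_form_def pull_def fun_eq_iff zero_fun_def)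

lemma cochain_complex_dolbeault_tw:
  assumes F: "complex_foliation F" and f: "smooth_function F f"
  shows "cochain_complex (dolbeault_tw F f p)"
proof
  fix q and \<phi> \<psi> :: "'b form" and c
  have diff: "\<phi> - \<psi> = (\<lambda>i y ws. 1 * \<phi> i y ws + (-1) * \<psi> i y ws)" for \<phi> \<psi> :: "'b form"
    by (simp add: fun_eq_iff)
  have scale: "form_scale c \<phi> = (\<lambda>i y ws. c * \<phi> i y ws + 0 * \<phi> i y ws)" for c and \<phi> :: "'b form"
    by (simp add: fun_eq_iff form_scale_def)
  show "0 \<in> cdeg (dolbeault_tw F f p) q"
    by (simp add: dolbeault_tw_def zero_foliated_form[OF F])
  show "cscale (dolbeault_tw F f p) c (\<phi> - \<psi>) =
      cscale (dolbeault_tw F f p) c \<phi> - cscale (dolbeault_tw F f p) c \<psi>"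
    by (simp add: dolbeault_tw_def form_scale_def fun_eq_iff algebra_simps)
  assume "\<phi> \<in> cdeg (dolbeault_tw F f p) q"
  then have \<phi>: "\<phi> \<in> foliated_forms F p q" by (simp add: dolbeault_tw_def)
  show "cscale (dolbeault_tw F f p) c \<phi> \<in> cdeg (dolbeault_tw F f p) q"
    unfolding dolbeault_tw_def cochain.simps scale by (rule foliated_forms_lincomb[OF F \<phi> \<phi>])
  show "cdiff (dolbeault_tw F f p) q \<phi> \<in> cdeg (dolbeault_tw F f p) (q + 1)"
    unfolding dolbeault_tw_def cochain.simps by (rule dbar_tw_mem[OF F f \<phi>])
  show "cdiff (dolbeault_tw F f p) (q + 1) (cdiff (dolbeault_tw F f p) q \<phi>) = 0"
    unfolding dolbeault_tw_def cochain.simps by (rule dbar_tw_dbar_tw[OF F f \<phi>])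
  show "cdiff (dolbeault_tw F f p) q (cscale (dolbeault_tw F f p) c \<phi>) =
      cscale (dolbeault_tw F f p) c (cdiff (dolbeault_tw F f p) q \<phi>)"
    unfolding dolbeault_tw_def cochain.simps scale using dbar_tw_lincomb[OF F \<phi> \<phi>, of f c 0]
    by (simp add: fun_eq_iff)
  assume "\<psi> \<in> cdeg (dolbeault_tw F f p) q"
  then have \<psi>: "\<psi> \<in> foliated_forms F p q" by (simp add: dolbeault_tw_def)
  show "\<phi> - \<psi> \<in> cdeg (dolbeault_tw F f p) q"
    unfolding dolbeault_tw_def cochain.simps diff by (rule foliated_forms_lincomb[OF F \<phi> \<psi>])
  show "cdiff (dolbeault_tw F f p) q (\<phi> - \<psi>) =
      cdiff (dolbeault_tw F f p) q \<phi> - cdiff (dolbeault_tw F f p) q \<psi>"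
    unfolding dolbeault_tw_def cochain.simps diff using dbar_tw_lincomb[OF F \<phi> \<psi>, of f 1 "-1"]
    by (simp add: fun_eq_iff)
qed

lemma morphism_chart_exists:
  assumes F: "complex_foliation F" and F': "complex_foliation F'" and mor: "foliation_morphism F F' h"
    and "i \<in> idx F" "y \<in> dom_ch F i"
  obtains j where "j \<in> idx F'" "y \<in> loc_dom F F' h i j"
proof -
  have "continuous_map (man F) (man F') h"
    using mor by (simp add: foliation_morphism_def smooth_map_def)
  then have "h (chart F i y) \<in> topspace (man F')"
    using chart_topspace[OF F assms(4,5)] by (auto simp: continuous_map_def)
  then obtain j where "j \<in> idx F'" "h (chart F i y) \<in> img_ch F' j"
    using foliation_cover[OF F'] by auto
  then show thesis using that loc_domI assms(5) by metis
qed

lemma smooth_function_compose: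
  assumes F: "complex_foliation F" and F': "complex_foliation F'" and mor: "foliation_morphism F F' h"
    and f: "smooth_function F' f"
  shows "smooth_function F (f \<circ> h)"
  unfolding smooth_function_def
proof
  fix i assume i: "i \<in> idx F"
  show "smooth_on (ldim F) (cdim F) (dom_ch F i) (\<lambda>y. (f \<circ> h) (chart F i y))"
  proof (rule smooth_on_local[OF coord_open_subset[OF foliationD(1)[OF F i]]])
    fix y assume "y \<in> dom_ch F i"
    then obtain j where j: "j \<in> idx F'" "y \<in> loc_dom F F' h i j"
      by (rule morphism_chart_exists[OF F F' mor i])
    note G = leaf_map_morphism[OF F i F' j(1) mor]
    have "smooth_on (ldim F) (cdim F) (loc_dom F F' h i j) (\<lambda>y. (f \<circ> h) (chart F i y))"
    proof (rule smooth_on_cong[OF leaf_mapD(1)[OF G], THEN iffD2])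
      show "(f \<circ> h) (chart F i y) = f (chart F' j (loc F F' h i j y))" if "y \<in> loc_dom F F' h i j" for y
        using loc_mem(3)[OF that] by simp
      show "smooth_on (ldim F) (cdim F) (loc_dom F F' h i j) (\<lambda>y. f (chart F' j (loc F F' h i j y)))"
        by (rule smooth_on_leaf_map[OF G smooth_functionD[OF f j(1)]])
    qed
    then show "\<exists>V. coord_open (ldim F) (cdim F) V \<and> y \<in> V \<and>
        smooth_on (ldim F) (cdim F) V (\<lambda>y. (f \<circ> h) (chart F i y))"
      using leaf_mapD(1)[OF G] j(2) by blast
  qed
qed

text \<open>
  The chart selected in the definition of \<open>pullback\<close> can be exchanged for any other one around the
  image point: the local expressions of the form differ by the pullback along a coordinate change,
  and pullback is functorial.
\<close>

lemma pullback_eq_pull: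
  assumes F: "complex_foliation F" "i \<in> idx F" and F': "complex_foliation F'" "j \<in> idx F'"
    and mor: "foliation_morphism F F' h" and \<phi>: "\<phi> \<in> foliated_forms F' p q"
    and y: "y \<in> loc_dom F F' h i j"
  shows "pullback F F' h \<phi> i y = pull (ldim F) (loc F F' h i j) (\<phi> j) y"
proof
  fix ws
  define k where "k = (SOME j. j \<in> idx F' \<and> h (chart F i y) \<in> img_ch F' j)"
  have "\<exists>j. j \<in> idx F' \<and> h (chart F i y) \<in> img_ch F' j" using F'(2) y by (auto simp: loc_dom_def)
  from someI_ex[OF this] have k: "k \<in> idx F'" "h (chart F i y) \<in> img_ch F' k" by (auto simp: k_def)
  let ?Gk = "loc F F' h i k" and ?Gj = "loc F F' h i j" and ?T = "loc F' F' id k j"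
  let ?U = "loc_dom F F' h i k \<inter> loc_dom F F' h i j"
  have yk: "y \<in> loc_dom F F' h i k" using k y by (simp add: loc_dom_def)
  note Gk = leaf_map_morphism[OF F F'(1) k(1) mor] and Gj = leaf_map_morphism[OF F F' mor]
    and T = leaf_map_transition[OF F'(1) k(1) F'(2)]
  have Tdom: "?Gk y \<in> loc_dom F' F' id k j" if "y \<in> ?U" for y
    using that loc_mem[of y F F' h i k] loc_mem[of y F F' h i j]
    by (intro loc_domI) (auto simp: img_ch_def intro: rev_image_eqI)
  have comp: "?Gj y = ?T (?Gk y)" if "y \<in> ?U" for y
  proof (rule loc_eqI[OF F'])
    show "?T (?Gk y) \<in> dom_ch F' j" "chart F' j (?T (?Gk y)) = h (chart F i y)"
      using loc_mem[OF Tdom[OF that]] loc_mem[of y F F' h i k] that by auto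
  qed
  have Gk': "leaf_map (ldim F) (cdim F) (ldim F') (cdim F') ?U (loc_dom F' F' id k j) ?Gk"
    using Tdom leaf_mapD(1)[OF Gk] leaf_mapD(1)[OF Gj]
    by (intro leaf_map_restrict[OF Gk _ _ leaf_mapD(1)[OF T]]) auto
  have "pullback F F' h \<phi> i y ws = \<phi> k (?Gk y) (map (leaf_diff (ldim F) ?Gk y) ws)"
    using F(2) loc_mem(1)[OF y] by (simp add: pullback_def k_def Let_def)
  also have "\<dots> = pull (ldim F') ?T (\<phi> j) (?Gk y) (map (leaf_diff (ldim F) ?Gk y) ws)"
    using foliated_formsD(2)[OF F'(1) \<phi> k(1) F'(2) Tdom] yk y by simp
  also have "\<dots> = pull (ldim F) ?Gj (\<phi> j) y ws"
    using yk y by (intro pull_comp[OF Gk' T _ comp, symmetric]) auto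
  finally show "pullback F F' h \<phi> i y ws = pull (ldim F) ?Gj (\<phi> j) y ws" .
qed

lemma pullback_outside: "i \<notin> idx F \<or> y \<notin> dom_ch F i \<Longrightarrow> pullback F F' h \<phi> i y = (\<lambda>ws. 0)"
  by (auto simp: pullback_def fun_eq_iff)

text \<open>
  The local expressions over two source charts are compared through one target chart, in which both
  are pullbacks of the same local form.
\<close>

lemma pullback_mem:
  assumes F: "complex_foliation F" and F': "complex_foliation F'"
    and mor: "foliation_morphism F F' h" and \<phi>: "\<phi> \<in> foliated_forms F' p q"
  shows "pullback F F' h \<phi> \<in> foliated_forms F p q"
  unfolding foliated_forms_iff[OF F]
proof (intro conjI ballI allI impI)
  note D = foliated_formsD[OF F' \<phi>]
  fix i assume i: "i \<in> idx F"
  have local: "local_form (ldim F) (cdim F) p q (loc_dom F F' h i j) (pull (ldim F) (loc F F' h i j) (\<phi> j))"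
    if "j \<in> idx F'" for j
    by (rule local_form_pull[OF leaf_map_morphism[OF F i F' that mor] D(1)[OF that]])
  note eq = pullback_eq_pull[OF F i F' _ mor \<phi>]
  show "local_form (ldim F) (cdim F) p q (dom_ch F i) (pullback F F' h \<phi> i)"
    unfolding local_form_def
  proof (intro conjI ballI allI)
    fix y assume "y \<in> dom_ch F i"
    then obtain j where j: "j \<in> idx F'" "y \<in> loc_dom F F' h i j"
      by (rule morphism_chart_exists[OF F F' mor i])
    show "pq_form (ldim F) p q (pullback F F' h \<phi> i y)"
      unfolding eq[OF j] by (rule local_formD(1)[OF local[OF j(1)] j(2)])
  next
    fix ws
    show "smooth_on (ldim F) (cdim F) (dom_ch F i) (\<lambda>y. pullback F F' h \<phi> i y ws)"
    proof (rule smooth_on_local[OF coord_open_subset[OF foliationD(1)[OF F i]]])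
      fix y assume "y \<in> dom_ch F i"
      then obtain j where j: "j \<in> idx F'" "y \<in> loc_dom F F' h i j"
        by (rule morphism_chart_exists[OF F F' mor i])
      note U = leaf_mapD(1)[OF leaf_map_morphism[OF F i F' j(1) mor]]
      have "smooth_on (ldim F) (cdim F) (loc_dom F F' h i j) (\<lambda>y. pullback F F' h \<phi> i y ws)"
        using smooth_on_cong[OF U, of "\<lambda>y. pullback F F' h \<phi> i y ws"
            "\<lambda>y. pull (ldim F) (loc F F' h i j) (\<phi> j) y ws"]
          eq[OF j(1)] local_formD(2)[OF local[OF j(1)]] by simp
      then show "\<exists>V. coord_open (ldim F) (cdim F) V \<and> y \<in> V \<and>
          smooth_on (ldim F) (cdim F) V (\<lambda>y. pullback F F' h \<phi> i y ws)"
        using U j(2) by blast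
    qed
  qed
  fix i2 y assume i2: "i2 \<in> idx F" and y: "y \<in> loc_dom F F id i i2"
  let ?T = "loc F F id i i2"
  note T = leaf_map_transition[OF F i i2]
  obtain j where j: "j \<in> idx F'" "y \<in> loc_dom F F' h i j"
    using morphism_chart_exists[OF F F' mor i loc_mem(1)[OF y]] .
  let ?U = "loc_dom F F id i i2 \<inter> loc_dom F F' h i j"
  note Gi = leaf_map_morphism[OF F i F' j(1) mor] and G2 = leaf_map_morphism[OF F i2 F' j(1) mor]
  have Tdom: "?T y \<in> loc_dom F F' h i2 j" if "y \<in> ?U" for y
    using that loc_mem[of y F F id i i2] by (auto simp: loc_dom_def[of F F'])
  have comp: "loc F F' h i j y = loc F F' h i2 j (?T y)" if "y \<in> ?U" for y
    using loc_mem(3)[of y F F id i i2] that by (simp add: loc_def[of F F'])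
  have T': "leaf_map (ldim F) (cdim F) (ldim F) (cdim F) ?U (loc_dom F F' h i2 j) ?T"
    using Tdom leaf_mapD(1)[OF T] leaf_mapD(1)[OF Gi]
    by (intro leaf_map_restrict[OF T _ _ leaf_mapD(1)[OF G2]]) auto
  have yU: "y \<in> ?U" using y j by simp
  show "pullback F F' h \<phi> i y = pull (ldim F) ?T (pullback F F' h \<phi> i2) y"
  proof
    fix ws
    have "pullback F F' h \<phi> i y ws = pull (ldim F) (loc F F' h i j) (\<phi> j) y ws"
      by (simp add: eq[OF j])
    also have "\<dots> = pull (ldim F) (loc F F' h i2 j) (\<phi> j) (?T y) (map (leaf_diff (ldim F) ?T y) ws)"
      by (rule pull_comp[OF T' G2 yU comp])
    also have "\<dots> = pull (ldim F) ?T (pullback F F' h \<phi> i2) y ws"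
      by (simp add: pull_def[of _ ?T] pullback_eq_pull[OF F i2 F' j(1) mor \<phi> Tdom[OF yU]])
    finally show "pullback F F' h \<phi> i y ws = pull (ldim F) ?T (pullback F F' h \<phi> i2) y ws" .
  qed
qed (rule pullback_outside)

lemma pullback_dbar_tw:
  assumes F: "complex_foliation F" and F': "complex_foliation F'"
    and mor: "foliation_morphism F F' h" and f: "smooth_function F' f" and \<phi>: "\<phi> \<in> foliated_forms F' p q"
  shows "pullback F F' h (dbar_tw F' f p q \<phi>) = dbar_tw F (f \<circ> h) p q (pullback F F' h \<phi>)"
proof (intro ext)
  fix i y ws
  note d_eq = dbar_tw_eq[OF F pullback_mem[OF F F' mor \<phi>]]
  show "pullback F F' h (dbar_tw F' f p q \<phi>) i y ws = dbar_tw F (f \<circ> h) p q (pullback F F' h \<phi>) i y ws"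
  proof (cases "i \<in> idx F \<and> y \<in> dom_ch F i")
    case True
    then have i: "i \<in> idx F" and "y \<in> dom_ch F i" by auto
    then obtain j where j: "j \<in> idx F'" "y \<in> loc_dom F F' h i j"
      using morphism_chart_exists[OF F F' mor i] by blast
    let ?G = "loc F F' h i j"
    note G = leaf_map_morphism[OF F i F' j(1) mor]
    have "dbar_tw F (f \<circ> h) p q (pullback F F' h \<phi>) i y ws =
        tw_dbar (ldim F) (of_int (p + q)) (\<lambda>y. (f \<circ> h) (chart F i y)) (pullback F F' h \<phi> i) y ws"
      using True by (simp add: d_eq)
    also have "\<dots> = tw_dbar (ldim F) (of_int (p + q)) (\<lambda>y. f (chart F' j (?G y))) (pull (ldim F) ?G (\<phi> j)) y ws"
      using loc_mem(3)[of _ F F' h i j] pullback_eq_pull[OF F i F' j(1) mor \<phi>]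
      by (intro fun_cong[OF tw_dbar_cong[OF leaf_mapD(1)[OF G] j(2)]]) auto
    also have "\<dots> = pull (ldim F) ?G (tw_dbar (ldim F') (of_int (p + q)) (\<lambda>y. f (chart F' j y)) (\<phi> j)) y ws"
      by (rule tw_dbar_pull[OF G j(2) foliated_formsD(1)[OF F' \<phi> j(1)] smooth_functionD[OF f j(1)]])
    also have "\<dots> = pull (ldim F) ?G (dbar_tw F' f p q \<phi> j) y ws"
      using j(1) loc_mem(2)[OF j(2)] by (simp add: pull_def dbar_tw_eq[OF F' \<phi>])
    also have "\<dots> = pullback F F' h (dbar_tw F' f p q \<phi>) i y ws"
      by (simp add: pullback_eq_pull[OF F i F' j(1) mor dbar_tw_mem[OF F' f \<phi>] j(2)])
    finally show ?thesis by simp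
  next
    case False
    then have "pullback F F' h (dbar_tw F' f p q \<phi>) i y = (\<lambda>ws. 0)" by (intro pullback_outside) auto
    then show ?thesis using False by (auto simp: d_eq)
  qed
qed

section \<open>The long exact sequence of a morphism\<close>

lemma cochain_map_pullback:
  assumes F: "complex_foliation F" and F': "complex_foliation F'"
    and mor: "foliation_morphism F F' h" and f: "smooth_function F' f"
  shows "cochain_map (dolbeault_tw F' f p) (dolbeault_tw F (f \<circ> h) p) (pullback F F' h)"
proof (intro cochain_map.intro cochain_map_axioms.intro)
  show "cochain_complex (dolbeault_tw F' f p)" "cochain_complex (dolbeault_tw F (f \<circ> h) p)"
    by (intro cochain_complex_dolbeault_tw F F' f smooth_function_compose[OF F F' mor])+
  show "pullback F F' h (\<phi> - \<psi>) = pullback F F' h \<phi> - pullback F F' h \<psi>" for \<phi> \<psi>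
    by (auto simp: fun_eq_iff pullback_def Let_def)
  show "pullback F F' h (cscale (dolbeault_tw F' f p) c \<phi>) =
      cscale (dolbeault_tw F (f \<circ> h) p) c (pullback F F' h \<phi>)" for c \<phi>
    by (auto simp: fun_eq_iff pullback_def Let_def dolbeault_tw_def form_scale_def)
  fix \<phi> q assume "\<phi> \<in> cdeg (dolbeault_tw F' f p) q"
  then have \<phi>: "\<phi> \<in> foliated_forms F' p q" by (simp add: dolbeault_tw_def)
  show "pullback F F' h \<phi> \<in> cdeg (dolbeault_tw F (f \<circ> h) p) q"
    using pullback_mem[OF F F' mor \<phi>] by (simp add: dolbeault_tw_def)
  show "pullback F F' h (cdiff (dolbeault_tw F' f p) q \<phi>) =
      cdiff (dolbeault_tw F (f \<circ> h) p) q (pullback F F' h \<phi>)"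
    using pullback_dbar_tw[OF F F' mor f \<phi>] by (simp add: dolbeault_tw_def)
qed

lemma relative_tw_eq_cone:
  "relative_tw F F' h f p = mapping_cone (dolbeault_tw F' f p) (dolbeault_tw F (f \<circ> h) p) (pullback F F' h)"
  by (simp add: relative_tw_def mapping_cone_def dolbeault_tw_def)

theorem mainTheorem4:
  fixes F :: "('a, 'i) foliation" and F' :: "('b, 'j) foliation"
    and \<mu> :: "'a \<Rightarrow> 'b" and f' :: "'b \<Rightarrow> complex" and p :: int
  assumes "complex_foliation F" and "complex_foliation F'"
    and "foliation_morphism F F' \<mu>"
    and "smooth_function F' f'"
  defines "K \<equiv> dolbeault_tw F (f' \<circ> \<mu>) p"
    and "K' \<equiv> dolbeault_tw F' f' p"
    and "R \<equiv> relative_tw F F' \<mu> f' p"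
  defines "\<alpha> \<equiv> \<lambda>\<psi>. (0, \<psi>)"
    and "\<beta> \<equiv> fst"
    and "\<mu>s \<equiv> pullback F F' \<mu>"
  shows "\<forall>q::int.
     induces_linear K (q - 1) R q \<alpha> \<and>
     induces_linear R q K' q \<beta> \<and>
     induces_linear K' q K q \<mu>s \<and>
     kernel (cohomology R q) (cohomology K' q) (induced K' q \<beta>) =
       induced R q \<alpha> ` carrier (cohomology K (q - 1)) \<and>
     kernel (cohomology K' q) (cohomology K q) (induced K q \<mu>s) =
       induced K' q \<beta> ` carrier (cohomology R q) \<and>
     kernel (cohomology K q) (cohomology R (q + 1)) (induced R (q + 1) \<alpha>) =
       induced K q \<mu>s ` carrier (cohomology K' q)"
proof -
  interpret cochain_map K' K \<mu>s
    unfolding K'_def K_def \<mu>s_def by (rule cochain_map_pullback[OF assms(1-4)])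
  have R: "R = mapping_cone K' K \<mu>s"
    unfolding R_def K'_def K_def \<mu>s_def by (rule relative_tw_eq_cone)
  show ?thesis
    unfolding R \<alpha>_def \<beta>_def
    by (intro allI conjI induces_linear_inclusion induces_linear_projection induces_linear_self
        exact_at_cone exact_at_target exact_at_source)
qed

end
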